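(* Let $\Omega\subset\mathbb{R}^N$ be a connected domain and let $V:\Omega\to\mathbb{R}$ be continuous with $$\int_{\Omega}\Big(|\nabla u(x)|^2+V(x)|u(x)|^2\Big)\,dx\ge 0\quad\text{for all }u\in C_0^\infty(\Omega).$$ Let $S$ be the Friedrichs extension in $L^2(\Omega)$ of $S_{\min}=(-\Delta+V)|_{C_0^\infty(\Omega)}$. Assume that there exists a constant $\alpha_*\in(0,\frac12]$ such that for every $g\in C_0^\infty(\Omega)$ the solution $W_S(\cdot)g$ satisfies $t^{2\alpha_*-1}W_S(\cdot)g\in L^\infty(0,\infty;L^2(\Omega))$. Then $(0,\alpha_* )\subset I_S$.
   Context: $N\ge 1$. The Friedrichs extension $S$ is a nonnegative selfadjoint operator in $L^2(\Omega)$; $S^\alpha$ denotes its fractional power (spectral functional calculus). For an operator $A$ with domain $D(A)$, $R(A)=\{Au : u\in D(A)\}$ is its range. $[L^2(\Omega)]_+=\{f\in L^2(\Omega) : f\ge 0 \text{ (a.e.)}\}$. Define $$I_S=\big\{\alpha>0 : R(S^{\alpha})\cap [L^2(\Omega)]_{+}\neq\{0\}\big\}.$$ $W_S(\cdot)g$ denotes the solution $w$ of the wave equation $\partial_t^2w-\Delta w+Vw=0$ in $\Omega\times(0,\infty)$ with $w=0$ on $\partial\Omega\times(0,\infty)$ and $(w,\partial_tw)(\cdot,0)=(0,g)$, understood as the unique solution in $L^2(\Omega)$ of $w''(t)+Sw(t)=0$, $w(0)=0$, $w'(0)=g$; equivalently, $W_S(t)g=\phi_t(S)g$ by functional calculus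 with $\phi_t(\lambda)=\sin(t\sqrt\lambda)/\sqrt\lambda$ for $\lambda>0$ and $\phi_t(0)=t$. *)

theory Defs
  imports "HOL-Analysis.Analysis"
begin

section \<open>The Hilbert space of square-integrable functions\<close>

text \<open>Scalars are real: the Schroedinger operator has a real potential, so it and all functions of it
  commute with complex conjugation and act on real and imaginary parts separately. Borel representatives lose nothing: every Lebesgue measurable function agrees
  almost everywhere with a Borel one.\<close>

definition sq_integrable :: "('a::euclidean_space \<Rightarrow> real) \<Rightarrow> bool" where
  "sq_integrable f \<longleftrightarrow> f \<in> borel_measurable lborel \<and> integrable lborel (\<lambda>x. (f x)\<^sup>2)"

lemma sq_integrable_mult:
  assumes "sq_integrable f" "sq_integrable g"
  shows "integrable lborel (\<lambda>x. f x * g x)"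
proof (rule Bochner_Integration.integrable_bound)
  show "integrable lborel (\<lambda>x. (f x)\<^sup>2 + (g x)\<^sup>2)"
    using assms by (auto simp: sq_integrable_def)
  show "(\<lambda>x. f x * g x) \<in> borel_measurable lborel"
    using assms by (auto simp: sq_integrable_def)
  have "\<bar>a * b\<bar> \<le> a\<^sup>2 + b\<^sup>2" for a b :: real
  proof -
    have "2 * (\<bar>a\<bar> * \<bar>b\<bar>) \<le> a\<^sup>2 + b\<^sup>2"
      using sum_squares_bound[of "\<bar>a\<bar>" "\<bar>b\<bar>"] by simp
    moreover have "0 \<le> \<bar>a\<bar> * \<bar>b\<bar>" by simp
    ultimately show ?thesis unfolding abs_mult by linarith
  qed
  then show "AE x in lborel. norm (f x * g x) \<le> norm ((f x)\<^sup>2 + (g x)\<^sup>2)"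
    by (auto intro: order_trans[OF _ abs_ge_self])
qed

lemma sq_integrable_add:
  assumes "sq_integrable f" "sq_integrable g"
  shows "sq_integrable (\<lambda>x. f x + g x)"
proof -
  have "integrable lborel (\<lambda>x. (f x)\<^sup>2 + (g x)\<^sup>2 + 2 * (f x * g x))"
    using assms sq_integrable_mult[OF assms] by (auto simp: sq_integrable_def)
  moreover have "(\<lambda>x. (f x)\<^sup>2 + (g x)\<^sup>2 + 2 * (f x * g x)) = (\<lambda>x. (f x + g x)\<^sup>2)"
    by (auto simp: power2_sum algebra_simps)
  ultimately show ?thesis
    using assms by (auto simp: sq_integrable_def)
qed

lemma sq_integrable_scale: "sq_integrable f \<Longrightarrow> sq_integrable (\<lambda>x. c * f x)"
  by (auto simp: sq_integrable_def power_mult_distrib)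

lemma sq_integrable_zero: "sq_integrable (\<lambda>x. 0)"
  by (auto simp: sq_integrable_def)

definition l2_rel :: "('a::euclidean_space \<Rightarrow> real) \<Rightarrow> ('a \<Rightarrow> real) \<Rightarrow> bool" where
  "l2_rel f g \<longleftrightarrow> sq_integrable f \<and> sq_integrable g \<and> (AE x in lborel. f x = g x)"

lemma part_equivp_l2_rel: "part_equivp l2_rel"
proof (rule part_equivpI)
  show "\<exists>f. l2_rel f f"
    using sq_integrable_zero by (auto simp: l2_rel_def)
  show "symp l2_rel"
    by (rule sympI) (auto simp: l2_rel_def elim: AE_mp)
  show "transp l2_rel"
    by (rule transpI) (auto simp: l2_rel_def elim: AE_mp)
qed

quotient_type (overloaded) 'a l2 = "'a::euclidean_space \<Rightarrow> real" / partial: l2_rel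
  morphisms rep_l2 class_of
  by (rule part_equivp_l2_rel)

instantiation l2 :: (euclidean_space) real_vector
begin

lift_definition zero_l2 :: "'a l2" is "\<lambda>x. 0"
  by (simp add: l2_rel_def sq_integrable_zero)

lift_definition plus_l2 :: "'a l2 \<Rightarrow> 'a l2 \<Rightarrow> 'a l2" is "\<lambda>f g x. f x + g x"
  by (auto simp: l2_rel_def sq_integrable_add)

lift_definition scaleR_l2 :: "real \<Rightarrow> 'a l2 \<Rightarrow> 'a l2" is "\<lambda>c f x. c * f x"
  by (auto simp: l2_rel_def sq_integrable_scale)

lift_definition uminus_l2 :: "'a l2 \<Rightarrow> 'a l2" is "\<lambda>f x. - f x"
  using sq_integrable_scale[of _ "-1"] by (auto simp: l2_rel_def)

definition minus_l2 :: "'a l2 \<Rightarrow> 'a l2 \<Rightarrow> 'a l2" where "minus_l2 u v = u + - v"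

instance
proof
  fix u v w :: "'a l2" and a b :: real
  show "u + v + w = u + (v + w)"
    by transfer (auto simp: l2_rel_def algebra_simps sq_integrable_add)
  show "u + v = v + u"
    by transfer (auto simp: l2_rel_def algebra_simps sq_integrable_add)
  show "0 + u = u"
    by transfer (auto simp: l2_rel_def)
  show "- u + u = 0"
    by transfer (auto simp: l2_rel_def sq_integrable_zero)
  show "u - v = u + - v"
    by (simp add: minus_l2_def)
  show "a *\<^sub>R (u + v) = a *\<^sub>R u + a *\<^sub>R v"
    by transfer (auto simp: l2_rel_def algebra_simps intro!: sq_integrable_add sq_integrable_scale)
  show "(a + b) *\<^sub>R u = a *\<^sub>R u + b *\<^sub>R u"
    by transfer (auto simp: l2_rel_def algebra_simps intro!: sq_integrable_add sq_integrable_scale)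
  show "a *\<^sub>R b *\<^sub>R u = (a * b) *\<^sub>R u"
    by transfer (auto simp: l2_rel_def mult.assoc intro!: sq_integrable_scale)
  show "1 *\<^sub>R u = u"
    by transfer (auto simp: l2_rel_def)
qed

end

instantiation l2 :: (euclidean_space) real_inner
begin

lift_definition inner_l2 :: "'a l2 \<Rightarrow> 'a l2 \<Rightarrow> real" is "\<lambda>f g. \<integral>x. f x * g x \<partial>lborel"
proof -
  fix f f' g g' :: "'a \<Rightarrow> real"
  assume f: "l2_rel f f'" and g: "l2_rel g g'"
  show "(\<integral>x. f x * g x \<partial>lborel) = (\<integral>x. f' x * g' x \<partial>lborel)"
  proof (rule integral_cong_AE)
    show "AE x in lborel. f x * g x = f' x * g' x"
      using f g unfolding l2_rel_def by auto
  qed (use f g in \<open>auto simp: l2_rel_def sq_integrable_def\<close>)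
qed

definition norm_l2 :: "'a l2 \<Rightarrow> real" where "norm_l2 u = sqrt (inner u u)"
definition sgn_l2 :: "'a l2 \<Rightarrow> 'a l2" where "sgn_l2 u = u /\<^sub>R norm u"
definition dist_l2 :: "'a l2 \<Rightarrow> 'a l2 \<Rightarrow> real" where "dist_l2 u v = norm (u - v)"
definition uniformity_l2 :: "('a l2 \<times> 'a l2) filter" where
  "uniformity_l2 = (INF e\<in>{0<..}. principal {(u, v). dist u v < e})"
definition open_l2 :: "'a l2 set \<Rightarrow> bool" where
  "open_l2 U \<longleftrightarrow> (\<forall>x\<in>U. \<forall>\<^sub>F (x', y) in uniformity. x' = x \<longrightarrow> y \<in> U)"

instance
proof
  fix u v w :: "'a l2" and a :: real and U :: "'a l2 set"
  show "sgn u = u /\<^sub>R norm u" "dist u v = norm (u - v)" "norm u = sqrt (inner u u)"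
    by (simp_all add: sgn_l2_def dist_l2_def norm_l2_def)
  show "(uniformity :: ('a l2 \<times> 'a l2) filter) = (INF e\<in>{0<..}. principal {(u, v). dist u v < e})"
    by (simp add: uniformity_l2_def)
  show "open U \<longleftrightarrow> (\<forall>x\<in>U. \<forall>\<^sub>F (x', y) in uniformity. x' = x \<longrightarrow> y \<in> U)"
    by (simp add: open_l2_def)
  show "inner u v = inner v u"
    by transfer (auto simp: mult.commute)
  show "inner (u + v) w = inner u w + inner v w"
    by transfer (auto simp: l2_rel_def distrib_right sq_integrable_mult)
  show "inner (a *\<^sub>R u) v = a * inner u v"
    by transfer (auto simp: mult.assoc)
  show "0 \<le> inner u u"
    by transfer auto
  show "inner u u = 0 \<longleftrightarrow> u = 0"
  proof transfer
    fix f :: "'a \<Rightarrow> real"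
    assume "l2_rel f f"
    then have f: "sq_integrable f" by (simp add: l2_rel_def)
    have "(\<integral>x. f x * f x \<partial>lborel) = 0 \<longleftrightarrow> (AE x in lborel. f x * f x = 0)"
      by (rule integral_nonneg_eq_0_iff_AE) (auto intro: sq_integrable_mult f)
    then show "(\<integral>x. f x * f x \<partial>lborel) = 0 \<longleftrightarrow> l2_rel f (\<lambda>x. 0)"
      using f by (simp add: l2_rel_def sq_integrable_zero)
  qed
qed

end

lift_definition vanishes_off :: "'a::euclidean_space set \<Rightarrow> 'a l2 \<Rightarrow> bool" is
  "\<lambda>\<Omega> f. AE x in lborel. x \<notin> \<Omega> \<longrightarrow> f x = 0"
  by (auto simp: l2_rel_def elim: AE_mp)

lift_definition nonneg_ae :: "'a::euclidean_space l2 \<Rightarrow> bool" is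
  "\<lambda>f. AE x in lborel. 0 \<le> f x"
  by (auto simp: l2_rel_def elim: AE_mp)

text \<open>The space over a domain is realised, by extension by zero, as a closed subspace of the space
  over the whole Euclidean space.\<close>

definition L2 :: "'a::euclidean_space set \<Rightarrow> 'a l2 set" where
  "L2 \<Omega> = {u. vanishes_off \<Omega> u}"

definition L2_nonneg :: "'a::euclidean_space set \<Rightarrow> 'a l2 set" where
  "L2_nonneg \<Omega> = {u \<in> L2 \<Omega>. nonneg_ae u}"


section \<open>Test functions and the minimal Schroedinger operator\<close>

definition partial :: "'a::euclidean_space \<Rightarrow> ('a \<Rightarrow> real) \<Rightarrow> 'a \<Rightarrow> real" where
  "partial i f x = frechet_derivative f (at x) i"

primrec Ck :: "nat \<Rightarrow> ('a::euclidean_space \<Rightarrow> real) \<Rightarrow> bool" where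
  "Ck 0 f \<longleftrightarrow> continuous_on UNIV f"
| "Ck (Suc k) f \<longleftrightarrow> (\<forall>x. f differentiable at x) \<and> (\<forall>i\<in>Basis. Ck k (partial i f))"

definition test_functions :: "'a::euclidean_space set \<Rightarrow> ('a \<Rightarrow> real) set" where
  "test_functions \<Omega> = {\<phi>. (\<forall>k. Ck k \<phi>) \<and> compact (closure {x. \<phi> x \<noteq> 0}) \<and> closure {x. \<phi> x \<noteq> 0} \<subseteq> \<Omega>}"

definition grad :: "('a::euclidean_space \<Rightarrow> real) \<Rightarrow> 'a \<Rightarrow> 'a" where
  "grad f x = (\<Sum>i\<in>Basis. partial i f x *\<^sub>R i)"

definition laplacian :: "('a::euclidean_space \<Rightarrow> real) \<Rightarrow> 'a \<Rightarrow> real" where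
  "laplacian f x = (\<Sum>i\<in>Basis. partial i (partial i f) x)"

text \<open>Unbounded operators are represented by their graphs.\<close>

definition S_min :: "'a::euclidean_space set \<Rightarrow> ('a \<Rightarrow> real) \<Rightarrow> ('a l2 \<times> 'a l2) set" where
  "S_min \<Omega> V = {(class_of \<phi>, class_of (\<lambda>x. - laplacian \<phi> x + V x * \<phi> x)) | \<phi>. \<phi> \<in> test_functions \<Omega>}"


section \<open>Friedrichs extension\<close>

text \<open>For a nonnegative symmetric operator \<open>T\<close>, the sequence \<open>s\<close> in the graph of \<open>T\<close> approximates \<open>u\<close>
  in the sense of the closure of the quadratic form \<open>u \<mapsto> T u \<bullet> u\<close>.\<close>

definition form_approx :: "('h::real_inner \<times> 'h) set \<Rightarrow> (nat \<Rightarrow> 'h \<times> 'h) \<Rightarrow> 'h \<Rightarrow> bool" where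
  "form_approx T s u \<longleftrightarrow> (\<forall>n. s n \<in> T) \<and> (\<lambda>n. fst (s n)) \<longlonglongrightarrow> u \<and>
     (\<forall>e>0. \<exists>M. \<forall>m\<ge>M. \<forall>n\<ge>M. (snd (s m) - snd (s n)) \<bullet> (fst (s m) - fst (s n)) < e)"

definition form_domain :: "('h::real_inner \<times> 'h) set \<Rightarrow> 'h set" where
  "form_domain T = {u. \<exists>s. form_approx T s u}"

text \<open>The closed form is \<open>q(u, v) = lim (T s\<^sub>n \<bullet> r\<^sub>n)\<close> for sequences approximating \<open>u\<close> and \<open>v\<close>;
  the Friedrichs extension is the operator associated with it in the Hilbert space \<open>K\<close>:
  \<open>u\<close> is mapped to \<open>f\<close> if \<open>q(u, v) = f \<bullet> v\<close> for all \<open>v\<close> in the form domain.\<close>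

definition friedrichs :: "'h::real_inner set \<Rightarrow> ('h \<times> 'h) set \<Rightarrow> ('h \<times> 'h) set" where
  "friedrichs K T = {(u, f). u \<in> form_domain T \<and> f \<in> K \<and>
     (\<forall>s v r. form_approx T s u \<longrightarrow> form_approx T r v \<longrightarrow>
        (\<lambda>n. snd (s n) \<bullet> fst (r n)) \<longlonglongrightarrow> f \<bullet> v)}"


section \<open>Spectral functional calculus\<close>

text \<open>Projection-valued measures in the closed subspace \<open>K\<close>. The projections act on the ambient space,
  and the listed properties force them to vanish on the orthogonal complement of \<open>K\<close>.\<close>

definition projection_valued_measure :: "'h::real_inner set \<Rightarrow> (real set \<Rightarrow> 'h \<Rightarrow> 'h) \<Rightarrow> bool" where
  "projection_valued_measure K E \<longleftrightarrow>
     (\<forall>B\<in>sets borel. linear (E B) \<and> range (E B) \<subseteq> K \<and>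
        (\<forall>x. E B (E B x) = E B x) \<and> (\<forall>x y. E B x \<bullet> y = x \<bullet> E B y)) \<and>
     (\<forall>x\<in>K. E UNIV x = x) \<and>
     (\<forall>A x. range A \<subseteq> sets borel \<longrightarrow> disjoint_family A \<longrightarrow>
        (\<lambda>n::nat. E (A n) x) sums E (\<Union>n. A n) x)"

definition scalar_spectral_measure :: "(real set \<Rightarrow> 'h::real_inner \<Rightarrow> 'h) \<Rightarrow> 'h \<Rightarrow> real measure" where
  "scalar_spectral_measure E x = measure_of UNIV (sets borel) (\<lambda>B. ennreal (E B x \<bullet> x))"

definition spectral_domain ::
  "'h::real_inner set \<Rightarrow> (real set \<Rightarrow> 'h \<Rightarrow> 'h) \<Rightarrow> (real \<Rightarrow> real) \<Rightarrow> 'h set" where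
  "spectral_domain K E \<phi> = {x \<in> K. integrable (scalar_spectral_measure E x) (\<lambda>l. (\<phi> l)\<^sup>2)}"

text \<open>The operator \<open>\<integral> \<phi> dE\<close>. The integral of \<open>\<phi>\<close> against the signed measure \<open>B \<mapsto> E B x \<bullet> z\<close> is
  written by polarisation; it suffices to test with \<open>z\<close> in the (dense) domain.\<close>

definition spectral_integral ::
  "'h::real_inner set \<Rightarrow> (real set \<Rightarrow> 'h \<Rightarrow> 'h) \<Rightarrow> (real \<Rightarrow> real) \<Rightarrow> ('h \<times> 'h) set" where
  "spectral_integral K E \<phi> = {(x, y). x \<in> spectral_domain K E \<phi> \<and> y \<in> K \<and>
     (\<forall>z \<in> spectral_domain K E \<phi>.
        y \<bullet> z = ((\<integral>l. \<phi> l \<partial>scalar_spectral_measure E (x + z))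
               - (\<integral>l. \<phi> l \<partial>scalar_spectral_measure E (x - z))) / 4)}"

text \<open>By the spectral theorem, a selfadjoint \<open>S\<close> has a spectral measure, and it is unique on
  Borel sets.\<close>

definition spectral_measure_of ::
  "'h::real_inner set \<Rightarrow> ('h \<times> 'h) set \<Rightarrow> real set \<Rightarrow> 'h \<Rightarrow> 'h" where
  "spectral_measure_of K S =
     (SOME E. projection_valued_measure K E \<and> spectral_integral K E (\<lambda>l. l) = S)"

definition functional_calculus ::
  "'h::real_inner set \<Rightarrow> ('h \<times> 'h) set \<Rightarrow> (real \<Rightarrow> real) \<Rightarrow> ('h \<times> 'h) set" where
  "functional_calculus K S \<phi> = spectral_integral K (spectral_measure_of K S) \<phi>"

definition fractional_power ::
  "'h::real_inner set \<Rightarrow> ('h \<times> 'h) set \<Rightarrow> real \<Rightarrow> ('h \<times> 'h) set" where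
  "fractional_power K S \<alpha> = functional_calculus K S (\<lambda>l. l powr \<alpha>)"

definition I_set :: "'a::euclidean_space set \<Rightarrow> ('a l2 \<times> 'a l2) set \<Rightarrow> real set" where
  "I_set \<Omega> S = {\<alpha>. \<alpha> > 0 \<and> Range (fractional_power (L2 \<Omega>) S \<alpha>) \<inter> L2_nonneg \<Omega> \<noteq> {0}}"


section \<open>The wave equation\<close>

text \<open>\<open>w\<close> solves \<open>w'' + S w = 0\<close> on \<open>[0, \<infinity>)\<close> with \<open>w 0 = 0\<close> and \<open>w' 0 = g\<close>; derivatives at \<open>0\<close> are
  one-sided. For nonnegative selfadjoint \<open>S\<close> there is at most one such \<open>w\<close> on \<open>[0, \<infinity>)\<close>, and for \<open>g\<close> in
  the domain of \<open>S\<close> there is one.\<close>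

definition wave_solution ::
  "('h::real_normed_vector \<times> 'h) set \<Rightarrow> 'h \<Rightarrow> (real \<Rightarrow> 'h) \<Rightarrow> bool" where
  "wave_solution S g w \<longleftrightarrow>
     (\<exists>w' w''. (\<forall>t\<ge>0. (w has_vector_derivative w' t) (at t within {0..}) \<and>
                      (w' has_vector_derivative w'' t) (at t within {0..}) \<and>
                      (w t, - w'' t) \<in> S) \<and>
               w 0 = 0 \<and> w' 0 = g)"

definition Linf_half_line :: "(real \<Rightarrow> 'h::real_normed_vector) set" where
  "Linf_half_line = {f. f \<in> borel_measurable (lebesgue_on {0<..}) \<and>
     (\<exists>C. AE t in lebesgue_on {0<..}. norm (f t) \<le> C)}"

end

theory Submission
  imports Defs "HOL-Probability.Helly_Selection"
begin

text \<open>Let \<open>\<mu>\<close> be the spectral measure of a test function \<open>g\<close>, so that the squared norm of the wave at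
  time \<open>t\<close> is the \<open>\<mu>\<close>-integral of \<open>sin\<^sup>2 (t \<surd>l) / l\<close>. For \<open>t\<close> between \<open>2 ^ k\<close> and \<open>2 ^ (k + 1)\<close> the
  integrand is of size \<open>4 ^ k\<close> on the window of those \<open>l\<close> with \<open>4 ^ - (k + 2) < l \<le> 4 ^ - (k + 1)\<close>, so the
  growth bound \<open>t powr (1 - 2 * \<alpha>s)\<close> forces the window to have mass at most a constant times
  \<open>4 powr (- 2 * k * \<alpha>s)\<close>, and \<open>{0}\<close> to have mass zero. Hence \<open>l powr (- 2 * \<alpha>)\<close> is \<open>\<mu>\<close>-integrable for
  \<open>\<alpha> < \<alpha>s\<close>, that is, \<open>g\<close> lies in the range of the fractional power; \<open>g\<close> is taken to be a nonnegative bump.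

  The spectral measure of the Friedrichs extension \<open>S\<close> is obtained from \<open>A = (1 + S)\<^sup>-\<^sup>1\<close>, which exists
  because minimising sequences of the form converge in the form norm. The operators
  \<open>A ^ k (1 - A) ^ l\<close> are nonnegative, so \<open>n \<mapsto> A ^ n x \<bullet> x\<close> is a Hausdorff moment sequence. The measures
  representing it, weak limits of binomially weighted point masses at \<open>k / n\<close>, are polarised to a
  Borel functional calculus of \<open>A\<close>.\<close>

section \<open>Bounded Borel functions and sigma-continuous functionals\<close>

text \<open>The calculus of \<open>S\<close> is defined through a spectral measure picked by choice,
  so nothing can be said about fractional powers until some spectral measure is known to exist; most
  of the text constructs one. Passing to the bounded operator \<open>A\<close> makes all moments
  finite, and the positivity of \<open>A ^ k (1 - A) ^ l\<close> comes without square roots, by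
  shifting factors in pairs across the inner product. The growth hypothesis concerns solutions of
  the wave equation, so the multiplier \<open>sin (t \<surd>l) / \<surd>l\<close> has to be shown to
  produce one; two derivatives in norm are available because a test function lies in the domain of
  \<open>S\<close>. The bound holds only at almost every time. Hence a good time is selected in each
  dyadic interval, and the spectral window is placed so that \<open>t \<surd>l\<close> stays in
  \<open>{1/4..1}\<close> for every time of that interval; there the sine is bounded below. On the
  \<open>k\<close>-th window \<open>l powr (- 2 * \<alpha>)\<close> is of size
  \<open>4 powr (2 * \<alpha> * k)\<close>, so the series over the windows has ratio
  \<open>4 powr (2 * \<alpha> - 2 * \<alpha>s)\<close>, which is below one exactly when
  \<open>\<alpha> < \<alpha>s\<close>.\<close>

definition bfun :: "(real \<Rightarrow> real) set" where
  "bfun = {f. f \<in> borel_measurable borel \<and> (\<exists>C. \<forall>x. \<bar>f x\<bar> \<le> C)}"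

lemma bfunI: "f \<in> borel_measurable borel \<Longrightarrow> (\<And>x. \<bar>f x\<bar> \<le> C) \<Longrightarrow> f \<in> bfun"
  by (auto simp: bfun_def)

lemma bfun_measurable [measurable_dest]: "f \<in> bfun \<Longrightarrow> f \<in> borel_measurable borel"
  by (auto simp: bfun_def)

lemma bfun_bound:
  assumes "f \<in> bfun"
  obtains C where "0 \<le> C" "\<And>x. \<bar>f x\<bar> \<le> C"
proof -
  from assms obtain C where C: "\<And>x. \<bar>f x\<bar> \<le> C" by (auto simp: bfun_def)
  moreover have "0 \<le> C" using C[of 0] by linarith
  ultimately show ?thesis using that by blast
qed

lemma bfun_const [simp, intro]: "(\<lambda>x. c) \<in> bfun"
  by (rule bfunI[of _ "\<bar>c\<bar>"]) auto

lemma bfun_indicator [simp, intro]: "B \<in> sets borel \<Longrightarrow> indicator B \<in> bfun"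
  by (rule bfunI[of _ 1]) (auto simp: indicator_def)

lemma bfun_add [simp, intro]:
  assumes "f \<in> bfun" "g \<in> bfun" shows "(\<lambda>x. f x + g x) \<in> bfun"
proof -
  obtain C where C: "0 \<le> C" "\<And>x. \<bar>f x\<bar> \<le> C" by (rule bfun_bound[OF assms(1)], rule that)
  obtain D where D: "0 \<le> D" "\<And>x. \<bar>g x\<bar> \<le> D" by (rule bfun_bound[OF assms(2)], rule that)
  have "\<bar>f x + g x\<bar> \<le> C + D" for x
    using C(2)[of x] D(2)[of x] by linarith
  then show ?thesis using assms by (intro bfunI[of _ "C + D"]) (auto intro: bfun_measurable)
qed

lemma bfun_mult [simp, intro]:
  assumes "f \<in> bfun" "g \<in> bfun" shows "(\<lambda>x. f x * g x) \<in> bfun"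
proof -
  obtain C where C: "0 \<le> C" "\<And>x. \<bar>f x\<bar> \<le> C" by (rule bfun_bound[OF assms(1)], rule that)
  obtain D where D: "0 \<le> D" "\<And>x. \<bar>g x\<bar> \<le> D" by (rule bfun_bound[OF assms(2)], rule that)
  have "\<bar>f x * g x\<bar> \<le> C * D" for x
    unfolding abs_mult using C D by (intro mult_mono) auto
  then show ?thesis using assms by (intro bfunI[of _ "C * D"]) (auto intro: bfun_measurable)
qed

lemma bfun_uminus [simp, intro]: "f \<in> bfun \<Longrightarrow> (\<lambda>x. - f x) \<in> bfun"
  using bfun_mult[of "\<lambda>x. -1" f] by simp

lemma bfun_diff [simp, intro]: "f \<in> bfun \<Longrightarrow> g \<in> bfun \<Longrightarrow> (\<lambda>x. f x - g x) \<in> bfun"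
  using bfun_add[of f "\<lambda>x. - g x"] by simp

lemma bfun_power [simp, intro]: "f \<in> bfun \<Longrightarrow> (\<lambda>x. f x ^ n) \<in> bfun"
  by (induction n) auto

lemma bfun_sum [intro]: "(\<And>i. i \<in> I \<Longrightarrow> f i \<in> bfun) \<Longrightarrow> (\<lambda>x. \<Sum>i\<in>I. f i x) \<in> bfun"
  by (induction I rule: infinite_finite_induct) auto

lemma bfun_comp: "f \<in> bfun \<Longrightarrow> h \<in> borel_measurable borel \<Longrightarrow> (\<lambda>x. f (h x)) \<in> bfun"
  by (auto simp: bfun_def)

text \<open>Signed measures enter only through their integrals: polarisation produces differences of
  finite measures, and this class (linear, continuous under bounded pointwise convergence) is closed
  under such differences, under weights and under substitutions.\<close>

definition sfun :: "((real \<Rightarrow> real) \<Rightarrow> real) \<Rightarrow> bool" where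
  "sfun L \<longleftrightarrow>
     (\<forall>f\<in>bfun. \<forall>g\<in>bfun. L (\<lambda>x. f x + g x) = L f + L g) \<and>
     (\<forall>c. \<forall>f\<in>bfun. L (\<lambda>x. c * f x) = c * L f) \<and>
     (\<forall>F f C. (\<forall>n. F n \<in> borel_measurable borel) \<longrightarrow> (\<forall>n x. \<bar>F n x\<bar> \<le> C) \<longrightarrow>
        (\<forall>x. (\<lambda>n::nat. F n x) \<longlonglongrightarrow> f x) \<longrightarrow> (\<lambda>n. L (F n)) \<longlonglongrightarrow> L f)"

lemma sfun_add: "sfun L \<Longrightarrow> f \<in> bfun \<Longrightarrow> g \<in> bfun \<Longrightarrow> L (\<lambda>x. f x + g x) = L f + L g"
  and sfun_scale: "sfun L \<Longrightarrow> f \<in> bfun \<Longrightarrow> L (\<lambda>x. c * f x) = c * L f"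
  and sfun_lim: "sfun L \<Longrightarrow> (\<And>n. F n \<in> borel_measurable borel) \<Longrightarrow> (\<And>n x. \<bar>F n x\<bar> \<le> C) \<Longrightarrow>
     (\<And>x. (\<lambda>n::nat. F n x) \<longlonglongrightarrow> f x) \<Longrightarrow> (\<lambda>n. L (F n)) \<longlonglongrightarrow> L f"
  unfolding sfun_def by blast+

lemma sfun_zero: "sfun L \<Longrightarrow> L (\<lambda>x. 0) = 0"
  using sfun_scale[of L "\<lambda>x. 0" 0] by simp

lemma sfun_diff: "sfun L \<Longrightarrow> f \<in> bfun \<Longrightarrow> g \<in> bfun \<Longrightarrow> L (\<lambda>x. f x - g x) = L f - L g"
  using sfun_add[of L f "\<lambda>x. (-1) * g x"] sfun_scale[of L g "-1"] by (simp add: bfun_mult)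

lemma sfun_sum:
  assumes "sfun L" "\<And>i. i \<in> I \<Longrightarrow> f i \<in> bfun"
  shows "L (\<lambda>x. \<Sum>i\<in>I. f i x) = (\<Sum>i\<in>I. L (f i))"
  using assms(2)
proof (induction I rule: infinite_finite_induct)
  case (insert i I)
  then show ?case by (simp add: sfun_add[OF assms(1)] bfun_sum)
qed (simp_all add: sfun_zero[OF assms(1)])

lemma sfun_plus [intro]: "sfun L \<Longrightarrow> sfun L' \<Longrightarrow> sfun (\<lambda>f. L f + L' f)"
  unfolding sfun_def
  apply (intro conjI allI impI ballI)
    apply (simp_all add: algebra_simps)
  apply (rule tendsto_add)
   apply blast+
  done

lemma sfun_cmult [intro]: "sfun L \<Longrightarrow> sfun (\<lambda>f. c * L f)"
  unfolding sfun_def by (simp add: algebra_simps tendsto_mult_left)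

lemma sfun_minus [intro]: "sfun L \<Longrightarrow> sfun L' \<Longrightarrow> sfun (\<lambda>f. L f - L' f)"
  using sfun_plus[of L "\<lambda>f. (-1) * L' f"] sfun_cmult[of L' "-1"] by simp

lemma sfun_divide [intro]: "sfun L \<Longrightarrow> sfun (\<lambda>f. L f / c)"
  using sfun_cmult[of L "inverse c"] by (simp add: field_simps)

lemma sfun_weight [intro]:
  assumes L: "sfun L" and g: "g \<in> bfun"
  shows "sfun (\<lambda>f. L (\<lambda>x. g x * f x))"
  unfolding sfun_def
proof (intro conjI ballI allI impI)
  fix f h assume "f \<in> bfun" "h \<in> bfun"
  then show "L (\<lambda>x. g x * (f x + h x)) = L (\<lambda>x. g x * f x) + L (\<lambda>x. g x * h x)"
    using sfun_add[OF L, of "\<lambda>x. g x * f x" "\<lambda>x. g x * h x"] g by (simp add: algebra_simps)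
next
  fix f c assume "f \<in> bfun"
  then show "L (\<lambda>x. g x * (c * f x)) = c * L (\<lambda>x. g x * f x)"
    using sfun_scale[OF L, of "\<lambda>x. g x * f x" c] g by (simp add: algebra_simps)
next
  fix F :: "nat \<Rightarrow> real \<Rightarrow> real" and f C
  assume F: "\<forall>n. F n \<in> borel_measurable borel" "\<forall>n x. \<bar>F n x\<bar> \<le> C" "\<forall>x. (\<lambda>n. F n x) \<longlonglongrightarrow> f x"
  obtain D where D: "0 \<le> D" "\<And>x. \<bar>g x\<bar> \<le> D" by (rule bfun_bound[OF g], rule that)
  show "(\<lambda>n. L (\<lambda>x. g x * F n x)) \<longlonglongrightarrow> L (\<lambda>x. g x * f x)"
  proof (rule sfun_lim[OF L])
    show "(\<lambda>x. g x * F n x) \<in> borel_measurable borel" for n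
      using F(1) bfun_measurable[OF g] by (intro borel_measurable_times) auto
    show "\<bar>g x * F n x\<bar> \<le> D * C" for n x
      unfolding abs_mult using D F(2) by (intro mult_mono) auto
    show "(\<lambda>n. g x * F n x) \<longlonglongrightarrow> g x * f x" for x
      using F(3) by (intro tendsto_mult_left) auto
  qed
qed

lemma sfun_comp [intro]:
  assumes L: "sfun L" and h: "h \<in> borel_measurable borel"
  shows "sfun (\<lambda>f. L (\<lambda>x. f (h x)))"
  unfolding sfun_def
proof (intro conjI ballI allI impI)
  fix f g assume "f \<in> bfun" "g \<in> bfun"
  then show "L (\<lambda>x. f (h x) + g (h x)) = L (\<lambda>x. f (h x)) + L (\<lambda>x. g (h x))"
    using sfun_add[OF L, of "\<lambda>x. f (h x)" "\<lambda>x. g (h x)"] bfun_comp[OF _ h, of f] bfun_comp[OF _ h, of g] by simp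
next
  fix f c assume "f \<in> bfun"
  then show "L (\<lambda>x. c * f (h x)) = c * L (\<lambda>x. f (h x))"
    using sfun_scale[OF L, of "\<lambda>x. f (h x)" c] bfun_comp[OF _ h, of f] by simp
next
  fix F :: "nat \<Rightarrow> real \<Rightarrow> real" and f C
  assume F: "\<forall>n. F n \<in> borel_measurable borel" "\<forall>n x. \<bar>F n x\<bar> \<le> C" "\<forall>x. (\<lambda>n. F n x) \<longlonglongrightarrow> f x"
  show "(\<lambda>n. L (\<lambda>x. F n (h x))) \<longlonglongrightarrow> L (\<lambda>x. f (h x))"
    using F by (intro sfun_lim[OF L, of _ C] measurable_compose[OF h]) auto
qed

lemma integrable_bfun:
  assumes "finite_measure M" "sets M = sets borel" "f \<in> bfun"
  shows "integrable M f"
proof -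
  interpret finite_measure M by fact
  obtain C where "0 \<le> C" "\<And>x. \<bar>f x\<bar> \<le> C" by (rule bfun_bound[OF assms(3)], rule that)
  moreover have "f \<in> borel_measurable M"
    using bfun_measurable[OF assms(3)] measurable_cong_sets[OF assms(2) refl] by blast
  ultimately show ?thesis by (intro integrable_const_bound[of _ C]) auto
qed

lemma sfun_integral [intro]:
  assumes "finite_measure M" and s: "sets M = sets borel"
  shows "sfun (\<lambda>f. \<integral>x. f x \<partial>M)"
  unfolding sfun_def
proof (intro conjI ballI allI impI)
  interpret finite_measure M by fact
  fix F :: "nat \<Rightarrow> real \<Rightarrow> real" and f C
  assume F: "\<forall>n. F n \<in> borel_measurable borel" "\<forall>n x. \<bar>F n x\<bar> \<le> C" "\<forall>x. (\<lambda>n. F n x) \<longlonglongrightarrow> f x"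
  have m: "borel_measurable M = (borel_measurable borel :: (real \<Rightarrow> real) set)"
    using measurable_cong_sets[OF s refl] .
  have "f \<in> borel_measurable borel"
    by (rule borel_measurable_LIMSEQ_real[where u=F]) (use F in auto)
  then show "(\<lambda>n. \<integral>x. F n x \<partial>M) \<longlonglongrightarrow> (\<integral>x. f x \<partial>M)"
    using F by (intro integral_dominated_convergence[of _ _ _ "\<lambda>_. C"]) (auto simp: m)
qed (auto intro!: Bochner_Integration.integral_add integrable_bfun[OF assms])

text \<open>Simple approximants dominated by twice \<open>f\<close> converge pointwise with a
  uniform bound, so \<open>L f\<close> is a limit of zeros.\<close>

lemma sfun_eq_zero_indicator:
  assumes L: "sfun L" and 0: "\<And>B. B \<in> sets borel \<Longrightarrow> L (indicator B) = 0" and f: "f \<in> bfun"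
  shows "L f = 0"
proof -
  obtain C where C: "0 \<le> C" "\<And>x. \<bar>f x\<bar> \<le> C" by (rule bfun_bound[OF f], rule that)
  obtain F where F: "\<And>i. simple_function borel (F i)" "\<And>x. (\<lambda>i. F i x) \<longlonglongrightarrow> f x"
    "\<And>i x. dist (F i x) 0 \<le> 2 * dist (f x) 0"
    using borel_measurable_implies_sequence_metric[OF bfun_measurable[OF f], of 0] by auto
  have Fm: "F i \<in> borel_measurable borel" for i
    using F(1) by (rule borel_measurable_simple_function)
  have L0: "L (F i) = 0" for i
  proof -
    have fin: "finite (range (F i))" using simple_functionD(1)[OF F(1)[of i]] by simp
    have b: "(\<lambda>x. y * indicator (F i -` {y}) x) \<in> bfun" "F i -` {y} \<in> sets borel" for y
    proof -
      show "F i -` {y} \<in> sets borel"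
        using simple_functionD(2)[OF F(1)[of i], of "{y}"] by simp
      then show "(\<lambda>x. y * indicator (F i -` {y}) x) \<in> bfun" by auto
    qed
    have "F i = (\<lambda>x. \<Sum>y\<in>range (F i). y * indicator (F i -` {y}) x)"
    proof
      fix x
      have "(\<Sum>y\<in>range (F i). y * indicator (F i -` {y}) x) = (\<Sum>y\<in>{F i x}. y * indicator (F i -` {y}) x)"
        using fin by (intro sum.mono_neutral_right) auto
      then show "F i x = (\<Sum>y\<in>range (F i). y * indicator (F i -` {y}) x)" by simp
    qed
    then have "L (F i) = L (\<lambda>x. \<Sum>y\<in>range (F i). y * indicator (F i -` {y}) x)" by simp
    also have "\<dots> = (\<Sum>y\<in>range (F i). L (\<lambda>x. y * indicator (F i -` {y}) x))"
      by (rule sfun_sum[OF L b(1)])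
    also have "\<dots> = 0"
      by (simp add: sfun_scale[OF L] b 0)
    finally show ?thesis .
  qed
  have "(\<lambda>n. L (F n)) \<longlonglongrightarrow> L f"
  proof (rule sfun_lim[OF L Fm])
    show "\<bar>F n x\<bar> \<le> 2 * C" for n x
      using F(3)[of n x] C(2)[of x] by simp
  qed (rule F(2))
  then show ?thesis using L0 by (simp add: LIMSEQ_const_iff)
qed

lemma sfun_eq_indicator:
  assumes "sfun L" "sfun L'" "\<And>B. B \<in> sets borel \<Longrightarrow> L (indicator B) = L' (indicator B)" "f \<in> bfun"
  shows "L f = L' f"
  using sfun_eq_zero_indicator[OF sfun_minus[OF assms(1,2)] _ assms(4)] assms(3) by simp

text \<open>For nonempty closed \<open>A\<close> the functions
  \<open>max 0 (1 - n * infdist x A)\<close> tend to the indicator of \<open>A\<close>, and closed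
  sets form an intersection-stable generator of the Borel sets, so Dynkin's argument reaches every
  indicator.\<close>

lemma sfun_eq_zero_continuous:
  assumes L: "sfun L" and 0: "\<And>g. continuous_on UNIV g \<Longrightarrow> g \<in> bfun \<Longrightarrow> L g = 0" and f: "f \<in> bfun"
  shows "L f = 0"
proof (rule sfun_eq_zero_indicator[OF L _ f])
  fix B :: "real set" assume "B \<in> sets borel"
  then have B: "B \<in> sigma_sets UNIV (Collect closed)"
    by (simp add: borel_eq_closed)
  have "Int_stable (Collect closed :: real set set)" "Collect closed \<subseteq> Pow (UNIV :: real set)"
    by (auto simp: Int_stable_def)
  then show "L (indicator B) = 0"
    using B
  proof (induction rule: sigma_sets_induct_disjoint)
    case (basic A)
    then have A: "closed A" by simp
    show ?case
    \<comment> \<open>The distance to the empty set is \<open>0\<close> by convention, so the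
      approximants below would be constantly \<open>1\<close>; hence the separate case.\<close>
    proof (cases "A = {}")
      case True
      then show ?thesis using sfun_zero[OF L] by (simp add: indicator_def)
    next
      case False
      define F where "F n x = max 0 (1 - real n * infdist x A)" for n x
      have c: "continuous_on UNIV (F n)" for n
        unfolding F_def by (intro continuous_intros)
      have b: "\<bar>F n x\<bar> \<le> 1" for n x
        using infdist_nonneg[of x A] by (auto simp: F_def max_def)
      have m: "F n \<in> borel_measurable borel" for n
        using c by (simp add: borel_measurable_continuous_onI)
      have "(\<lambda>n. L (F n)) \<longlonglongrightarrow> L (indicator A)"
      proof (rule sfun_lim[OF L m b])
        fix x
        show "(\<lambda>n. F n x) \<longlonglongrightarrow> indicator A x"
        proof (cases "x \<in> A")
          case True
          then have "F n x = indicator A x" for n by (simp add: F_def)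
          then show ?thesis by simp
        next
          case x: False
          have d: "infdist x A > 0"
            using x A False by (simp add: infdist_pos_not_in_closed)
          obtain N where N: "1 < real N * infdist x A" using reals_Archimedean3[OF d] by blast
          have "\<forall>\<^sub>F n in sequentially. F n x = 0"
            using eventually_ge_at_top[of N]
          proof eventually_elim
            case (elim n)
            then have "real N * infdist x A \<le> real n * infdist x A"
              using d by (intro mult_right_mono) auto
            with N have "1 - real n * infdist x A \<le> 0" by linarith
            then show ?case unfolding F_def by (rule max_absorb1)
          qed
          then show ?thesis using x by (simp add: tendsto_eventually)
        qed
      qed
      moreover have "L (F n) = 0" for n by (rule 0[OF c]) (rule bfunI[OF m b])
      ultimately show ?thesis by (simp add: LIMSEQ_const_iff)
    qed
  next
    case empty
    then show ?case using sfun_zero[OF L] by (simp add: indicator_def)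
  next
    case (compl A)
    then have [measurable]: "A \<in> sets borel" by (simp add: borel_eq_closed)
    have "indicator (UNIV - A) = (\<lambda>x. 1 - indicator A x :: real)" by (auto simp: indicator_def)
    then show ?case using compl 0[of "\<lambda>x. 1"] by (simp add: sfun_diff[OF L])
  next
    case (union A)
    then have [measurable]: "A i \<in> sets borel" for i by (auto simp: borel_eq_closed)
    have eq: "(\<Sum>i<n. indicator (A i) x) = (indicator (\<Union>i<n. A i) x :: real)" for n x
      using union(1) by (intro indicator_UN_disjoint[symmetric]) (auto simp: disjoint_family_on_def)
    have "(\<lambda>n. L (\<lambda>x. \<Sum>i<n. indicator (A i) x)) \<longlonglongrightarrow> L (indicator (\<Union>i. A i))"
    proof (rule sfun_lim[OF L, of _ 1])
      show "(\<lambda>n. \<Sum>i<n. indicator (A i) x) \<longlonglongrightarrow> (indicator (\<Union>i. A i) x :: real)" for x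
        unfolding eq by (rule LIMSEQ_indicator_UN)
      show "\<bar>\<Sum>i<n. indicator (A i) x\<bar> \<le> (1::real)" for n x
        unfolding eq by (simp add: indicator_def)
    qed simp
    moreover have "L (\<lambda>x. \<Sum>i<n. indicator (A i) x) = 0" for n
      using union(3) by (subst sfun_sum[OF L]) auto
    ultimately show ?case by (simp add: LIMSEQ_const_iff)
  qed
qed

text \<open>Measures carried by \<open>[0, 1]\<close> are kept as measures on the line; composing
  with this retraction makes every power a bounded function without changing any integral against
  them.\<close>

definition clamp01 :: "real \<Rightarrow> real" where "clamp01 a = min 1 (max 0 a)"

lemma clamp01_range: "0 \<le> clamp01 a" "clamp01 a \<le> 1"
  by (auto simp: clamp01_def)

lemma clamp01_id: "0 \<le> a \<Longrightarrow> a \<le> 1 \<Longrightarrow> clamp01 a = a"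
  by (simp add: clamp01_def)

lemma clamp01_continuous [continuous_intros]:
  "continuous_on S f \<Longrightarrow> continuous_on S (\<lambda>x. clamp01 (f x))"
  unfolding clamp01_def by (intro continuous_intros)

lemma clamp01_measurable [measurable]: "clamp01 \<in> borel_measurable borel"
  unfolding clamp01_def by measurable

lemma clamp01_bfun [simp, intro]: "clamp01 \<in> bfun"
  using clamp01_range by (intro bfunI[of _ 1]) auto

text \<open>Weierstrass: polynomials approximate a continuous \<open>g\<close> uniformly on
  \<open>{0..1}\<close>, and the hypothesis \<open>cl\<close> confines \<open>L\<close> to that
  interval. This is the determinacy of the Hausdorff moment problem, for signed functionals.\<close>

lemma sfun_eq_zero_moments:
  assumes L: "sfun L" and cl: "\<And>g. g \<in> bfun \<Longrightarrow> L g = L (\<lambda>a. g (clamp01 a))"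
    and 0: "\<And>n. L (\<lambda>a. clamp01 a ^ n) = 0" and f: "f \<in> bfun"
  shows "L f = 0"
proof (rule sfun_eq_zero_continuous[OF L _ f])
  fix g :: "real \<Rightarrow> real" assume gc: "continuous_on UNIV g" and g: "g \<in> bfun"
  obtain C where C: "0 \<le> C" "\<And>x. \<bar>g x\<bar> \<le> C" by (rule bfun_bound[OF g], rule that)
  have "\<exists>p. real_polynomial_function p \<and> (\<forall>x\<in>{0..1}. \<bar>g x - p x\<bar> < inverse (Suc n))" for n
    using Stone_Weierstrass_real_polynomial_function[of "{0..1}" g "inverse (Suc n)"]
      continuous_on_subset[OF gc] by (metis compact_Icc subset_UNIV inverse_positive_iff_positive of_nat_0_less_iff zero_less_Suc)
  then obtain p where p: "\<And>n. real_polynomial_function (p n)"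
      "\<And>n x. x \<in> {0..1} \<Longrightarrow> \<bar>g x - p n x\<bar> < inverse (Suc n)"
    by metis
  have pc: "\<bar>g (clamp01 x) - p n (clamp01 x)\<bar> < inverse (Suc n)" for n x
    using p(2) clamp01_range by simp
  have L0: "L (\<lambda>a. p n (clamp01 a)) = 0" for n
  proof -
    obtain a k where pe: "p n = (\<lambda>x. \<Sum>i\<le>k. a i * x ^ i)"
      using p(1)[of n] unfolding real_polynomial_function_iff_sum by blast
    have "L (\<lambda>x. \<Sum>i\<le>k. a i * clamp01 x ^ i) = (\<Sum>i\<le>k. L (\<lambda>x. a i * clamp01 x ^ i))"
      by (rule sfun_sum[OF L]) auto
    then show ?thesis using 0 by (simp add: pe sfun_scale[OF L])
  qed
  have "(\<lambda>n. L (\<lambda>a. p n (clamp01 a))) \<longlonglongrightarrow> L (\<lambda>a. g (clamp01 a))"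
  proof (rule sfun_lim[OF L, of _ "C + 1"])
    fix n
    have "p n \<in> borel_measurable borel"
      using p(1)[of n] by (intro borel_measurable_continuous_onI continuous_on_polymonial_function)
        (simp add: real_polynomial_function_eq)
    then show "(\<lambda>a. p n (clamp01 a)) \<in> borel_measurable borel" by measurable
    fix x
    have "inverse (real (Suc n)) \<le> 1" by (simp add: inverse_le_1_iff)
    then show "\<bar>p n (clamp01 x)\<bar> \<le> C + 1"
      using pc[of x n] C(2)[of "clamp01 x"] by linarith
  next
    fix x
    show "(\<lambda>n. p n (clamp01 x)) \<longlonglongrightarrow> g (clamp01 x)"
    proof (rule LIM_zero_cancel, rule Lim_null_comparison[OF _ LIMSEQ_inverse_real_of_nat])
      show "\<forall>\<^sub>F n in sequentially. norm (p n (clamp01 x) - g (clamp01 x)) \<le> inverse (real (Suc n))"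
        using pc[of x] by (auto simp: abs_minus_commute less_imp_le)
    qed
  qed
  then have "L (\<lambda>a. g (clamp01 a)) = 0" using L0 by (simp add: LIMSEQ_const_iff)
  then show "L g = 0" using cl[OF g] by simp
qed

section \<open>Variational problems and the Riesz representation theorem\<close>

text \<open>For \<open>p > 0\<close> the minimiser \<open>t = - g / p\<close> is inserted; for
  \<open>p = 0\<close> an affine function that is bounded below is constant.\<close>

lemma discriminant_le:
  fixes e g p :: real
  assumes "\<And>t. 0 \<le> e + 2 * t * g + t\<^sup>2 * p" "0 \<le> p"
  shows "g\<^sup>2 \<le> e * p"
proof (cases "p = 0")
  case True
  have "g = 0"
  proof (rule ccontr)
    assume g: "g \<noteq> 0"
    \<comment> \<open>At this \<open>t\<close> the affine expression equals
      \<open>-1\<close>.\<close>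
    show False using assms(1)[of "-(e + 1) / (2 * g)"] g True by (simp add: field_simps)
  qed
  then show ?thesis using True by simp
next
  case False
  then have p: "p > 0" using assms(2) by simp
  have "0 \<le> e + 2 * (- g / p) * g + (- g / p)\<^sup>2 * p" by (rule assms(1))
  also have "\<dots> = e - g\<^sup>2 / p" using p by (simp add: power2_eq_square field_simps)
  finally show ?thesis using p by (simp add: field_simps)
qed

text \<open>Common core of the Riesz theorem and of the Friedrichs resolvent. The functional
  \<open>a x x - 2 * l x\<close> is bounded below; a minimising sequence is Cauchy for
  \<open>a\<close> and nearly satisfies the Euler equation \<open>a x p = l p\<close>. No limit is
  taken here, because \<open>T\<close> may be incomplete for \<open>a\<close>; the error
  \<open>\<epsilon>\<close> carries the information instead.\<close>

lemma variational_sequence: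
  fixes a :: "'v::real_vector \<Rightarrow> 'v \<Rightarrow> real" and l :: "'v \<Rightarrow> real"
  assumes T: "subspace T"
    and add: "\<And>x y z. a (x + y) z = a x z + a y z" and scale: "\<And>c x z. a (c *\<^sub>R x) z = c * a x z"
    and sym: "\<And>x y. x \<in> T \<Longrightarrow> y \<in> T \<Longrightarrow> a x y = a y x" and pos: "\<And>x. x \<in> T \<Longrightarrow> 0 \<le> a x x"
    and l: "linear l" and bound: "\<And>x. x \<in> T \<Longrightarrow> (l x)\<^sup>2 \<le> C * a x x" and C: "0 \<le> C"
  obtains s :: "nat \<Rightarrow> 'v" and \<epsilon> :: "nat \<Rightarrow> real"
  where "\<And>n. s n \<in> T" "\<And>n. 0 \<le> \<epsilon> n" "\<epsilon> \<longlonglongrightarrow> 0"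
    "\<And>m n. a (s m - s n) (s m - s n) \<le> \<epsilon> m + \<epsilon> n"
    "\<And>n p. p \<in> T \<Longrightarrow> (a (s n) p - l p)\<^sup>2 \<le> \<epsilon> n * a p p"
proof -
  have ladd: "l (x + y) = l x + l y" and lscale: "l (c *\<^sub>R x) = c * l x" for x y c
    using linear_add[OF l] linear_cmul[OF l] by auto
  have radd: "a z (x + y) = a z x + a z y" if "x \<in> T" "y \<in> T" "z \<in> T" for x y z
    using that add[of x y z] sym subspace_add[OF T] by metis
  have rscale: "a z (c *\<^sub>R x) = c * a z x" if "x \<in> T" "z \<in> T" for x z c
    using that scale[of c x z] sym subspace_scale[OF T] by metis
  define J where "J x = a x x - 2 * l x" for x
  have Jexp: "J (x + t *\<^sub>R p) = J x + 2 * t * (a x p - l p) + t\<^sup>2 * a p p"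
    if "x \<in> T" "p \<in> T" for x p t
  proof -
    have tp: "t *\<^sub>R p \<in> T" using that subspace_scale[OF T] by blast
    have "a (x + t *\<^sub>R p) (x + t *\<^sub>R p) = a x x + 2 * t * a x p + t\<^sup>2 * a p p"
      using that tp
      by (simp add: add radd scale rscale subspace_add[OF T] sym[of p x] algebra_simps power2_eq_square)
    then show ?thesis by (simp add: J_def ladd lscale algebra_simps)
  qed
  have low: "- C \<le> J x" if "x \<in> T" for x
  proof -
    have "(2 * l x)\<^sup>2 \<le> 4 * (C * a x x)" using bound[OF that] by (simp add: power_mult_distrib)
    also have "\<dots> \<le> (C + a x x)\<^sup>2"
      using zero_le_power2[of "C - a x x"] by (simp add: power2_eq_square algebra_simps)
    finally have "2 * l x \<le> C + a x x"
      using pos[OF that] C by (metis add_nonneg_nonneg power2_le_imp_le)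
    then show ?thesis by (simp add: J_def)
  qed
  define d where "d = Inf (J ` T)"
  have bdd: "bdd_below (J ` T)" using low by (intro bdd_belowI[of _ "- C"]) auto
  have ne: "J ` T \<noteq> {}" using subspace_0[OF T] by auto
  have dle: "d \<le> J x" if "x \<in> T" for x
    unfolding d_def using bdd that by (intro cInf_lower) auto
  have "\<exists>x\<in>T. J x < d + inverse (Suc n)" for n
    using cInf_lessD[OF ne, of "d + inverse (Suc n)"] unfolding d_def by auto
  then obtain s where s: "\<And>n. s n \<in> T" "\<And>n. J (s n) < d + inverse (Suc n)" by metis
  \<comment> \<open>The factor \<open>2\<close> is the cost of the parallelogram law in the estimate
    of \<open>s m - s n\<close>.\<close>
  define \<epsilon> where "\<epsilon> n = 2 * (J (s n) - d)" for n
  have e0: "0 \<le> \<epsilon> n" for n using dle[OF s(1)[of n]] by (simp add: \<epsilon>_def)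
  have elim: "\<epsilon> \<longlonglongrightarrow> 0"
  proof (rule real_tendsto_sandwich[of "\<lambda>_. 0"])
    show "\<forall>\<^sub>F n in sequentially. \<epsilon> n \<le> 2 * inverse (real (Suc n))"
    proof (intro always_eventually allI)
      fix n show "\<epsilon> n \<le> 2 * inverse (real (Suc n))"
        using s(2)[of n] unfolding \<epsilon>_def by (smt (verit))
    qed
    show "(\<lambda>n. 2 * inverse (real (Suc n))) \<longlonglongrightarrow> 0"
      using tendsto_mult_right_zero[OF LIMSEQ_inverse_real_of_nat, of 2] .
  qed (use e0 in auto)
  show thesis
  proof (rule that[OF s(1) e0 elim])
    fix m n
    have T': "s m \<in> T" "s n \<in> T" "s m - s n \<in> T" using s(1) subspace_diff[OF T] by auto
    define p where "p = s m - s n"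
    have p: "p \<in> T" "s n \<in> T" using T' by (simp_all add: p_def)
    have mid: "s n + (1/2) *\<^sub>R p \<in> T" using p subspace_add[OF T] subspace_scale[OF T] by blast
    have "J (s m) = J (s n + 1 *\<^sub>R p)" by (simp add: p_def)
    also have "\<dots> = J (s n) + 2 * (a (s n) p - l p) + a p p"
      using Jexp[OF p(2,1), of 1] by simp
    finally have 1: "J (s m) = J (s n) + 2 * (a (s n) p - l p) + a p p" .
    \<comment> \<open>The value at the midpoint of \<open>s n\<close> and \<open>s m\<close> is not
      below the infimum; subtracting twice this from \<open>1\<close> bounds
      \<open>a p p\<close>.\<close>
    have "d \<le> J (s n) + (a (s n) p - l p) + a p p / 4"
      using dle[OF mid] Jexp[OF p(2,1), of "1/2"] by (simp add: power2_eq_square)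
    with 1 show "a (s m - s n) (s m - s n) \<le> \<epsilon> m + \<epsilon> n"
      unfolding \<epsilon>_def p_def[symmetric] by (simp add: algebra_simps)
  next
    fix n p assume p: "p \<in> T"
    \<comment> \<open>Along the line \<open>s n + t *\<^sub>R p\<close> the functional exceeds its
      infimum by a nonnegative quadratic in \<open>t\<close>, and the linear coefficient is the
      defect in the Euler equation.\<close>
    have "(a (s n) p - l p)\<^sup>2 \<le> (J (s n) - d) * a p p"
    proof (rule discriminant_le)
      fix t
      have "s n + t *\<^sub>R p \<in> T" using p s(1) subspace_add[OF T] subspace_scale[OF T] by blast
      from dle[OF this] show "0 \<le> J (s n) - d + 2 * t * (a (s n) p - l p) + t\<^sup>2 * a p p"
        using Jexp[OF s(1)[of n] p] by simp
    qed (rule pos[OF p])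
    also have "\<dots> \<le> \<epsilon> n * a p p"
      using pos[OF p] dle[OF s(1)[of n]] by (intro mult_right_mono) (auto simp: \<epsilon>_def)
    finally show "(a (s n) p - l p)\<^sup>2 \<le> \<epsilon> n * a p p" .
  qed
qed

lemma Cauchy_of_norm_sq_le:
  fixes X :: "nat \<Rightarrow> 'h::real_inner"
  assumes "\<epsilon> \<longlonglongrightarrow> 0" "\<And>m n. (norm (X m - X n))\<^sup>2 \<le> \<epsilon> m + \<epsilon> n"
  shows "Cauchy X"
  unfolding Cauchy_iff
proof (intro allI impI)
  fix e :: real assume e: "0 < e"
  then have "0 < e\<^sup>2 / 2" by simp
  from order_tendstoD(2)[OF assms(1) this] obtain N where N: "\<And>n. n \<ge> N \<Longrightarrow> \<epsilon> n < e\<^sup>2 / 2"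
    by (auto simp: eventually_sequentially)
  have "norm (X m - X n) < e" if "m \<ge> N" "n \<ge> N" for m n
  proof -
    have "(norm (X m - X n))\<^sup>2 < e\<^sup>2"
      using assms(2)[of m n] N[OF that(1)] N[OF that(2)] by simp
    then show ?thesis using e by (simp add: power_less_imp_less_base)
  qed
  then show "\<exists>M. \<forall>m\<ge>M. \<forall>n\<ge>M. norm (X m - X n) < e" by blast
qed

lemma tendsto_zero_of_square_le:
  fixes f g :: "nat \<Rightarrow> real"
  assumes "\<And>n. (f n)\<^sup>2 \<le> g n" "g \<longlonglongrightarrow> 0"
  shows "f \<longlonglongrightarrow> 0"
proof -
  have "(\<lambda>n. (f n)\<^sup>2) \<longlonglongrightarrow> 0"
    by (rule real_tendsto_sandwich[of "\<lambda>_. 0" _ _ g]) (use assms in auto)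
  from tendsto_real_sqrt[OF this] show ?thesis by (simp add: tendsto_rabs_zero_iff)
qed

text \<open>With the inner product itself as \<open>a\<close>, Cauchy for \<open>a\<close> means
  Cauchy in norm, and completeness supplies the representing vector.\<close>

lemma riesz_representation:
  fixes l :: "'h::{real_inner,complete_space} \<Rightarrow> real"
  assumes l: "bounded_linear l"
  obtains y where "\<And>x. y \<bullet> x = l x"
proof -
  obtain K where K: "\<And>x. norm (l x) \<le> norm x * K" "0 \<le> K"
    using bounded_linear.nonneg_bounded[OF l] by blast
  have b: "(l x)\<^sup>2 \<le> K\<^sup>2 * (x \<bullet> x)" for x
    using power_mono[OF K(1)[of x], of 2] by (simp add: power_mult_distrib power2_norm_eq_inner mult.commute)
  obtain s :: "nat \<Rightarrow> 'h" and \<epsilon> where s: "\<epsilon> \<longlonglongrightarrow> 0"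
    "\<And>m n. (s m - s n) \<bullet> (s m - s n) \<le> \<epsilon> m + \<epsilon> n"
    "\<And>n p. (s n \<bullet> p - l p)\<^sup>2 \<le> \<epsilon> n * (p \<bullet> p)"
  proof (goal_cases)
    case *: 1
    show thesis
  proof (rule variational_sequence[of UNIV "\<lambda>x y. x \<bullet> y" l "K\<^sup>2"])
    show "x \<bullet> y = y \<bullet> x" for x y :: 'h by (rule inner_commute)
    show thesis if "\<epsilon> \<longlonglongrightarrow> 0" "\<And>m n. (s m - s n) \<bullet> (s m - s n) \<le> \<epsilon> m + \<epsilon> n"
      "\<And>n p. p \<in> UNIV \<Longrightarrow> (s n \<bullet> p - l p)\<^sup>2 \<le> \<epsilon> n * (p \<bullet> p)" for s \<epsilon>
      by (rule *[OF that(1,2)]) (use that(3) in auto)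
  qed (use b l in \<open>simp_all add: inner_add_left bounded_linear.linear\<close>)
  qed
  have "Cauchy s" by (rule Cauchy_of_norm_sq_le[OF s(1)]) (use s(2) in \<open>simp add: power2_norm_eq_inner\<close>)
  then obtain y where y: "s \<longlonglongrightarrow> y" using Cauchy_convergent_iff convergent_def by blast
  have "y \<bullet> p = l p" for p
  proof -
    have "(\<lambda>n. s n \<bullet> p - l p) \<longlonglongrightarrow> 0"
      by (rule tendsto_zero_of_square_le[OF s(3)]) (use tendsto_mult_left_zero[OF s(1)] in auto)
    moreover have "(\<lambda>n. s n \<bullet> p - l p) \<longlonglongrightarrow> y \<bullet> p - l p"
      by (intro tendsto_intros y)
    ultimately have "y \<bullet> p - l p = 0" by (rule LIMSEQ_unique[rotated])
    then show ?thesis by simp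
  qed
  then show thesis by (rule that)
qed

section \<open>Operators represented by families of measures\<close>

text \<open>The polarised integral from the definition of \<open>spectral_integral\<close>; for a
  spectral family it is the matrix element of the operator given by \<open>f\<close>.\<close>

definition mform :: "('h::real_inner \<Rightarrow> real measure) \<Rightarrow> (real \<Rightarrow> real) \<Rightarrow> 'h \<Rightarrow> 'h \<Rightarrow> real" where
  "mform M f x y = ((\<integral>l. f l \<partial>M (x + y)) - (\<integral>l. f l \<partial>M (x - y))) / 4"

lemma sfun_mformI:
  "(\<And>x. finite_measure (M x)) \<Longrightarrow> (\<And>x. sets (M x) = sets borel) \<Longrightarrow> sfun (\<lambda>f. mform M f x y)"
  unfolding mform_def by (intro sfun_divide sfun_minus sfun_integral)

text \<open>Abstracts what two constructions share: the spectral measures of a projection-valued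
  measure and the moment measures of a positive contraction. The conditions say that polarising the
  measures yields symmetric bilinear forms, with the mass as bound.\<close>

locale measure_family =
  fixes M :: "'h::{real_inner,complete_space} \<Rightarrow> real measure"
  assumes finite_M: "finite_measure (M x)" and sets_M: "sets (M x) = sets borel"
    and mass_M: "measure (M x) UNIV \<le> (norm x)\<^sup>2"
    and mform_add: "f \<in> bfun \<Longrightarrow> mform M f (x + x') y = mform M f x y + mform M f x' y"
    and mform_scale: "f \<in> bfun \<Longrightarrow> mform M f (c *\<^sub>R x) y = c * mform M f x y"
    and mform_sym: "f \<in> bfun \<Longrightarrow> mform M f x y = mform M f y x"
    and mform_diag: "f \<in> bfun \<Longrightarrow> mform M f x x = (\<integral>l. f l \<partial>M x)"
begin

lemma space_M: "space (M x) = UNIV"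
  using sets_eq_imp_space_eq[OF sets_M] by simp

lemma measurable_M: "borel_measurable (M x) = borel_measurable borel"
  by (rule measurable_cong_sets[OF sets_M refl])

lemma integrable_M: "f \<in> bfun \<Longrightarrow> integrable (M x) f"
  by (rule integrable_bfun[OF finite_M sets_M])

lemma sfun_mform: "sfun (\<lambda>f. mform M f x y)"
  by (rule sfun_mformI[OF finite_M sets_M])

lemma integral_M_bound:
  assumes "f \<in> borel_measurable borel" "\<And>l. \<bar>f l\<bar> \<le> C"
  shows "\<bar>\<integral>l. f l \<partial>M x\<bar> \<le> C * (norm x)\<^sup>2"
proof -
  interpret finite_measure "M x" by (rule finite_M)
  have C: "0 \<le> C" using assms(2)[of 0] by linarith
  have f: "f \<in> bfun" using assms by (rule bfunI)
  have "\<bar>\<integral>l. f l \<partial>M x\<bar> \<le> (\<integral>l. \<bar>f l\<bar> \<partial>M x)" by (rule integral_abs_bound)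
  also have "\<dots> \<le> (\<integral>l. C \<partial>M x)"
    using integrable_M[OF f] assms(2) by (intro integral_mono) auto
  also have "\<dots> = C * measure (M x) UNIV" by (simp add: space_M mult.commute)
  also have "\<dots> \<le> C * (norm x)\<^sup>2" using mass_M C by (rule mult_left_mono)
  finally show ?thesis .
qed

lemma mform_bounded_linear:
  assumes f: "f \<in> bfun"
  shows "bounded_linear (mform M f x)"
proof -
  obtain C where C: "0 \<le> C" "\<And>l. \<bar>f l\<bar> \<le> C" by (rule bfun_bound[OF f], rule that)
  have add: "mform M f x (y + y') = mform M f x y + mform M f x y'" for y y'
    using mform_add[OF f, of y y' x] mform_sym[OF f] by simp
  have scale: "mform M f x (c *\<^sub>R y) = c * mform M f x y" for c y
    using mform_scale[OF f, of c y x] mform_sym[OF f] by simp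
  have b: "\<bar>mform M f x y\<bar> \<le> C * ((norm x)\<^sup>2 + (norm y)\<^sup>2) / 2" for y
  proof -
    have "\<bar>mform M f x y\<bar> \<le> (\<bar>\<integral>l. f l \<partial>M (x + y)\<bar> + \<bar>\<integral>l. f l \<partial>M (x - y)\<bar>) / 4"
      unfolding mform_def by (simp add: abs_triangle_ineq4 divide_right_mono)
    also have "\<dots> \<le> (C * (norm (x + y))\<^sup>2 + C * (norm (x - y))\<^sup>2) / 4"
      using f C by (intro divide_right_mono add_mono integral_M_bound) (auto intro: bfun_measurable)
    also have "\<dots> = C * ((norm x)\<^sup>2 + (norm y)\<^sup>2) / 2"
      by (simp add: power2_norm_eq_inner inner_add_left inner_add_right inner_diff_left
          inner_diff_right inner_commute algebra_simps)
    finally show ?thesis .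
  qed
  show ?thesis
  proof (rule bounded_linear_intro[of _ "C * ((norm x)\<^sup>2 + 1) / 2"])
    fix y
    show "norm (mform M f x y) \<le> norm y * (C * ((norm x)\<^sup>2 + 1) / 2)"
    proof (cases "y = 0")
      case True
      then show ?thesis using scale[of 0 0] by simp
    next
      case False
      \<comment> \<open>The parallelogram law gives a bound quadratic in \<open>y\<close>; applied
        to the unit vector in the direction of \<open>y\<close> it becomes linear by
        homogeneity.\<close>
      define z where "z = inverse (norm y) *\<^sub>R y"
      have z: "norm z = 1" "y = norm y *\<^sub>R z" using False by (auto simp: z_def)
      have "\<bar>mform M f x y\<bar> = norm y * \<bar>mform M f x z\<bar>"
        by (subst z(2)) (simp add: scale abs_mult)
      also have "\<dots> \<le> norm y * (C * ((norm x)\<^sup>2 + 1) / 2)"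
        using b[of z] z(1) by (intro mult_left_mono) auto
      finally show ?thesis by simp
    qed
  qed (simp_all add: add scale)
qed

text \<open>The Riesz representative of the functional \<open>mform M f x\<close>; for
  \<open>f\<close> in \<open>bfun\<close> it exists and is unique, so the choice is
  harmless.\<close>

definition Phi :: "(real \<Rightarrow> real) \<Rightarrow> 'h \<Rightarrow> 'h" where
  "Phi f x = (SOME y. \<forall>z. y \<bullet> z = mform M f x z)"

lemma Phi_inner: "f \<in> bfun \<Longrightarrow> Phi f x \<bullet> y = mform M f x y"
proof -
  assume "f \<in> bfun"
  from riesz_representation[OF mform_bounded_linear[OF this, of x]]
  have "\<exists>y. \<forall>z. y \<bullet> z = mform M f x z" by metis
  from someI_ex[OF this] show ?thesis unfolding Phi_def by blast
qed

lemma Phi_eqI: "f \<in> bfun \<Longrightarrow> (\<And>z. mform M f x z = y \<bullet> z) \<Longrightarrow> Phi f x = y"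
  using Phi_inner vector_eq_rdot by metis

lemma Phi_self: "f \<in> bfun \<Longrightarrow> Phi f x \<bullet> x = (\<integral>l. f l \<partial>M x)"
  by (simp add: Phi_inner mform_diag)

lemma Phi_sym: "f \<in> bfun \<Longrightarrow> Phi f x \<bullet> y = x \<bullet> Phi f y"
  using mform_sym[of f x y] by (simp add: Phi_inner inner_commute[of x])

lemma Phi_add_fun: "f \<in> bfun \<Longrightarrow> g \<in> bfun \<Longrightarrow> Phi (\<lambda>l. f l + g l) x = Phi f x + Phi g x"
  by (rule Phi_eqI) (simp_all add: inner_add_left Phi_inner sfun_add[OF sfun_mform])

lemma Phi_scale_fun: "f \<in> bfun \<Longrightarrow> Phi (\<lambda>l. c * f l) x = c *\<^sub>R Phi f x"
  by (rule Phi_eqI) (simp_all add: Phi_inner sfun_scale[OF sfun_mform])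

lemma Phi_diff_fun: "f \<in> bfun \<Longrightarrow> g \<in> bfun \<Longrightarrow> Phi (\<lambda>l. f l - g l) x = Phi f x - Phi g x"
  by (rule Phi_eqI) (simp_all add: inner_diff_left Phi_inner sfun_diff[OF sfun_mform])

lemma linear_Phi: "f \<in> bfun \<Longrightarrow> linear (Phi f)"
  by (rule linearI; rule Phi_eqI) (simp_all add: inner_add_left Phi_inner mform_add mform_scale)

lemma Phi_add: "f \<in> bfun \<Longrightarrow> Phi f (x + y) = Phi f x + Phi f y"
  and Phi_diff: "f \<in> bfun \<Longrightarrow> Phi f (x - y) = Phi f x - Phi f y"
  and Phi_scaleR: "f \<in> bfun \<Longrightarrow> Phi f (c *\<^sub>R x) = c *\<^sub>R Phi f x"
  by (simp_all add: linear_add linear_diff linear_cmul linear_Phi)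

end

locale borel_calculus = measure_family +
  assumes Phi_mult: "f \<in> bfun \<Longrightarrow> g \<in> bfun \<Longrightarrow> Phi (\<lambda>l. f l * g l) x = Phi f (Phi g x)"
begin

lemma Phi_commute: "f \<in> bfun \<Longrightarrow> g \<in> bfun \<Longrightarrow> Phi f (Phi g x) = Phi g (Phi f x)"
  using Phi_mult[of f g x] Phi_mult[of g f x] by (simp add: mult.commute)

text \<open>Symmetry and multiplicativity move both factors to one side. This isometry turns every
  norm estimate below into an integral against \<open>M x\<close>.\<close>

lemma norm_Phi_sq:
  assumes f: "f \<in> bfun" shows "(norm (Phi f x))\<^sup>2 = (\<integral>l. (f l)\<^sup>2 \<partial>M x)"
proof -
  have "Phi f x \<bullet> Phi f x = Phi f (Phi f x) \<bullet> x"
    by (rule Phi_sym[OF f, symmetric])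
  also have "\<dots> = (\<integral>l. f l * f l \<partial>M x)"
    using Phi_mult[OF f f] Phi_self[OF bfun_mult[OF f f]] by simp
  finally show ?thesis unfolding power2_norm_eq_inner unfolding power2_eq_square .
qed

lemma norm_Phi_le:
  assumes "f \<in> borel_measurable borel" "\<And>l. \<bar>f l\<bar> \<le> C"
  shows "norm (Phi f x) \<le> C * norm x"
proof -
  have C: "0 \<le> C" using assms(2)[of 0] by linarith
  have "(f l)\<^sup>2 \<le> C\<^sup>2" for l using power_mono[OF assms(2)[of l], of 2] by simp
  then have "\<bar>\<integral>l. (f l)\<^sup>2 \<partial>M x\<bar> \<le> C\<^sup>2 * (norm x)\<^sup>2"
    using assms(1) by (intro integral_M_bound) auto
  then have "(norm (Phi f x))\<^sup>2 \<le> (C * norm x)\<^sup>2"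
    using norm_Phi_sq[OF bfunI[OF assms], of x] by (simp add: power_mult_distrib)
  then show ?thesis by (rule power2_le_imp_le) (simp add: C)
qed

lemma bounded_linear_Phi: "f \<in> bfun \<Longrightarrow> bounded_linear (Phi f)"
proof -
  assume f: "f \<in> bfun"
  obtain C where C: "0 \<le> C" "\<And>l. \<bar>f l\<bar> \<le> C" by (rule bfun_bound[OF f], rule that)
  show ?thesis
    by (rule bounded_linear_intro[of _ C])
       (use norm_Phi_le[OF bfun_measurable[OF f] C(2)] in \<open>auto simp: Phi_add Phi_scaleR f mult.commute\<close>)
qed

text \<open>Dominated convergence of \<open>(F n l - f l)\<^sup>2\<close> against
  \<open>M x\<close>, read as norm convergence through \<open>norm_Phi_sq\<close>.\<close>

lemma Phi_tendsto:
  assumes F: "\<And>n. F n \<in> borel_measurable borel" "\<And>n l. \<bar>F n l\<bar> \<le> C" "\<And>l. (\<lambda>n. F n l) \<longlonglongrightarrow> f l"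
  shows "(\<lambda>n. Phi (F n) x) \<longlonglongrightarrow> Phi f x"
proof -
  have f: "f \<in> bfun"
  proof (rule bfunI)
    show "f \<in> borel_measurable borel" by (rule borel_measurable_LIMSEQ_real[OF F(3) F(1)])
    show "\<bar>f l\<bar> \<le> C" for l
      using tendsto_rabs[OF F(3)] by (rule LIMSEQ_le_const2) (use F(2) in auto)
  qed
  have Fb: "F n \<in> bfun" for n using F(1,2) by (rule bfunI)
  have "(\<lambda>n. \<integral>l. (F n l - f l)\<^sup>2 \<partial>M x) \<longlonglongrightarrow> (\<integral>l. 0 \<partial>M x)"
  proof (rule sfun_lim[OF sfun_integral[OF finite_M sets_M]])
    show "(\<lambda>l. (F n l - f l)\<^sup>2) \<in> borel_measurable borel" for n
      using F(1) bfun_measurable[OF f] by measurable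
    fix n l
    have "\<bar>f l\<bar> \<le> C"
      using tendsto_rabs[OF F(3)] by (rule LIMSEQ_le_const2) (use F(2) in auto)
    then have "\<bar>F n l - f l\<bar> \<le> 2 * C" using F(2)[of n l] by linarith
    then show "\<bar>(F n l - f l)\<^sup>2\<bar> \<le> (2 * C)\<^sup>2" using power_mono[of "\<bar>F n l - f l\<bar>" "2*C" 2] by simp
    show "(\<lambda>n. (F n l - f l)\<^sup>2) \<longlonglongrightarrow> 0" for l
      using tendsto_power[OF LIM_zero[OF F(3)[of l]], of 2] by simp
  qed
  then have "(\<lambda>n. (norm (Phi (F n) x - Phi f x))\<^sup>2) \<longlonglongrightarrow> 0"
    by (simp add: Phi_diff_fun[symmetric] Fb f norm_Phi_sq)
  then have "(\<lambda>n. norm (Phi (F n) x - Phi f x)) \<longlonglongrightarrow> 0"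
    by (rule tendsto_zero_of_square_le[OF order_refl])
  then show ?thesis by (simp add: LIM_zero_iff tendsto_norm_zero_iff)
qed

end

section \<open>The calculus of a projection-valued measure\<close>

lemma indicator_mult: "(\<lambda>l. indicator A l * indicator B l) = (indicator (A \<inter> B) :: real \<Rightarrow> real)"
  by (auto simp: indicator_def)

lemma sets_scalar_spectral_measure: "sets (scalar_spectral_measure E x) = sets borel"
proof -
  have "sigma_sets UNIV (sets borel) = (sets borel :: real set set)"
    using sets.sigma_sets_eq[of "borel :: real measure"] by simp
  then show ?thesis by (simp add: scalar_spectral_measure_def)
qed

locale pvm =
  fixes K :: "'h::{real_inner,complete_space} set" and E :: "real set \<Rightarrow> 'h \<Rightarrow> 'h"
  assumes pvm: "projection_valued_measure K E"
begin

lemma linear_E: "B \<in> sets borel \<Longrightarrow> linear (E B)"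
  and E_in_K: "B \<in> sets borel \<Longrightarrow> E B x \<in> K"
  and E_idem: "B \<in> sets borel \<Longrightarrow> E B (E B x) = E B x"
  and E_sym: "B \<in> sets borel \<Longrightarrow> E B x \<bullet> y = x \<bullet> E B y"
  and E_UNIV: "x \<in> K \<Longrightarrow> E UNIV x = x"
  and E_sums: "range A \<subseteq> sets borel \<Longrightarrow> disjoint_family A \<Longrightarrow> (\<lambda>n. E (A n) x) sums E (\<Union>n. A n) x"
  using pvm unfolding projection_valued_measure_def by blast+

lemma in_K_iff: "x \<in> K \<longleftrightarrow> E UNIV x = x"
  using E_UNIV E_in_K[of UNIV x] by auto

text \<open>A constant series converges only if its term is \<open>0\<close>.\<close>

lemma E_empty: "E {} x = 0"
proof -
  have "(\<lambda>n::nat. E {} x) sums E (\<Union>n::nat. {}) x"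
    by (rule E_sums) (auto simp: disjoint_family_on_def)
  then have "(\<lambda>n::nat. E {} x) \<longlonglongrightarrow> 0" by (intro summable_LIMSEQ_zero) (rule sums_summable)
  then show ?thesis by (simp add: LIMSEQ_const_iff)
qed

lemma E_Un:
  assumes "A \<in> sets borel" "B \<in> sets borel" "A \<inter> B = {}"
  shows "E (A \<union> B) x = E A x + E B x"
proof -
  have "(\<lambda>n. E (binaryset A B n) x) sums E (\<Union>n. binaryset A B n) x"
    using assms by (intro E_sums) (auto simp: range_binaryset_eq disjoint_family_on_def binaryset_def)
  moreover have "(\<lambda>n. E (binaryset A B n) x) sums (E A x + E B x)"
    by (rule binaryset_sums) (rule E_empty)
  ultimately show ?thesis using sums_unique2 by (fastforce simp: UN_binaryset_eq)
qed

lemma E_inner_self: "B \<in> sets borel \<Longrightarrow> E B x \<bullet> x = (norm (E B x))\<^sup>2"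
  by (metis E_sym E_idem power2_norm_eq_inner)

lemma norm_E_le:
  assumes "B \<in> sets borel" shows "norm (E B x) \<le> norm x"
proof -
  have "norm (E B x) * norm (E B x) \<le> norm (E B x) * norm x"
    using norm_cauchy_schwarz[of "E B x" x] E_inner_self[OF assms, of x] by (simp add: power2_eq_square)
  then show ?thesis by (cases "norm (E B x) = 0") auto
qed

text \<open>For \<open>y\<close> in the range of \<open>E B\<close>, additivity and Pythagoras give
  \<open>E (A \<union> B) y\<close> the squared norm of \<open>E A y\<close> plus that of
  \<open>y\<close>, yet a projection does not increase norms.\<close>

lemma E_disjoint:
  assumes "A \<in> sets borel" "B \<in> sets borel" "A \<inter> B = {}"
  shows "E A (E B x) = 0"
proof -
  define y where "y = E B x"
  have y: "E B y = y" by (simp add: y_def E_idem assms)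
  have AB: "A \<union> B \<in> sets borel" using assms by simp
  have "(norm (E (A \<union> B) y))\<^sup>2 = (norm (E A y))\<^sup>2 + (norm y)\<^sup>2"
    using E_inner_self[OF AB, of y, symmetric] E_inner_self[OF assms(1), of y, symmetric] assms
    by (simp add: E_Un y inner_add_left power2_norm_eq_inner)
  moreover have "(norm (E (A \<union> B) y))\<^sup>2 \<le> (norm y)\<^sup>2"
    using norm_E_le[OF AB] by (rule power_mono) simp
  ultimately show ?thesis unfolding y_def[symmetric] by simp
qed

lemma E_Int:
  assumes "A \<in> sets borel" "B \<in> sets borel"
  shows "E A (E B x) = E (A \<inter> B) x"
proof -
  have B: "E B x = E (A \<inter> B) x + E (B - A) x"
    using E_Un[of "A \<inter> B" "B - A" x] assms by (simp add: Un_Diff_Int Int_commute[of A] sup_commute Diff_Int_distrib2 Int_Diff_disjoint)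
  have "E A y = E (A \<inter> B) y + E (A - B) y" for y
    using E_Un[of "A \<inter> B" "A - B" y] assms by (simp add: Int_Diff_Un Int_Diff_disjoint)
  from this[of "E (A \<inter> B) x"] have "E A (E (A \<inter> B) x) = E (A \<inter> B) x"
    using E_disjoint[of "A - B" "A \<inter> B" x] assms by (simp add: E_idem Int_Diff_disjoint disjoint_iff)
  moreover have "E A (E (B - A) x) = 0"
    using assms by (intro E_disjoint) auto
  ultimately show ?thesis
    using linear_add[OF linear_E[OF assms(1)]] by (simp add: B)
qed

abbreviation M where "M \<equiv> scalar_spectral_measure E"

lemma emeasure_M:
  assumes "B \<in> sets borel" shows "emeasure (M x) B = ennreal (E B x \<bullet> x)"
proof (rule emeasure_measure_of[OF scalar_spectral_measure_def])
  show "positive (sets (M x)) (\<lambda>B. ennreal (E B x \<bullet> x))"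
    by (simp add: positive_def E_empty)
  show "countably_additive (sets (M x)) (\<lambda>B. ennreal (E B x \<bullet> x))"
    unfolding countably_additive_def sets_scalar_spectral_measure
  proof (intro allI impI)
    fix A :: "nat \<Rightarrow> real set" assume A: "range A \<subseteq> sets borel" "disjoint_family A"
    have "(\<lambda>n. E (A n) x \<bullet> x) sums (E (\<Union>n. A n) x \<bullet> x)"
      using E_sums[OF A] by (rule bounded_linear.sums[OF bounded_linear_inner_left])
    then show "(\<Sum>n. ennreal (E (A n) x \<bullet> x)) = ennreal (E (\<Union> (range A)) x \<bullet> x)"
      using A by (intro suminf_ennreal_eq) (auto simp: E_inner_self range_subsetD)
  qed
qed (use assms in \<open>auto simp: sets_scalar_spectral_measure\<close>)

lemma measure_M: "B \<in> sets borel \<Longrightarrow> measure (M x) B = E B x \<bullet> x"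
  by (simp add: measure_def emeasure_M E_inner_self)

lemma finite_measure_M: "finite_measure (M x)"
proof
  have "space (M x) = UNIV"
    using sets_eq_imp_space_eq[OF sets_scalar_spectral_measure, of E x] by simp
  then show "emeasure (M x) (space (M x)) \<noteq> \<infinity>" by (simp add: emeasure_M)
qed

lemma integral_indicator_M: "B \<in> sets borel \<Longrightarrow> (\<integral>l. indicator B l \<partial>M x) = E B x \<bullet> x"
  by (simp add: sets_scalar_spectral_measure measure_M)

lemma mform_indicator:
  assumes "B \<in> sets borel" shows "mform M (indicator B) x y = E B x \<bullet> y"
proof -
  have "E B y \<bullet> x = E B x \<bullet> y" using E_sym[OF assms, of y x] by (simp only: inner_commute)
  then show ?thesis
    unfolding mform_def integral_indicator_M[OF assms] linear_add[OF linear_E[OF assms]]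
      linear_diff[OF linear_E[OF assms]]
    by (simp add: inner_add_left inner_add_right inner_diff_left inner_diff_right)
qed

lemma sfun_mform_M: "sfun (\<lambda>f. mform M f x y)"
  by (rule sfun_mformI[OF finite_measure_M sets_scalar_spectral_measure])

text \<open>Each identity is linear and sigma-continuous in \<open>f\<close>, so it suffices to see
  it for indicators, where it reduces to linearity and symmetry of \<open>E B\<close>.\<close>

sublocale measure_family M
proof (rule measure_family.intro)
  fix f :: "real \<Rightarrow> real" and x x' y and c :: real
  assume f: "f \<in> bfun"
  show "mform M f (x + x') y = mform M f x y + mform M f x' y"
    by (rule sfun_eq_indicator[OF sfun_mform_M sfun_plus[OF sfun_mform_M sfun_mform_M] _ f])
       (simp add: mform_indicator linear_add[OF linear_E] inner_add_left)
  show "mform M f (c *\<^sub>R x) y = c * mform M f x y"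
    by (rule sfun_eq_indicator[OF sfun_mform_M sfun_cmult[OF sfun_mform_M] _ f])
       (simp add: mform_indicator linear_cmul[OF linear_E])
  show "mform M f x y = mform M f y x"
    by (rule sfun_eq_indicator[OF sfun_mform_M sfun_mform_M _ f])
       (simp add: mform_indicator E_sym inner_commute[of x])
  show "mform M f x x = (\<integral>l. f l \<partial>M x)"
    by (rule sfun_eq_indicator[OF sfun_mform_M sfun_integral[OF finite_measure_M sets_scalar_spectral_measure] _ f])
       (simp only: mform_indicator integral_indicator_M)
next
  show "measure (M x) UNIV \<le> (norm x)\<^sup>2" for x
    using norm_E_le[of UNIV x] by (simp add: measure_M E_inner_self power_mono)
qed (rule finite_measure_M sets_scalar_spectral_measure)+

lemma Phi_indicator: "B \<in> sets borel \<Longrightarrow> Phi (indicator B) x = E B x"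
  by (rule Phi_eqI) (simp_all add: mform_indicator)

text \<open>Indicators multiply by \<open>E_Int\<close>; the identity then extends to bounded
  functions one factor at a time.\<close>

sublocale borel_calculus M
proof
  fix f g :: "real \<Rightarrow> real" and x
  assume f: "f \<in> bfun" and g: "g \<in> bfun"
  have 1: "mform M (\<lambda>l. indicator B l * f l) x z = mform M f (E B x) z"
    if B: "B \<in> sets borel" and f: "f \<in> bfun" for B f z
    by (rule sfun_eq_indicator[OF sfun_weight[OF sfun_mform_M] sfun_mform_M _ f])
       (use B in \<open>simp_all add: indicator_mult mform_indicator E_Int Int_commute\<close>)
  have 2: "mform M (\<lambda>l. f l * g l) x z = mform M g x (Phi f z)" for z
  proof (rule sfun_eq_indicator[OF sfun_weight[OF sfun_mform_M f] sfun_mform_M _ g])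
    fix B :: "real set" assume B: "B \<in> sets borel"
    show "mform M (\<lambda>l. f l * indicator B l) x z = mform M (indicator B) x (Phi f z)"
      using 1[OF B f, of z] by (simp add: mult.commute mform_indicator B Phi_inner[OF f, symmetric] Phi_sym[OF f])
  qed
  show "Phi (\<lambda>l. f l * g l) x = Phi f (Phi g x)"
    by (rule Phi_eqI) (simp_all add: 2 f g Phi_inner[OF g, symmetric] Phi_sym[OF f])
qed

lemma Phi_one: "Phi (\<lambda>_. 1) x = E UNIV x"
proof -
  have "(\<lambda>_. 1) = (indicator UNIV :: real \<Rightarrow> real)" by auto
  then show ?thesis using Phi_indicator[of UNIV x] by simp
qed

lemma Phi_in_K: "f \<in> bfun \<Longrightarrow> Phi f x \<in> K"
  using Phi_mult[of "\<lambda>_. 1" f x] E_in_K[of UNIV "Phi f x"] by (simp add: Phi_one)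

text \<open>\<open>K\<close> is the set of fixed vectors of the bounded projection
  \<open>E UNIV\<close>, hence closed.\<close>

lemma K_tendsto: "(\<And>n. s n \<in> K) \<Longrightarrow> s \<longlonglongrightarrow> x \<Longrightarrow> x \<in> K"
proof -
  assume s: "\<And>n. s n \<in> K" "s \<longlonglongrightarrow> x"
  have "(\<lambda>n. E UNIV (s n)) \<longlonglongrightarrow> E UNIV x"
    using bounded_linear.tendsto[OF bounded_linear_Phi[of "\<lambda>_. 1"] s(2)] by (simp add: Phi_one)
  moreover have "E UNIV (s n) = s n" for n using s(1) by (rule E_UNIV)
  ultimately have "E UNIV x = x" using s(2) by (simp add: LIMSEQ_unique)
  then show "x \<in> K" by (simp add: in_K_iff)
qed

lemma K_add: "x \<in> K \<Longrightarrow> y \<in> K \<Longrightarrow> x + y \<in> K"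
  and K_diff: "x \<in> K \<Longrightarrow> y \<in> K \<Longrightarrow> x - y \<in> K"
  by (simp_all add: in_K_iff linear_add[OF linear_E] linear_diff[OF linear_E])

text \<open>Large values are replaced by \<open>0\<close> rather than by \<open>n\<close>: then for
  \<open>n \<le> m\<close> the function \<open>trunc f n\<close> is \<open>trunc f m\<close> times
  an indicator, and the increments have disjoint supports.\<close>

definition trunc :: "(real \<Rightarrow> real) \<Rightarrow> nat \<Rightarrow> real \<Rightarrow> real" where
  "trunc f n l = indicator {l. \<bar>f l\<bar> \<le> real n} l * f l"

lemma trunc_le: "\<bar>trunc f n l\<bar> \<le> real n" "\<bar>trunc f n l\<bar> \<le> \<bar>f l\<bar>"
  by (auto simp: trunc_def indicator_def)

lemma trunc_measurable [measurable]:
  assumes [measurable]: "f \<in> borel_measurable borel" shows "trunc f n \<in> borel_measurable borel"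
proof -
  have "trunc f n = (\<lambda>l. indicator {l. \<bar>f l\<bar> \<le> real n} l * f l)" by (auto simp: trunc_def)
  then show ?thesis by simp
qed

lemma trunc_bfun: "f \<in> borel_measurable borel \<Longrightarrow> trunc f n \<in> bfun"
  by (rule bfunI[OF _ trunc_le(1)]) measurable

lemma trunc_tendsto: "(\<lambda>n. trunc f n l) \<longlonglongrightarrow> f l"
proof -
  obtain N where "\<bar>f l\<bar> \<le> real N" using real_arch_simple by blast
  then have "\<forall>\<^sub>F n in sequentially. trunc f n l = f l"
    by (intro eventually_mono[OF eventually_ge_at_top[of N]]) (auto simp: trunc_def)
  then show ?thesis by (rule tendsto_eventually)
qed

text \<open>Truncations are dominated by \<open>f\<close> and converge to it, so one direction is
  monotonicity and the other Fatou's lemma. The norm bound is visibly stable under sums of vectors,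
  unlike integrability against the varying measures \<open>M x\<close>.\<close>

lemma in_spectral_domain_iff:
  assumes [measurable]: "f \<in> borel_measurable borel"
  shows "x \<in> spectral_domain K E f \<longleftrightarrow> x \<in> K \<and> (\<exists>C. \<forall>n. norm (Phi (trunc f n) x) \<le> C)"
proof (intro iffI conjI)
  assume x: "x \<in> spectral_domain K E f"
  then show "x \<in> K" by (simp add: spectral_domain_def)
  from x have i: "integrable (M x) (\<lambda>l. (f l)\<^sup>2)" by (simp add: spectral_domain_def)
  have "norm (Phi (trunc f n) x) \<le> sqrt (\<integral>l. (f l)\<^sup>2 \<partial>M x)" for n
  proof (rule real_le_rsqrt)
    have "(trunc f n l)\<^sup>2 \<le> (f l)\<^sup>2" for l
      using power_mono[OF trunc_le(2)[of f n l], of 2] by simp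
    then show "(norm (Phi (trunc f n) x))\<^sup>2 \<le> (\<integral>l. (f l)\<^sup>2 \<partial>M x)"
      unfolding norm_Phi_sq[OF trunc_bfun[OF assms]]
      using i integrable_M[OF bfun_power[OF trunc_bfun[OF assms]]] by (intro integral_mono) auto
  qed
  then show "\<exists>C. \<forall>n. norm (Phi (trunc f n) x) \<le> C" by blast
next
  assume x: "x \<in> K \<and> (\<exists>C. \<forall>n. norm (Phi (trunc f n) x) \<le> C)"
  then obtain C where C: "\<And>n. norm (Phi (trunc f n) x) \<le> C" by blast
  have "(\<integral>\<^sup>+l. ennreal ((f l)\<^sup>2) \<partial>M x) \<le> ennreal (C\<^sup>2)"
  proof -
    have "ennreal ((f l)\<^sup>2) = liminf (\<lambda>n. ennreal ((trunc f n l)\<^sup>2))" for l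
      by (rule lim_imp_Liminf[symmetric]) (auto intro!: tendsto_ennrealI tendsto_power trunc_tendsto)
    then have "(\<integral>\<^sup>+l. ennreal ((f l)\<^sup>2) \<partial>M x) = (\<integral>\<^sup>+l. liminf (\<lambda>n. ennreal ((trunc f n l)\<^sup>2)) \<partial>M x)"
      by simp
    also have "\<dots> \<le> liminf (\<lambda>n. \<integral>\<^sup>+l. ennreal ((trunc f n l)\<^sup>2) \<partial>M x)"
      by (rule nn_integral_liminf) (simp add: measurable_M)
    also have "\<dots> \<le> liminf (\<lambda>n. ennreal (C\<^sup>2))"
    proof (rule Liminf_mono, rule always_eventually, rule allI)
      fix n
      have "(\<integral>\<^sup>+l. ennreal ((trunc f n l)\<^sup>2) \<partial>M x) = ennreal (\<integral>l. (trunc f n l)\<^sup>2 \<partial>M x)"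
        using integrable_M[OF bfun_power[OF trunc_bfun[OF assms]]] by (intro nn_integral_eq_integral) auto
      also have "\<dots> = ennreal ((norm (Phi (trunc f n) x))\<^sup>2)"
        using norm_Phi_sq[OF trunc_bfun[OF assms]] by simp
      also have "\<dots> \<le> ennreal (C\<^sup>2)" using C by (intro ennreal_leI power_mono) auto
      finally show "(\<integral>\<^sup>+l. ennreal ((trunc f n l)\<^sup>2) \<partial>M x) \<le> ennreal (C\<^sup>2)" .
    qed
    also have "\<dots> = ennreal (C\<^sup>2)" by (simp add: Liminf_const)
    finally show ?thesis .
  qed
  then have "integrable (M x) (\<lambda>l. (f l)\<^sup>2)"
    unfolding integrable_iff_bounded
    by (auto simp: measurable_M less_top[symmetric] top_unique intro: le_less_trans)
  then show "x \<in> spectral_domain K E f" using x by (simp add: spectral_domain_def)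
qed

lemma spectral_domain_add:
  assumes f: "f \<in> borel_measurable borel" and "x \<in> spectral_domain K E f" "y \<in> spectral_domain K E f"
  shows "x + y \<in> spectral_domain K E f" "x - y \<in> spectral_domain K E f"
proof -
  obtain C D where C: "\<And>n. norm (Phi (trunc f n) x) \<le> C" "\<And>n. norm (Phi (trunc f n) y) \<le> D"
    using assms by (auto simp: in_spectral_domain_iff)
  have "norm (Phi (trunc f n) (x + y)) \<le> C + D" "norm (Phi (trunc f n) (x - y)) \<le> C + D" for n
    using C[of n] norm_triangle_ineq[of "Phi (trunc f n) x" "Phi (trunc f n) y"]
      norm_triangle_ineq4[of "Phi (trunc f n) x" "Phi (trunc f n) y"]
    by (auto simp: Phi_add[OF trunc_bfun[OF f]] Phi_diff[OF trunc_bfun[OF f]])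
  then show "x + y \<in> spectral_domain K E f" "x - y \<in> spectral_domain K E f"
    using assms by (auto simp: in_spectral_domain_iff K_add K_diff)
qed

lemma Phi_trunc_inner_tendsto:
  assumes f [measurable]: "f \<in> borel_measurable borel"
    and "x \<in> spectral_domain K E f" "y \<in> spectral_domain K E f"
  shows "(\<lambda>n. Phi (trunc f n) x \<bullet> y) \<longlonglongrightarrow> mform M f x y"
proof -
  have lim: "(\<lambda>n. \<integral>l. trunc f n l \<partial>M z) \<longlonglongrightarrow> (\<integral>l. f l \<partial>M z)" if z: "z \<in> spectral_domain K E f" for z
  proof (rule integral_dominated_convergence)
    show "integrable (M z) (\<lambda>l. 1 + (f l)\<^sup>2)"
      using z integrable_M[of "\<lambda>_. 1"] by (auto simp: spectral_domain_def)
    show "AE l in M z. norm (trunc f n l) \<le> 1 + (f l)\<^sup>2" for n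
    proof (rule AE_I2)
      fix l
      \<comment> \<open>Square integrability gives integrability, because
        \<open>\<bar>f\<bar> \<le> 1 + f\<^sup>2\<close> and \<open>M z\<close> is finite.\<close>
      have "0 \<le> (\<bar>f l\<bar> - 1)\<^sup>2 + 1 + (f l)\<^sup>2" by simp
      then have "2 * \<bar>f l\<bar> \<le> 2 * (1 + (f l)\<^sup>2)" by (simp add: power2_eq_square algebra_simps)
      then show "norm (trunc f n l) \<le> 1 + (f l)\<^sup>2" using trunc_le(2)[of f n l] by simp
    qed
    show "AE l in M z. (\<lambda>n. trunc f n l) \<longlonglongrightarrow> f l" by (simp add: trunc_tendsto)
  qed (simp_all add: measurable_M)
  show ?thesis
    unfolding Phi_inner[OF trunc_bfun[OF f]] mform_def
    by (intro tendsto_intros lim spectral_domain_add assms) simp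
qed

text \<open>Replaces the weak, polarised definition by a strong limit, the form in which all later
  computations are done. A graph element \<open>(x, y)\<close> satisfies
  \<open>E (B n) y = Phi (trunc f n) x\<close> on the sets \<open>B n\<close> where
  \<open>\<bar>f\<bar> \<le> n\<close>, and these sets exhaust the line.\<close>

lemma spectral_integral_iff:
  assumes f [measurable]: "f \<in> borel_measurable borel"
  shows "(x, y) \<in> spectral_integral K E f \<longleftrightarrow>
    x \<in> K \<and> y \<in> K \<and> (\<lambda>n. Phi (trunc f n) x) \<longlonglongrightarrow> y"
proof
  assume r: "x \<in> K \<and> y \<in> K \<and> (\<lambda>n. Phi (trunc f n) x) \<longlonglongrightarrow> y"
  then have "Bseq (\<lambda>n. Phi (trunc f n) x)" using convergent_imp_Bseq convergent_def by blast
  then have x: "x \<in> spectral_domain K E f"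
    using r by (auto simp: in_spectral_domain_iff Bseq_def)
  have "y \<bullet> z = mform M f x z" if "z \<in> spectral_domain K E f" for z
  proof (rule LIMSEQ_unique)
    show "(\<lambda>n. Phi (trunc f n) x \<bullet> z) \<longlonglongrightarrow> y \<bullet> z" using r by (intro tendsto_intros) auto
  qed (rule Phi_trunc_inner_tendsto[OF f x that])
  then show "(x, y) \<in> spectral_integral K E f"
    using x r by (simp add: spectral_integral_def mform_def)
next
  assume "(x, y) \<in> spectral_integral K E f"
  then have x: "x \<in> spectral_domain K E f" "x \<in> K" and y: "y \<in> K"
    and xy: "\<And>z. z \<in> spectral_domain K E f \<Longrightarrow> y \<bullet> z = mform M f x z"
    by (auto simp: spectral_integral_def mform_def spectral_domain_def)
  define B where "B n = {l. \<bar>f l\<bar> \<le> real n}" for n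
  have B [measurable]: "B n \<in> sets borel" for n unfolding B_def by measurable
  have EB: "E (B n) y = Phi (trunc f n) x" for n
  proof (rule vector_eq_rdot[THEN iffD1], rule allI)
    fix z
    have "Phi (trunc f m) (E (B n) z) = Phi (\<lambda>l. trunc f m l * indicator (B n) l) z" for m
      by (simp add: Phi_mult trunc_bfun Phi_indicator)
    moreover have "norm (Phi (\<lambda>l. trunc f m l * indicator (B n) l) z) \<le> real n * norm z" for m
      by (rule norm_Phi_le) (use trunc_le[of f m] in \<open>auto simp: B_def indicator_def trunc_def\<close>)
    \<comment> \<open>Vectors cut off to \<open>B n\<close> lie in the domain of \<open>f\<close>,
      hence are legitimate test vectors in the weak definition.\<close>
    ultimately have z: "E (B n) z \<in> spectral_domain K E f"
      by (auto simp: in_spectral_domain_iff E_in_K)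
    have "(\<lambda>m. Phi (trunc f m) x \<bullet> E (B n) z) \<longlonglongrightarrow> y \<bullet> E (B n) z"
      using Phi_trunc_inner_tendsto[OF f x(1) z] xy[OF z] by simp
    moreover have "\<forall>\<^sub>F m in sequentially. Phi (trunc f m) x \<bullet> E (B n) z = Phi (trunc f n) x \<bullet> z"
      using eventually_ge_at_top[of n]
    proof eventually_elim
      case (elim m)
      then have "(\<lambda>l. indicator (B n) l * trunc f m l) = trunc f n"
        by (auto simp: fun_eq_iff trunc_def B_def indicator_def)
      then have "E (B n) (Phi (trunc f m) x) = Phi (trunc f n) x"
        using Phi_mult[of "indicator (B n)" "trunc f m" x] by (simp add: trunc_bfun Phi_indicator)
      then show ?case using E_sym[OF B, of n "Phi (trunc f m) x" z] by simp
    qed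
    ultimately have "(\<lambda>m::nat. Phi (trunc f n) x \<bullet> z) \<longlonglongrightarrow> y \<bullet> E (B n) z"
      by (rule Lim_transform_eventually)
    then show "E (B n) y \<bullet> z = Phi (trunc f n) x \<bullet> z" by (simp add: LIMSEQ_const_iff E_sym)
  qed
  have "(\<lambda>n. Phi (indicator (B n)) y) \<longlonglongrightarrow> Phi (\<lambda>_. 1) y"
  proof (rule Phi_tendsto)
    fix l
    obtain N where "\<bar>f l\<bar> \<le> real N" using real_arch_simple by blast
    then have "\<forall>\<^sub>F n in sequentially. indicator (B n) l = (1::real)"
      by (intro eventually_mono[OF eventually_ge_at_top[of N]]) (auto simp: B_def)
    then show "(\<lambda>n. indicator (B n) l) \<longlonglongrightarrow> (1::real)" by (rule tendsto_eventually)
  next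
    show "\<bar>indicator (B n) l\<bar> \<le> (1::real)" for n l by (simp add: indicator_def)
  qed simp
  moreover have "Phi (\<lambda>_. 1) y = y"
    using y by (simp add: Phi_one E_UNIV)
  ultimately show "x \<in> K \<and> y \<in> K \<and> (\<lambda>n. Phi (trunc f n) x) \<longlonglongrightarrow> y"
    using x y EB by (simp add: Phi_indicator)
qed

end

section \<open>The Hausdorff moment problem\<close>

text \<open>The expansion of \<open>1 = (a + (1 - a)) ^ n\<close>, with \<open>d k l\<close> in the
  role of \<open>a ^ k * (1 - a) ^ l\<close>.\<close>

lemma sum_binomial_pascal:
  fixes d :: "nat \<Rightarrow> nat \<Rightarrow> real"
  assumes rec: "\<And>k l. d k l = d (Suc k) l + d k (Suc l)"
  shows "(\<Sum>k\<le>n. (n choose k) * d (m + k) (l + n - k)) = d m l"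
proof (induction n arbitrary: m l)
  case (Suc n)
  define g where "g k = d (m + k) (l + Suc n - k)" for k
  have "(\<Sum>k\<le>Suc n. (Suc n choose k) * g k)
      = g 0 + (\<Sum>k\<le>n. (n choose Suc k) * g (Suc k)) + (\<Sum>k\<le>n. (n choose k) * g (Suc k))"
    by (subst sum.atMost_Suc_shift) (simp add: algebra_simps sum.distrib)
  also have "g 0 + (\<Sum>k\<le>n. (n choose Suc k) * g (Suc k)) = (\<Sum>k\<le>Suc n. (n choose k) * g k)"
    by (subst sum.atMost_Suc_shift) simp
  also have "\<dots> = (\<Sum>k\<le>n. (n choose k) * d (m + k) (Suc l + n - k))"
    by (simp add: g_def)
  also have "\<dots> = d m (Suc l)" by (rule Suc)
  also have "(\<Sum>k\<le>n. (n choose k) * g (Suc k)) = d (Suc m) l"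
    using Suc[of "Suc m" l] by (simp add: g_def)
  finally show ?case using rec[of m l] by (simp add: g_def)
qed simp

text \<open>The factorial moments of the binomial weights are exact for every
  \<open>n \<ge> m\<close>: rewriting the product of binomials and shifting \<open>k\<close> by
  \<open>m\<close> reduces the sum to \<open>sum_binomial_pascal\<close>.\<close>

lemma sum_binomial_moment:
  fixes d :: "nat \<Rightarrow> nat \<Rightarrow> real"
  assumes rec: "\<And>k l. d k l = d (Suc k) l + d k (Suc l)" and "m \<le> n"
  shows "(\<Sum>k\<le>n. (n choose k) * (k choose m) * d k (n - k)) = (n choose m) * d m 0"
proof -
  have "(\<Sum>k\<le>n. real ((n choose k) * (k choose m)) * d k (n - k))
      = (\<Sum>k\<in>{m..n}. real ((n choose k) * (k choose m)) * d k (n - k))"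
    by (rule sum.mono_neutral_right) auto
  also have "\<dots> = (\<Sum>k\<in>{m..n}. real ((n choose m) * ((n - m) choose (k - m))) * d k (n - k))"
    by (rule sum.cong) (simp_all only: choose_mult atLeastAtMost_iff)
  also have "\<dots> = (\<Sum>j\<le>n - m. real ((n choose m) * ((n - m) choose j)) * d (m + j) (n - m - j))"
    using assms(2) by (intro sum.reindex_bij_witness[of _ "\<lambda>j. m + j" "\<lambda>k. k - m"]) auto
  also have "\<dots> = (n choose m) * (\<Sum>j\<le>n - m. ((n - m) choose j) * d (m + j) (0 + (n - m) - j))"
    by (simp add: sum_distrib_left mult.assoc)
  also have "\<dots> = (n choose m) * d m 0" by (subst sum_binomial_pascal[where d=d, OF rec]) simp
  finally show ?thesis by simp
qed

text \<open>Compares factorial with ordinary moments: the quotient of binomials is the product of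
  the ratios \<open>(k - i) / (n - i)\<close> for \<open>i < m\<close>, each within
  \<open>m / (n - m)\<close> of \<open>k / n\<close>, and products of numbers of modulus at most one
  differ by at most the sum of the differences of their factors.\<close>

lemma choose_ratio_approx:
  assumes "k \<le> n" "2 * m < n"
  shows "\<bar>(real k / real n) ^ m - (k choose m) / (n choose m)\<bar> \<le> real m * (real m / real (n - m))"
proof -
  define w where "w i = (real k - real i) / (real n - real i)" for i
  have ratio: "(k choose m) / (n choose m) = (\<Prod>i\<in>{0..<m}. w i)"
    by (simp add: binomial_gbinomial gbinomial_prod_rev prod_dividef w_def)
  have "\<bar>(\<Prod>i\<in>{0..<m}. real k / real n) - (\<Prod>i\<in>{0..<m}. w i)\<bar>
      \<le> (\<Sum>i\<in>{0..<m}. norm (real k / real n - w i))"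
    unfolding real_norm_def[symmetric]
  proof (rule norm_prod_diff)
    show "norm (real k / real n) \<le> 1" using assms by simp
    fix i assume i: "i \<in> {0..<m}"
    \<comment> \<open>Here \<open>2 * m < n\<close> enters: for \<open>k < i\<close> the numerator
      is negative, and its modulus must still be at most \<open>n - i\<close>.\<close>
    then have "\<bar>real k - real i\<bar> \<le> real n - real i" "0 < real n - real i" using assms by auto
    then show "norm (w i) \<le> 1" by (simp add: w_def)
  qed
  also have "\<dots> \<le> (\<Sum>i\<in>{0..<m}. real m / real (n - m))"
  proof (rule sum_mono)
    fix i assume i: "i \<in> {0..<m}"
    have pos: "0 < real n - real i" "0 < real n" "0 < real (n - m)" "real (n - m) \<le> real n - real i"
      using i assms by auto
    have "real k / real n - w i = real i * (real n - real k) / (real n * (real n - real i))"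
      using pos by (simp add: w_def field_simps)
    also have "\<bar>\<dots>\<bar> = real i * ((real n - real k) / real n) / (real n - real i)"
      using pos assms by (simp add: abs_mult)
    also have "\<dots> \<le> real m * 1 / real (n - m)"
      using i assms pos by (intro frac_le mult_mono) (auto simp: field_simps)
    finally show "norm (real k / real n - w i) \<le> real m / real (n - m)" by simp
  qed
  finally show ?thesis by (simp add: ratio)
qed

lemma hausdorff_moment_prob:
  fixes d :: "nat \<Rightarrow> nat \<Rightarrow> real"
  assumes rec: "\<And>k l. d k l = d (Suc k) l + d k (Suc l)" and pos: "\<And>k l. 0 \<le> d k l"
    and one: "d 0 0 = 1"
  obtains M where "real_distribution M" "AE a in M. clamp01 a = a"
    "\<And>m. (\<integral>a. clamp01 a ^ m \<partial>M) = d m 0"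
proof -
  \<comment> \<open>If \<open>d k l\<close> is the integral of \<open>a ^ k * (1 - a) ^ l\<close>,
    these weights are the integrals of the Bernstein polynomials of degree \<open>n\<close>.\<close>
  define p where "p n k = (n choose k) * d k (n - k)" for n k
  have p0: "0 \<le> p n k" for n k by (simp add: p_def pos)
  have p1: "(\<Sum>k\<le>n. p n k) = 1" for n
    using sum_binomial_pascal[where d=d, OF rec, of n 0 0] by (simp add: p_def one)
  define \<mu> where "\<mu> n = distr (point_measure {..n} (\<lambda>k. ennreal (p n k))) borel (\<lambda>k. real k / real n)" for n
  have rd: "real_distribution (\<mu> n)" for n
  proof -
    have "prob_space (point_measure {..n} (\<lambda>k. ennreal (p n k)))"
      by (rule prob_spaceI)
         (simp add: space_point_measure emeasure_point_measure_finite sum_ennreal p0 p1)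
    then have "prob_space (\<mu> n)" unfolding \<mu>_def by (rule prob_space.prob_space_distr) simp
    then show ?thesis by (intro real_distribution.intro real_distribution_axioms.intro) (simp_all add: \<mu>_def)
  qed
  have int\<mu>: "(\<integral>a. f a \<partial>\<mu> n) = (\<Sum>k\<le>n. p n k * f (real k / real n))" if "f \<in> borel_measurable borel" for f n
    unfolding \<mu>_def using that p0
    by (simp add: integral_distr lebesgue_integral_point_measure_finite)
  \<comment> \<open>This includes \<open>n = 0\<close>, where the quotient is \<open>0\<close> by
    convention.\<close>
  have unit: "0 \<le> real k / real n" "real k / real n \<le> 1" if "k \<le> n" for k n
    using that by (auto simp: divide_le_eq_1)
  have "tight \<mu>"
    unfolding tight_def
  proof (intro conjI allI impI)
    fix e :: real assume e: "0 < e"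
    \<comment> \<open>Tightness is phrased with half-open intervals; this one contains
      \<open>[0, 1]\<close>, which carries every \<open>\<mu> n\<close>.\<close>
    have "measure (\<mu> n) {-1<..2} = 1" for n
    proof -
      interpret real_distribution "\<mu> n" by (rule rd)
      have "(\<integral>a. indicator {-1<..2} a \<partial>\<mu> n) = (\<Sum>k\<le>n. p n k * indicator {-1<..2} (real k / real n))"
        by (rule int\<mu>) simp
      also have "\<dots> = (\<Sum>k\<le>n. p n k)"
      proof (intro sum.cong refl)
        fix k assume "k \<in> {..n}"
        then have "0 \<le> real k / real n" "real k / real n \<le> 1" using unit by auto
        then have "real k / real n \<in> {-1<..2}" unfolding greaterThanAtMost_iff by linarith
        then show "p n k * indicator {-1<..2} (real k / real n) = p n k" by (simp only: indicator_simps mult_1_right)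
      qed
      finally show ?thesis by (simp add: p1)
    qed
    then show "\<exists>a b. a < b \<and> (\<forall>n. 1 - e < measure (\<mu> n) {a<..b})"
      using e by (intro exI[of _ "-1"] exI[of _ 2]) auto
  qed (rule rd)
  from tight_imp_convergent_subsubsequence[OF this strict_monoI[of "\<lambda>n. n"]]
  obtain r M where r: "strict_mono (r :: nat \<Rightarrow> nat)" and M: "real_distribution M"
    and wc: "weak_conv_m (\<lambda>n. \<mu> (r n)) M"
    by (auto simp: comp_def)
  interpret real_distribution M by (rule M)
  have conv: "(\<lambda>n. \<integral>a. f a \<partial>\<mu> (r n)) \<longlonglongrightarrow> (\<integral>a. f a \<partial>M)"
    if "continuous_on UNIV f" "\<And>x. \<bar>f x\<bar> \<le> B" for f :: "real \<Rightarrow> real" and B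
    by (rule weak_conv_imp_integral_bdd_continuous_conv[OF rd M wc])
       (use that in \<open>auto simp: continuous_on_eq_continuous_at\<close>)
  show thesis
  proof (rule that[OF M])
    \<comment> \<open>A bounded continuous function vanishing exactly on \<open>[0, 1]\<close>: its
      zero integral survives the weak limit and localises \<open>M\<close>.\<close>
    define f where "f a = min 1 \<bar>a - clamp01 a\<bar>" for a
    have fc: "continuous_on UNIV f" unfolding f_def by (intro continuous_intros)
    have fm: "f \<in> borel_measurable borel" using fc by (rule borel_measurable_continuous_onI)
    have fb: "\<bar>f a\<bar> \<le> 1" "0 \<le> f a" for a by (auto simp: f_def)
    have "(\<integral>a. f a \<partial>\<mu> n) = 0" for n
      unfolding int\<mu>[OF fm] using unit by (intro sum.neutral) (auto simp: f_def clamp01_id)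
    then have "(\<integral>a. f a \<partial>M) = 0" using conv[OF fc fb(1)] by (simp add: LIMSEQ_const_iff)
    moreover have "integrable M f"
      by (rule integrable_bfun[OF finite_measure_axioms events_eq_borel bfunI[OF fm fb(1)]])
    ultimately have "AE a in M. f a = 0"
      using integral_nonneg_eq_0_iff_AE[of M f] fb(2) by simp
    then show "AE a in M. clamp01 a = a" by eventually_elim (auto simp: f_def min_def split: if_splits)
  next
    fix m
    have c: "continuous_on UNIV (\<lambda>a. clamp01 a ^ m)" by (intro continuous_intros)
    have b: "\<bar>clamp01 a ^ m\<bar> \<le> 1" for a
      using clamp01_range[of a] by (simp add: power_le_one)
    have "(\<lambda>n. \<integral>a. clamp01 a ^ m \<partial>\<mu> (r n)) \<longlonglongrightarrow> (\<integral>a. clamp01 a ^ m \<partial>M)" by (rule conv[OF c b])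
    moreover have "(\<lambda>n. \<integral>a. clamp01 a ^ m \<partial>\<mu> n) \<longlonglongrightarrow> d m 0"
    proof (rule LIM_zero_cancel, rule Lim_null_comparison)
      show "\<forall>\<^sub>F n in sequentially. norm ((\<integral>a. clamp01 a ^ m \<partial>\<mu> n) - d m 0) \<le> real m * (real m / real (n - m))"
        using eventually_gt_at_top[of "2 * m"]
      proof eventually_elim
        case (elim n)
        have "(\<integral>a. clamp01 a ^ m \<partial>\<mu> n) = (\<Sum>k\<le>n. p n k * (real k / real n) ^ m)"
          by (subst int\<mu>) (auto intro!: sum.cong simp: clamp01_id[OF unit])
        moreover have "d m 0 = (\<Sum>k\<le>n. p n k * ((k choose m) / (n choose m)))"
          using sum_binomial_moment[where d=d, OF rec, of m n] elim
          by (simp add: p_def field_simps flip: sum_divide_distrib)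
        ultimately have "norm ((\<integral>a. clamp01 a ^ m \<partial>\<mu> n) - d m 0)
            = \<bar>\<Sum>k\<le>n. p n k * ((real k / real n) ^ m - (k choose m) / (n choose m))\<bar>"
          by (simp add: right_diff_distrib sum_subtractf)
        also have "\<dots> \<le> (\<Sum>k\<le>n. p n k * (real m * (real m / real (n - m))))"
        proof (intro order_trans[OF sum_abs] sum_mono)
          fix k assume "k \<in> {..n}"
          then show "\<bar>p n k * ((real k / real n) ^ m - (k choose m) / (n choose m))\<bar>
              \<le> p n k * (real m * (real m / real (n - m)))"
            using choose_ratio_approx[of k n m] elim p0[of n k] unfolding abs_mult
            by (simp only: abs_of_nonneg) (intro mult_left_mono, simp_all)
        qed
        also have "\<dots> = real m * (real m / real (n - m))"
          using p1[of n] by (simp only: sum_distrib_right[symmetric] mult_1_left)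
        finally show ?case .
      qed
      show "(\<lambda>n. real m * (real m / real (n - m))) \<longlonglongrightarrow> 0"
        by (rule LIMSEQ_offset[of _ m]) (simp add: lim_const_over_n)
    qed
    then have "(\<lambda>n. \<integral>a. clamp01 a ^ m \<partial>\<mu> (r n)) \<longlonglongrightarrow> d m 0"
      using LIMSEQ_subseq_LIMSEQ[OF _ r, of "\<lambda>n. \<integral>a. clamp01 a ^ m \<partial>\<mu> n"] by (simp add: comp_def)
    ultimately show "(\<integral>a. clamp01 a ^ m \<partial>M) = d m 0" by (rule LIMSEQ_unique)
  qed
qed

text \<open>Rescaling by the total mass \<open>d 0 0\<close>; if that is \<open>0\<close>, the
  moments decrease from \<open>0\<close> and the null measure represents them.\<close>

lemma hausdorff_moment:
  fixes d :: "nat \<Rightarrow> nat \<Rightarrow> real"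
  assumes rec: "\<And>k l. d k l = d (Suc k) l + d k (Suc l)" and pos: "\<And>k l. 0 \<le> d k l"
  shows "\<exists>M. finite_measure M \<and> sets M = sets borel \<and> measure M UNIV = d 0 0 \<and>
    (AE a in M. clamp01 a = a) \<and> (\<forall>m. (\<integral>a. clamp01 a ^ m \<partial>M) = d m 0)"
proof (cases "d 0 0 = 0")
  case True
  have "d m 0 \<le> 0" for m
  proof (induction m)
    case (Suc m)
    then show ?case using rec[of m 0] pos[of m 1] by simp
  qed (simp add: True)
  then have "d m 0 = 0" for m using pos[of m 0] by (simp add: antisym)
  then show ?thesis
    by (intro exI[of _ "null_measure borel"]) (auto intro!: finite_measureI simp: AE_iff_null null_sets_def)
next
  case False
  define D where "D = d 0 0"
  have D: "D > 0" using False pos[of 0 0] by (simp add: D_def)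
  obtain M0 where M0: "real_distribution M0" "AE a in M0. clamp01 a = a"
    "\<And>m. (\<integral>a. clamp01 a ^ m \<partial>M0) = d m 0 / D"
  proof (rule hausdorff_moment_prob[of "\<lambda>k l. d k l / D"])
    show "d k l / D = d (Suc k) l / D + d k (Suc l) / D" for k l
      using rec[of k l] by (simp add: add_divide_distrib)
  qed (use D pos in \<open>simp_all add: D_def\<close>)
  interpret real_distribution M0 by (rule M0)
  define M where "M = density M0 (\<lambda>_. ennreal D)"
  have eM: "emeasure M UNIV = ennreal D"
  proof -
    have "emeasure M0 UNIV = 1" using emeasure_space_1 by simp
    then show ?thesis by (simp add: M_def emeasure_density_const)
  qed
  have "finite_measure M" 
  proof (rule finite_measureI)
    have "space M = UNIV" by (simp add: M_def)
    then show "emeasure M (space M) \<noteq> \<infinity>" by (simp add: eM)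
  qed
  moreover have "measure M UNIV = D" using D eM by (simp add: measure_def)
  moreover have "AE a in M. clamp01 a = a"
    unfolding M_def by (subst AE_density) (use M0(2) in auto)
  moreover have "(\<integral>a. clamp01 a ^ m \<partial>M) = d m 0" for m
    using D M0(3)[of m] by (simp add: M_def integral_density)
  moreover have "sets M = sets borel" by (simp add: M_def)
  ultimately show ?thesis unfolding D_def by blast
qed

section \<open>The spectral theorem for a positive contraction\<close>

locale positive_contraction =
  fixes A :: "'h::{real_inner,complete_space} \<Rightarrow> 'h"
  assumes linear_A: "linear A" and A_sym: "A x \<bullet> y = x \<bullet> A y"
    and A_nonneg: "0 \<le> A x \<bullet> x" and A_le: "A x \<bullet> x \<le> x \<bullet> x"
begin

definition R :: "'h \<Rightarrow> 'h" where "R x = x - A x"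

lemma A_add: "A (x + y) = A x + A y" and A_diff: "A (x - y) = A x - A y"
  and A_scale: "A (c *\<^sub>R x) = c *\<^sub>R A x"
  using linear_add[OF linear_A] linear_diff[OF linear_A] linear_cmul[OF linear_A] by auto

lemma R_sym: "R x \<bullet> y = x \<bullet> R y"
  by (simp add: R_def inner_diff_left inner_diff_right A_sym)

lemma R_nonneg: "0 \<le> R x \<bullet> x"
  using A_le[of x] by (simp add: R_def inner_diff_left)

lemma A_R: "A (R x) = R (A x)"
  by (simp add: R_def A_diff)

text \<open>A product of commuting nonnegative operators, without square roots: splitting
  \<open>x = A x + R x\<close> yields the form of \<open>R\<close> at \<open>A x\<close> plus the
  form of \<open>A\<close> at \<open>R x\<close>.\<close>

lemma AR_nonneg: "0 \<le> A (R x) \<bullet> x"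
proof -
  have "x = A x + R x" by (simp add: R_def)
  then have "A (R x) \<bullet> x = A (R x) \<bullet> A x + A (R x) \<bullet> R x" by (metis inner_add_right)
  also have "A (R x) \<bullet> A x = R (A x) \<bullet> A x" by (simp add: A_R)
  finally show ?thesis using R_nonneg[of "A x"] A_nonneg[of "R x"] by linarith
qed

lemma pow_A: "(A ^^ k) (A x) = A ((A ^^ k) x)" and pow_R: "(R ^^ k) (R x) = R ((R ^^ k) x)"
  by (simp_all add: funpow_swap1)

lemma pow_A_R: "(A ^^ k) (R x) = R ((A ^^ k) x)"
  by (induction k) (simp_all add: A_R)

lemma pow_R_A: "(R ^^ k) (A x) = A ((R ^^ k) x)"
  by (induction k) (simp_all add: A_R)

lemma pow_A_diff: "(A ^^ k) (x - y) = (A ^^ k) x - (A ^^ k) y"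
  by (induction k) (simp_all add: A_diff)

definition moment :: "'h \<Rightarrow> nat \<Rightarrow> nat \<Rightarrow> real" where
  "moment x k l = (A ^^ k) ((R ^^ l) x) \<bullet> x"

lemma moment_rec: "moment x k l = moment x (Suc k) l + moment x k (Suc l)"
proof -
  have "(A ^^ k) ((R ^^ Suc l) x) = (A ^^ k) ((R ^^ l) x) - (A ^^ Suc k) ((R ^^ l) x)"
    by (simp add: R_def pow_A_diff pow_A)
  then show ?thesis by (simp add: moment_def inner_diff_left)
qed

lemma moment_step: "moment x (Suc (Suc k)) l = moment (A x) k l" "moment x k (Suc (Suc l)) = moment (R x) k l"
  by (simp_all add: moment_def pow_A pow_R pow_R_A pow_A_R A_sym R_sym)

text \<open>Two factors \<open>A\<close>, or two factors \<open>R\<close>, split evenly between the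
  two sides of the inner product, so only the exponents \<open>0\<close> and \<open>1\<close>
  remain.\<close>

lemma moment_nonneg: "0 \<le> moment x k l"
proof (induction "k + l" arbitrary: k l x rule: less_induct)
  case less
  show ?case
  proof (cases "k \<ge> 2")
    case True
    then obtain k' where "k = Suc (Suc k')" by (metis Suc_le_D numeral_2_eq_2 Suc_le_mono)
    then show ?thesis using less[of k' l "A x"] by (simp add: moment_step)
  next
    case k: False
    show ?thesis
    proof (cases "l \<ge> 2")
      case True
      then obtain l' where "l = Suc (Suc l')" by (metis Suc_le_D numeral_2_eq_2 Suc_le_mono)
      then show ?thesis using less[of k l' "R x"] by (simp add: moment_step)
    next
      case False
      then have "(k = 0 \<or> k = 1) \<and> (l = 0 \<or> l = 1)" using k by auto
      then show ?thesis using A_nonneg[of x] R_nonneg[of x] AR_nonneg[of x] by (auto simp: moment_def)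
    qed
  qed
qed

definition M :: "'h \<Rightarrow> real measure" where
  "M x = (SOME M. finite_measure M \<and> sets M = sets borel \<and> measure M UNIV = moment x 0 0 \<and>
    (AE a in M. clamp01 a = a) \<and> (\<forall>m. (\<integral>a. clamp01 a ^ m \<partial>M) = moment x m 0))"

lemma M_props:
  "finite_measure (M x)" "sets (M x) = sets borel" "measure (M x) UNIV = x \<bullet> x"
  "AE a in M x. clamp01 a = a" "(\<integral>a. clamp01 a ^ m \<partial>M x) = (A ^^ m) x \<bullet> x"
  using someI_ex[OF hausdorff_moment[of "moment x", OF moment_rec moment_nonneg]] unfolding M_def[symmetric]
  by (auto simp: moment_def)

lemma integral_M_clamp:
  assumes "g \<in> bfun" shows "(\<integral>a. g a \<partial>M x) = (\<integral>a. g (clamp01 a) \<partial>M x)"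
proof (rule integral_cong_AE)
  have "borel_measurable (M x) = borel_measurable borel" by (rule measurable_cong_sets[OF M_props(2) refl])
  then show "g \<in> borel_measurable (M x)" "(\<lambda>a. g (clamp01 a)) \<in> borel_measurable (M x)"
    using bfun_measurable[OF assms] measurable_compose[OF clamp01_measurable bfun_measurable[OF assms]]
    by blast+
  show "AE a in M x. g a = g (clamp01 a)" using M_props(4)[of x] by eventually_elim simp
qed

text \<open>Functionals carried by \<open>[0, 1]\<close>; by \<open>sfun_eq_zero_moments\<close> two
  of them agree as soon as their moments do, so identities of the calculus need only be checked on
  powers of \<open>A\<close>.\<close>

definition conc :: "((real \<Rightarrow> real) \<Rightarrow> real) \<Rightarrow> bool" where
  "conc L \<longleftrightarrow> sfun L \<and> (\<forall>g\<in>bfun. L g = L (\<lambda>a. g (clamp01 a)))"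

lemma conc_eq:
  assumes "conc L" "conc L'" "\<And>n. L (\<lambda>a. clamp01 a ^ n) = L' (\<lambda>a. clamp01 a ^ n)" "f \<in> bfun"
  shows "L f = L' f"
  using sfun_eq_zero_moments[of "\<lambda>f. L f - L' f" f] assms unfolding conc_def by auto

lemma conc_plus: "conc L \<Longrightarrow> conc L' \<Longrightarrow> conc (\<lambda>f. L f + L' f)"
  and conc_cmult: "conc L \<Longrightarrow> conc (\<lambda>f. c * L f)"
  unfolding conc_def by auto

text \<open>The weight \<open>f\<close> is evaluated at \<open>a\<close>, not at
  \<open>clamp01 a\<close>; both sides are brought to the form with all arguments clamped, and
  clamping is idempotent.\<close>

lemma conc_weight:
  assumes "conc L" and f: "f \<in> bfun" shows "conc (\<lambda>g. L (\<lambda>a. f a * g a))"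
  unfolding conc_def
proof (intro conjI ballI)
  show "sfun (\<lambda>g. L (\<lambda>a. f a * g a))" using assms by (auto simp: conc_def)
  fix g assume g: "g \<in> bfun"
  have gc: "(\<lambda>a. g (clamp01 a)) \<in> bfun" by (rule bfun_comp[OF g clamp01_measurable])
  have "clamp01 (clamp01 a) = clamp01 a" for a by (simp add: clamp01_id clamp01_range)
  moreover have "\<And>h. h \<in> bfun \<Longrightarrow> L h = L (\<lambda>a. h (clamp01 a))" using assms by (auto simp: conc_def)
  from this[of "\<lambda>a. f a * g a"] this[of "\<lambda>a. f a * g (clamp01 a)"]
  have "L (\<lambda>a. f a * g a) = L (\<lambda>a. f (clamp01 a) * g (clamp01 a))"
    "L (\<lambda>a. f a * g (clamp01 a)) = L (\<lambda>a. f (clamp01 a) * g (clamp01 (clamp01 a)))"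
    using f g gc by auto
  ultimately show "L (\<lambda>a. f a * g a) = L (\<lambda>a. f a * g (clamp01 a))" by simp
qed

lemma conc_integral: "conc (\<lambda>f. \<integral>a. f a \<partial>M x)"
  unfolding conc_def using integral_M_clamp sfun_integral[OF M_props(1,2)] by blast

lemma conc_mform: "conc (\<lambda>f. mform M f x y)"
proof -
  have "conc (\<lambda>f. (1/4) * ((\<integral>a. f a \<partial>M (x + y)) + (-1) * (\<integral>a. f a \<partial>M (x - y))))"
    by (intro conc_plus conc_cmult conc_integral)
  then show ?thesis by (simp add: mform_def)
qed

lemma pow_A_add: "(A ^^ n) (x + y) = (A ^^ n) x + (A ^^ n) y"
  and pow_A_scale: "(A ^^ n) (c *\<^sub>R x) = c *\<^sub>R (A ^^ n) x"
  by (induction n) (simp_all add: A_add A_scale)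

lemma pow_A_sym: "(A ^^ n) x \<bullet> y = x \<bullet> (A ^^ n) y"
  by (induction n arbitrary: x y) (simp_all add: A_sym pow_A)

lemma mform_moment: "mform M (\<lambda>a. clamp01 a ^ n) x y = (A ^^ n) x \<bullet> y"
proof -
  have "(A ^^ n) y \<bullet> x = (A ^^ n) x \<bullet> y" using pow_A_sym[of n y x] by (simp only: inner_commute)
  then show ?thesis
    unfolding mform_def M_props pow_A_add pow_A_diff
    by (simp add: inner_add_left inner_add_right inner_diff_left inner_diff_right)
qed

sublocale measure_family M
proof (rule measure_family.intro)
  fix f :: "real \<Rightarrow> real" and x x' y and c :: real
  assume f: "f \<in> bfun"
  show "mform M f (x + x') y = mform M f x y + mform M f x' y"
    by (rule conc_eq[OF conc_mform conc_plus[OF conc_mform conc_mform] _ f])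
       (simp add: mform_moment pow_A_add inner_add_left)
  show "mform M f (c *\<^sub>R x) y = c * mform M f x y"
    by (rule conc_eq[OF conc_mform conc_cmult[OF conc_mform] _ f])
       (simp add: mform_moment pow_A_scale)
  show "mform M f x y = mform M f y x"
    by (rule conc_eq[OF conc_mform conc_mform _ f])
       (simp only: mform_moment pow_A_sym inner_commute[of x])
  show "mform M f x x = (\<integral>l. f l \<partial>M x)"
    by (rule conc_eq[OF conc_mform conc_integral _ f])
       (simp only: mform_moment M_props)
next
  show "measure (M x) UNIV \<le> (norm x)\<^sup>2" for x
    by (simp add: M_props power2_norm_eq_inner)
qed (rule M_props)+

lemma Phi_moment: "Phi (\<lambda>a. clamp01 a ^ n) x = (A ^^ n) x"
  by (rule Phi_eqI) (simp_all add: mform_moment)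

text \<open>As for projection-valued measures, with powers in place of indicators: multiplicativity
  holds for two powers by composing iterates of \<open>A\<close>, then for a power and
  \<open>f\<close>, then for \<open>f\<close> and \<open>g\<close>.\<close>

sublocale borel_calculus M
proof
  fix f g :: "real \<Rightarrow> real" and x
  assume f: "f \<in> bfun" and g: "g \<in> bfun"
  have 1: "mform M (\<lambda>l. clamp01 l ^ n * f l) x z = mform M f ((A ^^ n) x) z" if f: "f \<in> bfun" for n f z
  proof (rule conc_eq[OF conc_weight[OF conc_mform] conc_mform _ f])
    fix k
    have "(A ^^ (n + k)) x = (A ^^ k) ((A ^^ n) x)" by (metis add.commute comp_apply funpow_add)
    then show "mform M (\<lambda>l. clamp01 l ^ n * clamp01 l ^ k) x z = mform M (\<lambda>a. clamp01 a ^ k) ((A ^^ n) x) z"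
      by (simp add: mform_moment flip: power_add)
  qed auto
  have 2: "mform M (\<lambda>l. f l * g l) x z = mform M g x (Phi f z)" for z
  proof (rule conc_eq[OF conc_weight[OF conc_mform f] conc_mform _ g])
    fix n
    show "mform M (\<lambda>l. f l * clamp01 l ^ n) x z = mform M (\<lambda>a. clamp01 a ^ n) x (Phi f z)"
      using 1[OF f, of n z] by (simp add: mult.commute mform_moment Phi_inner[OF f, symmetric] Phi_sym[OF f])
  qed
  show "Phi (\<lambda>l. f l * g l) x = Phi f (Phi g x)"
    by (rule Phi_eqI) (simp_all add: 2 f g Phi_inner[OF g, symmetric] Phi_sym[OF f])
qed

lemma Phi_clamp01: "Phi clamp01 x = A x"
  using Phi_moment[of 1 x] by simp

lemma Phi_one: "Phi (\<lambda>_. 1) x = x"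
  using Phi_moment[of 0 x] by simp

lemma Phi_clamp: 
  assumes "f \<in> bfun" shows "Phi f x = Phi (\<lambda>a. f (clamp01 a)) x"
  using assms conc_mform[unfolded conc_def] bfun_comp[OF assms clamp01_measurable]
  by (intro Phi_eqI) (auto simp: Phi_inner)

end

text \<open>The substitution \<open>l = 1 / a - 1\<close> turns the spectral measure of \<open>A = (1 + S)\<^sup>-\<^sup>1\<close> into that of \<open>S\<close>.\<close>

definition resolvent_inv :: "real \<Rightarrow> real" where "resolvent_inv a = 1 / a - 1"

lemma resolvent_inv_measurable [measurable]: "resolvent_inv \<in> borel_measurable borel"
  unfolding resolvent_inv_def by measurable

text \<open>The properties of \<open>(1 + S)\<^sup>-\<^sup>1\<close> for a nonnegative selfadjoint
  \<open>S\<close> in \<open>K\<close>, extended to the ambient space with range in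
  \<open>K\<close>.\<close>

locale resolvent = positive_contraction A for A :: "'h::{real_inner,complete_space} \<Rightarrow> 'h" +
  fixes K :: "'h set"
  assumes subspace_K: "subspace K" and closed_K: "closed K"
    and A_in_K: "A x \<in> K" and A_inj: "x \<in> K \<Longrightarrow> A x = 0 \<Longrightarrow> x = 0"
begin

text \<open>The point \<open>a = 0\<close> is removed: it belongs to the kernel of \<open>A\<close>
  in the ambient space and has no image under \<open>1 / a - 1\<close>; with
  \<open>1 / 0 = 0\<close> it would be sent to \<open>-1\<close>.\<close>

definition pull :: "(real \<Rightarrow> real) \<Rightarrow> real \<Rightarrow> real" where
  "pull f a = indicator {0<..1} a * f (resolvent_inv a)"

lemma pull_bfun: "f \<in> bfun \<Longrightarrow> pull f \<in> bfun"
  unfolding pull_def[abs_def]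
  by (intro bfun_mult bfun_indicator bfun_comp[of f resolvent_inv]) auto

lemma pull_mult: "pull (\<lambda>l. f l * g l) = (\<lambda>a. pull f a * pull g a)"
  by (auto simp: pull_def indicator_def)

text \<open>Away from \<open>0\<close> the function is divisible by \<open>a\<close>, so the vector
  lies in the range of \<open>A\<close>; the cut at \<open>1 / (n + 1)\<close> is then removed by
  closedness of \<open>K\<close>.\<close>

lemma Phi_pos_in_K:
  assumes "f \<in> bfun" shows "Phi (pull f) x \<in> K"
proof -
  define F where "F n a = indicator {1 / real (Suc n)..1} a * pull f a" for n a
  have F: "F n = (\<lambda>a. clamp01 a * (indicator {1 / real (Suc n)..1} a * inverse a * pull f a))" for n
  proof
    fix a
    have "0 < 1 / real (Suc n)" by simp
    then have "clamp01 a * inverse a = 1" if "a \<in> {1 / real (Suc n)..1}"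
    proof -
      have "0 < a" "a \<le> 1" using that less_le_trans[OF \<open>0 < 1 / real (Suc n)\<close>] by auto
      then show ?thesis by (simp add: clamp01_id)
    qed
    then show "F n a = clamp01 a * (indicator {1 / real (Suc n)..1} a * inverse a * pull f a)"
      by (cases "a \<in> {1 / real (Suc n)..1}") (simp_all add: F_def)
  qed
  obtain C where C: "0 \<le> C" "\<And>l. \<bar>pull f l\<bar> \<le> C" by (rule bfun_bound[OF pull_bfun[OF assms]], rule that)
  have inv: "(\<lambda>a. indicator {1 / real (Suc n)..1} a * inverse a) \<in> bfun" for n
  proof (rule bfunI[of _ "real (Suc n)"])
    fix a
    show "\<bar>indicator {1 / real (Suc n)..1} a * inverse a\<bar> \<le> real (Suc n)"
    proof (cases "a \<in> {1 / real (Suc n)..1}")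
      case True
      then have a: "1 / real (Suc n) \<le> a" by simp
      have 0: "0 < 1 / real (Suc n)" by simp
      have "inverse a \<le> inverse (1 / real (Suc n))" by (rule le_imp_inverse_le[OF a 0])
      moreover have "0 < a" by (rule less_le_trans[OF 0 a])
      ultimately show ?thesis using True by simp
    qed simp
  qed measurable
  have "(\<lambda>n. Phi (F n) x) \<longlonglongrightarrow> Phi (pull f) x"
  proof (rule Phi_tendsto)
    show "F n \<in> borel_measurable borel" for n
      unfolding F_def[abs_def] using bfun_measurable[OF pull_bfun[OF assms]] by measurable
    show "\<bar>F n a\<bar> \<le> C" for n a using C by (auto simp: F_def indicator_def)
    fix a
    show "(\<lambda>n. F n a) \<longlonglongrightarrow> pull f a"
    proof (cases "0 < a \<and> a \<le> 1")
      case True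
      obtain N where N: "inverse (real (Suc N)) < a" using reals_Archimedean True by blast
      have "\<forall>\<^sub>F n in sequentially. F n a = pull f a"
      proof (rule eventually_mono[OF eventually_ge_at_top[of N]])
        fix n assume "N \<le> n"
        then have "1 / real (Suc n) \<le> 1 / real (Suc N)" by (intro divide_left_mono) auto
        then have "a \<in> {1 / real (Suc n)..1}" using N True by (simp add: inverse_eq_divide)
        then show "F n a = pull f a" by (simp add: F_def)
      qed
      then show ?thesis by (rule tendsto_eventually)
    next
      case False
      then have "pull f a = 0" by (auto simp: pull_def)
      then show ?thesis by (simp add: F_def)
    qed
  qed
  moreover have "Phi (F n) x \<in> K" for n
    unfolding F using Phi_mult[OF clamp01_bfun bfun_mult[OF inv[of n] pull_bfun[OF assms]], of x] A_in_K
    by (simp add: Phi_clamp01)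
  ultimately show ?thesis by (rule closed_sequentially[OF closed_K, rotated])
qed

text \<open>The spectral projection of \<open>{0}\<close> maps into the kernel of \<open>A\<close>,
  which meets \<open>K\<close> only in \<open>0\<close>.\<close>

lemma Phi_pos:
  assumes x: "x \<in> K" shows "Phi (indicator {0<..1}) x = x"
proof -
  define y where "y = Phi (indicator {0}) x"
  have "Phi (\<lambda>a. indicator {0<..1} a + indicator {0} a) x = Phi (\<lambda>_. 1) x"
  proof (subst Phi_clamp)
    have "indicator {0<..1} (clamp01 a) + indicator {0} (clamp01 a) = (1 :: real)" for a
      using clamp01_range[of a] by (cases "clamp01 a = 0") (auto simp: indicator_def)
    then have "(\<lambda>a. indicator {0<..1} (clamp01 a) + indicator {0} (clamp01 a)) = (\<lambda>_. 1 :: real)"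
      by blast
    then show "Phi (\<lambda>a. indicator {0<..1} (clamp01 a) + indicator {0} (clamp01 a)) x = Phi (\<lambda>_. 1) x"
      by simp
  qed auto
  then have sum: "x = Phi (indicator {0<..1}) x + y" by (simp add: Phi_one Phi_add_fun y_def)
  have "pull (\<lambda>_. 1) = indicator {0<..1}" by (auto simp: pull_def)
  then have "Phi (indicator {0<..1}) x \<in> K" using Phi_pos_in_K[of "\<lambda>_. 1" x] by simp
  then have "x - Phi (indicator {0<..1}) x \<in> K" using x subspace_diff[OF subspace_K] by blast
  moreover have "x - Phi (indicator {0<..1}) x = y" using sum by (metis add_diff_cancel_left')
  ultimately have "y \<in> K" by simp
  moreover have "A y = 0"
  proof -
    have "A y = Phi (\<lambda>a. clamp01 a * indicator {0} a) x"
      using Phi_mult[of clamp01 "indicator {0}" x] by (simp add: Phi_clamp01 y_def)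
    also have "(\<lambda>a. clamp01 a * indicator {0} a) = (\<lambda>a. 0 * 1)"
      by (rule ext) (auto simp: indicator_def clamp01_def)
    also have "Phi (\<lambda>a. 0 * 1) x = 0" using Phi_scale_fun[of "\<lambda>_. 1" 0 x] by simp
    finally show ?thesis .
  qed
  ultimately have "y = 0" by (rule A_inj)
  then show ?thesis using sum by simp
qed

definition E :: "real set \<Rightarrow> 'h \<Rightarrow> 'h" where
  "E B = Phi (pull (indicator B))"

lemma pvm_E: "projection_valued_measure K E"
  unfolding projection_valued_measure_def
proof (intro conjI ballI allI impI)
  fix B :: "real set" assume B: "B \<in> sets borel"
  have b: "pull (indicator B) \<in> bfun" using B by (intro pull_bfun) simp
  show "linear (E B)" unfolding E_def by (rule linear_Phi[OF b])
  show "range (E B) \<subseteq> K" using Phi_pos_in_K B by (auto simp: E_def)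
  show "E B x \<bullet> y = x \<bullet> E B y" for x y unfolding E_def by (rule Phi_sym[OF b])
  have "(\<lambda>l. indicator B l * indicator B l :: real) = indicator B" by (simp add: indicator_mult)
  then show "E B (E B x) = E B x" for x
    unfolding E_def Phi_mult[OF b b, symmetric] pull_mult[symmetric] by simp
next
  fix x assume "x \<in> K"
  moreover have "pull (indicator UNIV) = indicator {0<..1}" by (auto simp: pull_def)
  ultimately show "E UNIV x = x" by (simp add: E_def Phi_pos)
next
  fix A :: "nat \<Rightarrow> real set" and x
  assume A: "range A \<subseteq> sets borel" "disjoint_family A"
  then have m: "A i \<in> sets borel" for i by auto
  have eq: "(\<Sum>i<n. indicator (A i) l) = (indicator (\<Union>i<n. A i) l :: real)" for n l
    using A(2) by (intro indicator_UN_disjoint[symmetric]) (auto simp: disjoint_family_on_def)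
  have part: "(\<Sum>i<n. E (A i) x) = Phi (pull (indicator (\<Union>i<n. A i))) x" for n
  proof (induction n)
    case 0
    have "pull (indicator (\<Union>i<0. A i)) = (\<lambda>_. 0 * 1)" by (auto simp: pull_def)
    then have "Phi (pull (indicator (\<Union>i<0. A i))) x = 0 *\<^sub>R Phi (\<lambda>_. 1) x"
      by (simp only: Phi_scale_fun[OF bfun_const])
    then show ?case by (simp only: lessThan_0 sum.empty scaleR_zero_left)
  next
    case (Suc n)
    have "pull (indicator (\<Union>i<Suc n. A i)) = (\<lambda>a. pull (indicator (\<Union>i<n. A i)) a + pull (indicator (A n)) a)"
      unfolding pull_def eq[symmetric] by (simp add: algebra_simps)
    then show ?case using Suc m by (simp add: E_def Phi_add_fun pull_bfun)
  qed
  show "(\<lambda>n. E (A n) x) sums E (\<Union>n. A n) x"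
    unfolding sums_def part unfolding E_def
  proof (rule Phi_tendsto)
    show "pull (indicator (\<Union>i<n. A i)) \<in> borel_measurable borel" for n
      using m by (intro bfun_measurable pull_bfun) auto
    show "\<bar>pull (indicator (\<Union>i<n. A i)) a\<bar> \<le> 1" for n a by (simp add: pull_def indicator_def)
    show "(\<lambda>n. pull (indicator (\<Union>i<n. A i)) a) \<longlonglongrightarrow> pull (indicator (\<Union>n. A n)) a" for a
      unfolding pull_def by (intro tendsto_mult_left LIMSEQ_indicator_UN)
  qed
qed

sublocale E: pvm K E by (rule pvm.intro[OF pvm_E])

lemma sfun_pull: "sfun (\<lambda>f. mform M (pull f) x z)"
  unfolding pull_def[abs_def]
  by (rule sfun_comp[OF sfun_weight[OF sfun_mform], of "indicator {0<..1}" resolvent_inv, simplified])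

text \<open>The change of variables on the level of operators, checked on indicators, where it is
  the definition of \<open>E\<close>.\<close>

lemma E_Phi: "f \<in> bfun \<Longrightarrow> E.Phi f x = Phi (pull f) x"
proof (rule E.Phi_eqI)
  fix z assume f: "f \<in> bfun"
  have "mform E.M f x z = mform M (pull f) x z"
  proof (rule sfun_eq_indicator[OF E.sfun_mform_M sfun_pull _ f])
    fix B :: "real set" assume B: "B \<in> sets borel"
    then show "mform E.M (indicator B) x z = mform M (pull (indicator B)) x z"
      by (simp add: E.mform_indicator E_def Phi_inner pull_bfun)
  qed
  then show "mform E.M f x z = Phi (pull f) x \<bullet> z" using f by (simp add: Phi_inner pull_bfun)
qed

text \<open>The identity \<open>(1 / a - 1) * a = 1 - a\<close> puts \<open>(A f, f - A f)\<close>
  into the graph. Conversely, a graph element \<open>(x, y)\<close> differs from the one with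
  \<open>f = x + y\<close> by a vector \<open>u\<close> that is mapped to \<open>- u\<close>, which
  nonnegativity forbids unless \<open>u = 0\<close>.\<close>

lemma spectral_integral_E: "spectral_integral K E (\<lambda>l. l) = {(A f, f - A f) | f. f \<in> K}"
proof -
  have id: "(\<lambda>l. l :: real) \<in> borel_measurable borel" by simp
  let ?t = "E.trunc (\<lambda>l. l)"
  note tb = E.trunc_bfun[OF id]
  have sub: "(A f, f - A f) \<in> spectral_integral K E (\<lambda>l. l)" if f: "f \<in> K" for f
    unfolding E.spectral_integral_iff[OF id]
  proof (intro conjI)
    show "A f \<in> K" by (rule A_in_K)
    then show "f - A f \<in> K" using f subspace_diff[OF subspace_K] by blast
    have eq: "E.Phi (?t n) (A f) = Phi (\<lambda>a. pull (?t n) a * clamp01 a) f" for n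
      by (simp add: E_Phi tb Phi_mult pull_bfun Phi_clamp01)
    have lim: "(\<lambda>n. Phi (\<lambda>a. pull (?t n) a * clamp01 a) f) \<longlonglongrightarrow> Phi (\<lambda>a. (1 - clamp01 a) * indicator {0<..1} a) f"
    proof (rule Phi_tendsto)
      show "(\<lambda>a. pull (?t n) a * clamp01 a) \<in> borel_measurable borel" for n
        by (intro bfun_measurable bfun_mult pull_bfun tb clamp01_bfun)
      fix a :: real
      have val: "resolvent_inv a * clamp01 a = 1 - clamp01 a" if "a \<in> {0<..1}"
        using that by (simp add: resolvent_inv_def clamp01_id field_simps)
      show "\<bar>pull (?t n) a * clamp01 a\<bar> \<le> 1" for n
      proof (cases "a \<in> {0<..1}")
        case True
        have "\<bar>pull (?t n) a * clamp01 a\<bar> \<le> \<bar>resolvent_inv a\<bar> * clamp01 a"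
          unfolding abs_mult using E.trunc_le(2)[of "\<lambda>l. l" n] clamp01_range[of a] True
          by (simp add: pull_def mult_right_mono)
        also have "\<dots> = \<bar>1 - clamp01 a\<bar>" using val[OF True] clamp01_range[of a] by (metis abs_mult abs_of_nonneg)
        also have "\<dots> \<le> 1" using clamp01_range[of a] by simp
        finally show ?thesis .
      qed (simp add: pull_def)
      show "(\<lambda>n. pull (?t n) a * clamp01 a) \<longlonglongrightarrow> (1 - clamp01 a) * indicator {0<..1} a"
      proof (cases "a \<in> {0<..1}")
        case True
        have "(\<lambda>n. ?t n (resolvent_inv a) * clamp01 a) \<longlonglongrightarrow> resolvent_inv a * clamp01 a"
          by (intro tendsto_mult_right E.trunc_tendsto)
        then show ?thesis using True val[OF True] by (simp add: pull_def)
      qed (simp add: pull_def)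
    qed
    have "Phi (\<lambda>a. (1 - clamp01 a) * indicator {0<..1} a) f = f - A f"
      using Phi_mult[of "\<lambda>a. 1 - clamp01 a" "indicator {0<..1}" f]
      by (simp add: Phi_pos[OF f] Phi_diff_fun Phi_one Phi_clamp01)
    then show "(\<lambda>n. E.Phi (?t n) (A f)) \<longlonglongrightarrow> f - A f" using lim by (simp add: eq)
  qed
  have "(x, y) \<in> {(A f, f - A f) | f. f \<in> K}" if xy: "(x, y) \<in> spectral_integral K E (\<lambda>l. l)" for x y
  proof -
    have xyK: "x \<in> K" "y \<in> K" and xy: "(\<lambda>n. E.Phi (?t n) x) \<longlonglongrightarrow> y"
      using xy by (auto simp: E.spectral_integral_iff[OF id])
    define f where "f = x + y"
    have f: "f \<in> K" using xyK subspace_add[OF subspace_K] by (simp add: f_def)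
    define u where "u = x - A f"
    have "(\<lambda>n. E.Phi (?t n) (A f)) \<longlonglongrightarrow> f - A f"
      using sub[OF f] by (simp add: E.spectral_integral_iff[OF id])
    from tendsto_diff[OF xy this] have "(\<lambda>n. E.Phi (?t n) u) \<longlonglongrightarrow> - u"
      by (simp add: u_def f_def E.Phi_diff tb)
    then have "(\<lambda>n. E.Phi (?t n) u \<bullet> u) \<longlonglongrightarrow> - u \<bullet> u" by (intro tendsto_intros)
    moreover have "0 \<le> E.Phi (?t n) u \<bullet> u" for n
    proof -
      have "0 \<le> pull (?t n) a" for a
        by (auto simp: pull_def E.trunc_def indicator_def resolvent_inv_def)
      then show ?thesis by (simp add: E_Phi tb Phi_self pull_bfun)
    qed
    ultimately have "0 \<le> - u \<bullet> u" by (intro LIMSEQ_le_const) auto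
    then have "u \<bullet> u = 0" using inner_ge_zero[of u] by (simp only: inner_minus_left)
    then have "u = 0" by simp
    then have "x = A f" "y = f - A f" by (auto simp: u_def f_def)
    then show ?thesis using f by blast
  qed
  then show ?thesis using sub by auto
qed

end

section \<open>The wave equation in the spectral representation\<close>

lemma square_le_of_abs_le: "\<bar>a\<bar> \<le> b \<Longrightarrow> a\<^sup>2 \<le> b\<^sup>2" for a b :: real
  using power_mono[of "\<bar>a\<bar>" b 2] by simp

lemma sin_taylor: "\<bar>sin (x + y) - sin x - y * cos x\<bar> \<le> y\<^sup>2"
  and cos_taylor: "\<bar>cos (x + y) - cos x + y * sin x\<bar> \<le> y\<^sup>2" for x y :: real
proof -
  have s: "\<bar>sin y - y\<bar> \<le> y\<^sup>2 / 2"
    using Maclaurin_sin_bound[of y 2] by (simp add: sin_coeff_def lessThan_nat_numeral lessThan_Suc power2_eq_square)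
  have "cos y - 1 = - 2 * (sin (y / 2))\<^sup>2"
    using cos_double_sin[of "y / 2"] by simp
  moreover have "(sin (y / 2))\<^sup>2 \<le> (y / 2)\<^sup>2"
    using square_le_of_abs_le[OF abs_sin_x_le_abs_x[of "y / 2"]] by (simp only: power2_abs)
  ultimately have c: "\<bar>cos y - 1\<bar> \<le> y\<^sup>2 / 2" by (simp add: power2_eq_square abs_mult)
  have m: "\<bar>a * b\<bar> \<le> \<bar>b\<bar>" if "\<bar>a\<bar> \<le> 1" for a b :: real
    using mult_right_mono[OF that, of "\<bar>b\<bar>"] by (simp add: abs_mult)
  have "sin (x + y) - sin x - y * cos x = sin x * (cos y - 1) + cos x * (sin y - y)"
    by (simp add: sin_add algebra_simps)
  then show "\<bar>sin (x + y) - sin x - y * cos x\<bar> \<le> y\<^sup>2"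
    using m[OF abs_sin_le_one, of x "cos y - 1"] m[OF abs_cos_le_one, of x "sin y - y"] s c
      abs_triangle_ineq[of "sin x * (cos y - 1)" "cos x * (sin y - y)"] by linarith
  have "cos (x + y) - cos x + y * sin x = cos x * (cos y - 1) - sin x * (sin y - y)"
    by (simp add: cos_add algebra_simps)
  then show "\<bar>cos (x + y) - cos x + y * sin x\<bar> \<le> y\<^sup>2"
    using m[OF abs_cos_le_one, of x "cos y - 1"] m[OF abs_sin_le_one, of x "sin y - y"] s c
      abs_triangle_ineq4[of "cos x * (cos y - 1)" "sin x * (sin y - y)"] by linarith
qed

lemma has_vector_derivative_quadratic:
  assumes "\<And>t'. norm (f t' - f t - (t' - t) *\<^sub>R f') \<le> C * (t' - t)\<^sup>2"
  shows "(f has_vector_derivative f') (at t within S)"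
  unfolding has_vector_derivative_def
proof (rule has_derivativeI_sandwich[of 1])
  show "bounded_linear (\<lambda>x. x *\<^sub>R f')" by (rule bounded_linear_scaleR_left)
  show "((\<lambda>t'. C * \<bar>t' - t\<bar>) \<longlongrightarrow> 0) (at t within S)"
    by (auto intro!: tendsto_eq_intros)
  fix t' assume "t' \<noteq> t"
  then show "norm (f t' - f t - (t' - t) *\<^sub>R f') / norm (t' - t) \<le> C * \<bar>t' - t\<bar>"
    using assms[of t'] by (simp add: divide_le_eq power2_eq_square abs_mult_self_eq mult.assoc)
qed simp

text \<open>The value \<open>t\<close> is the limit at \<open>l = 0\<close>; keeping it for negative
  \<open>l\<close>, which carry no mass for a nonnegative operator, preserves the bound
  \<open>\<bar>t\<bar>\<close> on the whole line.\<close>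

definition wsin :: "real \<Rightarrow> real \<Rightarrow> real" where
  "wsin t l = (if l \<le> 0 then t else sin (t * sqrt l) / sqrt l)"

definition wcos :: "real \<Rightarrow> real \<Rightarrow> real" where
  "wcos t l = (if l \<le> 0 then 1 else cos (t * sqrt l))"

lemma wsin_bfun [simp, intro]: "wsin t \<in> bfun"
proof (rule bfunI[of _ "\<bar>t\<bar>"])
  show "wsin t \<in> borel_measurable borel" unfolding wsin_def[abs_def] by measurable
  show "\<bar>wsin t l\<bar> \<le> \<bar>t\<bar>" for l
    using abs_sin_x_le_abs_x[of "t * sqrt l"]
    by (auto simp: wsin_def abs_mult pos_divide_le_eq)
qed

lemma wcos_bfun [simp, intro]: "wcos t \<in> bfun"
proof (rule bfunI[of _ 1])
  show "wcos t \<in> borel_measurable borel" unfolding wcos_def[abs_def] by measurable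
qed (auto simp: wcos_def)

text \<open>The remainder is quadratic in \<open>t' - t\<close> with weight
  \<open>1 + l\<^sup>2\<close>, which is integrable against the spectral measure of a vector in the
  domain of the operator; differentiability in norm will follow.\<close>

lemma wsin_taylor:
  assumes "0 \<le> l" shows "(wsin t' l - wsin t l - (t' - t) * wcos t l)\<^sup>2 \<le> ((t' - t)\<^sup>2)\<^sup>2 * (1 + l\<^sup>2)"
proof (cases "l = 0")
  case False
  define s where "s = sqrt l"
  have s: "s > 0" "s\<^sup>2 = l" using assms False by (auto simp: s_def)
  define e where "e = sin (t * s + (t' - t) * s) - sin (t * s) - ((t' - t) * s) * cos (t * s)"
  have eq: "wsin t' l - wsin t l - (t' - t) * wcos t l = e / s"
    using s False assms by (simp add: wsin_def wcos_def e_def s_def[symmetric] field_simps)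
  have "\<bar>e\<bar> \<le> ((t' - t) * s)\<^sup>2" unfolding e_def by (rule sin_taylor)
  then have "\<bar>e\<bar> \<le> ((t' - t)\<^sup>2 * s) * s" by (simp add: power2_eq_square ac_simps)
  then have "\<bar>e / s\<bar> \<le> (t' - t)\<^sup>2 * s"
    using s(1) by (simp add: pos_divide_le_eq)
  then have "(e / s)\<^sup>2 \<le> ((t' - t)\<^sup>2 * s)\<^sup>2" by (rule square_le_of_abs_le)
  also have "\<dots> = ((t' - t)\<^sup>2)\<^sup>2 * l" using s by (simp add: power_mult_distrib)
  also have "\<dots> \<le> ((t' - t)\<^sup>2)\<^sup>2 * (1 + l\<^sup>2)"
  proof (rule mult_left_mono)
    have "0 \<le> (l - 1/2)\<^sup>2" by simp
    then show "l \<le> 1 + l\<^sup>2" by (simp add: power2_eq_square algebra_simps)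
  qed simp
  finally show ?thesis by (simp add: eq)
qed (simp add: wsin_def wcos_def)

lemma wcos_taylor:
  assumes "0 \<le> l" shows "(wcos t' l - wcos t l + (t' - t) * (wsin t l * l))\<^sup>2 \<le> ((t' - t)\<^sup>2)\<^sup>2 * (1 + l\<^sup>2)"
proof (cases "l = 0")
  case False
  define s where "s = sqrt l"
  have s: "s > 0" "s\<^sup>2 = l" using assms False by (auto simp: s_def)
  define e where "e = cos (t * s + (t' - t) * s) - cos (t * s) + ((t' - t) * s) * sin (t * s)"
  have "wsin t l = sin (t * s) / s" using False assms by (simp add: wsin_def s_def)
  then have "wsin t l * l = s * sin (t * s)"
    using s(1) by (simp add: power2_eq_square flip: s(2))
  then have eq: "wcos t' l - wcos t l + (t' - t) * (wsin t l * l) = e"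
    using s False assms by (simp add: wcos_def e_def s_def[symmetric] algebra_simps)
  have "\<bar>e\<bar> \<le> ((t' - t) * s)\<^sup>2" unfolding e_def by (rule cos_taylor)
  then have "\<bar>e\<bar> \<le> (t' - t)\<^sup>2 * l" using s by (simp add: power_mult_distrib)
  then have "e\<^sup>2 \<le> ((t' - t)\<^sup>2 * l)\<^sup>2" by (rule square_le_of_abs_le)
  also have "\<dots> = ((t' - t)\<^sup>2)\<^sup>2 * l\<^sup>2" by (simp add: power_mult_distrib)
  also have "\<dots> \<le> ((t' - t)\<^sup>2)\<^sup>2 * (1 + l\<^sup>2)" by (rule mult_left_mono) simp_all
  finally show ?thesis by (simp add: eq)
qed (simp add: wcos_def)

text \<open>An interval of positive length is not null. The wave is bounded only at almost every
  time, so admissible times have to be found rather than prescribed.\<close>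

lemma ex_of_AE_half_line:
  fixes P :: "real \<Rightarrow> bool"
  assumes "AE t in lebesgue_on {0<..}. P t" "0 < a" "a < b"
  obtains t where "a \<le> t" "t \<le> b" "P t"
proof (rule ccontr)
  assume "\<not> thesis"
  then have no: "\<And>t. a \<le> t \<Longrightarrow> t \<le> b \<Longrightarrow> \<not> P t" using that by blast
  have "AE t in lebesgue. t \<in> {0<..} \<longrightarrow> P t"
    using assms(1) by (subst (asm) AE_restrict_space_iff) auto
  then have "AE t in lebesgue. t \<notin> {a..b}"
    by eventually_elim (use no assms(2) in auto)
  then have "emeasure lebesgue {a..b} = 0" by (subst (asm) AE_iff_measurable[of "{a..b}"]) auto
  then show False using assms(3) by simp
qed

section \<open>Existence of spectral integrals\<close>

context pvm
begin

text \<open>Increments of the truncations have disjoint supports, so squared norms of differences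
  are differences of the sequence \<open>a\<close>, which converges; the truncations are therefore
  Cauchy.\<close>

lemma spectral_integral_exists:
  assumes f [measurable]: "f \<in> borel_measurable borel" and x: "x \<in> spectral_domain K E f"
  obtains y where "(x, y) \<in> spectral_integral K E f"
proof -
  note tb = trunc_bfun[OF f]
  define a where "a n = (\<integral>l. (trunc f n l)\<^sup>2 \<partial>M x)" for n
  define I where "I = (\<integral>l. (f l)\<^sup>2 \<partial>M x)"
  have i: "integrable (M x) (\<lambda>l. (f l)\<^sup>2)" and xK: "x \<in> K" using x by (auto simp: spectral_domain_def)
  have sq: "(trunc f n l)\<^sup>2 \<le> (f l)\<^sup>2" for n l
    using power_mono[OF trunc_le(2)[of f n l], of 2] by simp
  have ti: "integrable (M x) (\<lambda>l. (trunc f n l)\<^sup>2)" for n by (rule integrable_M[OF bfun_power[OF tb]])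
  have aI: "a n \<le> I" for n unfolding a_def I_def using i ti sq by (intro integral_mono)
  have mono: "(norm (Phi (trunc f m) x - Phi (trunc f n) x))\<^sup>2 = a m - a n" if "n \<le> m" for m n
  proof -
    have "(trunc f m l - trunc f n l)\<^sup>2 = (trunc f m l)\<^sup>2 - (trunc f n l)\<^sup>2" for l
      using that by (auto simp: trunc_def indicator_def)
    then show ?thesis
      unfolding a_def using ti
      by (simp add: Phi_diff_fun[OF tb tb, symmetric] norm_Phi_sq tb)
  qed
  have "Cauchy (\<lambda>n. Phi (trunc f n) x)"
  proof (rule Cauchy_of_norm_sq_le)
    have "a \<longlonglongrightarrow> I"
      unfolding a_def I_def
      by (rule integral_dominated_convergence[OF _ _ i])
         (use sq in \<open>auto simp: measurable_M intro!: tendsto_power trunc_tendsto\<close>)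
    then show "(\<lambda>n. I - a n) \<longlonglongrightarrow> 0" using tendsto_diff[OF tendsto_const[of I]] by fastforce
    show "(norm (Phi (trunc f m) x - Phi (trunc f n) x))\<^sup>2 \<le> I - a m + (I - a n)" for m n
      using mono[of m n] mono[of n m] aI[of m] aI[of n]
      by (cases "n \<le> m") (simp_all add: norm_minus_commute)
  qed
  then obtain y where y: "(\<lambda>n. Phi (trunc f n) x) \<longlonglongrightarrow> y"
    using Cauchy_convergent_iff convergent_def by blast
  moreover have "y \<in> K" by (rule K_tendsto[OF Phi_in_K[OF tb] y])
  ultimately show thesis using that xK by (simp add: spectral_integral_iff)
qed

lemma spectral_integral_Phi:
  assumes f: "f \<in> borel_measurable borel" and xy: "(x, y) \<in> spectral_integral K E f" and b: "b \<in> bfun"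
  shows "(Phi b x, Phi b y) \<in> spectral_integral K E f"
proof -
  have "(\<lambda>n. Phi (trunc f n) x) \<longlonglongrightarrow> y" using xy by (simp add: spectral_integral_iff[OF f])
  then have "(\<lambda>n. Phi b (Phi (trunc f n) x)) \<longlonglongrightarrow> Phi b y"
    by (rule bounded_linear.tendsto[OF bounded_linear_Phi[OF b]])
  then show ?thesis
    by (simp add: spectral_integral_iff[OF f] Phi_in_K[OF b] Phi_commute[OF b trunc_bfun[OF f]])
qed

end

section \<open>Nonnegative operators and their waves\<close>

locale nonneg_pvm = pvm +
  assumes nonneg: "(x, y) \<in> spectral_integral K E (\<lambda>l. l) \<Longrightarrow> 0 \<le> y \<bullet> x"
begin

abbreviation S where "S \<equiv> spectral_integral K E (\<lambda>l. l)"

lemma id_measurable: "(\<lambda>l. l :: real) \<in> borel_measurable borel" by simp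

text \<open>On the range of \<open>E B\<close> with \<open>B = {- real n..<0}\<close> the operator
  is bounded, and its form is the integral of \<open>l\<close> over negative numbers: nonpositive by
  sign, nonnegative by hypothesis.\<close>

lemma AE_nonneg: "AE l in M x. 0 \<le> l"
proof -
  have "AE l in M x. \<not> (- real n \<le> l \<and> l < 0)" for n
  proof -
    define B where "B = {- real n..<0}"
    have B [measurable]: "B \<in> sets borel" by (simp add: B_def)
    define f where "f l = indicator B l * l" for l :: real
    have fm: "f \<in> borel_measurable borel" unfolding f_def[abs_def] by measurable
    have f: "f \<in> bfun" by (rule bfunI[OF fm, of "real n"]) (auto simp: f_def B_def indicator_def)
    have "(E B x, Phi f x) \<in> S"
      unfolding spectral_integral_iff[OF id_measurable]
    proof (intro conjI)
      show "E B x \<in> K" by (rule E_in_K[OF B])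
      show "Phi f x \<in> K" by (rule Phi_in_K[OF f])
      have "\<forall>\<^sub>F m in sequentially. Phi (trunc (\<lambda>l. l) m) (E B x) = Phi f x"
        using eventually_ge_at_top[of n]
      proof eventually_elim
        case (elim m)
        then have "(\<lambda>l. trunc (\<lambda>l. l) m l * indicator B l) = f"
          by (auto simp: fun_eq_iff trunc_def f_def B_def indicator_def)
        then show ?case
          using Phi_mult[OF trunc_bfun[OF id_measurable] bfun_indicator[OF B], of m x] by (simp add: Phi_indicator)
      qed
      then show "(\<lambda>m. Phi (trunc (\<lambda>l. l) m) (E B x)) \<longlonglongrightarrow> Phi f x" by (rule tendsto_eventually)
    qed
    then have "0 \<le> Phi f x \<bullet> E B x" by (rule nonneg)
    also have "Phi f x \<bullet> E B x = Phi (\<lambda>l. indicator B l * f l) x \<bullet> x"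
      by (simp add: Phi_mult f Phi_indicator E_sym)
    also have "(\<lambda>l. indicator B l * f l) = f" by (auto simp: f_def indicator_def)
    also have "Phi f x \<bullet> x = (\<integral>l. f l \<partial>M x)" by (rule Phi_self[OF f])
    finally have "0 \<le> (\<integral>l. f l \<partial>M x)" .
    moreover have le: "f l \<le> 0" for l by (auto simp: f_def B_def indicator_def)
    then have "0 \<le> (\<integral>l. - f l \<partial>M x)" by (intro Bochner_Integration.integral_nonneg) simp
    ultimately have "(\<integral>l. - f l \<partial>M x) = 0" by simp
    then have "AE l in M x. - f l = 0"
      using integral_nonneg_eq_0_iff_AE[of "M x" "\<lambda>l. - f l"] le integrable_M[OF f] by simp
    then show ?thesis by eventually_elim (auto simp: f_def B_def indicator_def)
  qed
  then have "AE l in M x. \<forall>n. \<not> (- real n \<le> l \<and> l < 0)" unfolding AE_all_countable by blast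
  then show ?thesis
  proof eventually_elim
    case (elim l)
    obtain n where "- l \<le> real n" using real_arch_simple by blast
    then show ?case using elim[rule_format, of n] by auto
  qed
qed

text \<open>\<open>D\<close> is the graph norm of \<open>g\<close>. It is quantified before the
  function \<open>f\<close>, so one constant serves all times in the difference quotients.\<close>

lemma norm_Phi_graph_bound:
  assumes g: "(g, h) \<in> S"
  shows "\<exists>D. \<forall>f C. f \<in> bfun \<longrightarrow> 0 \<le> C \<longrightarrow> (\<forall>l\<ge>0. (f l)\<^sup>2 \<le> C\<^sup>2 * (1 + l\<^sup>2)) \<longrightarrow> norm (Phi f g) \<le> D * C"
proof -
  have "g \<in> spectral_domain K E (\<lambda>l. l)" using g by (auto simp: spectral_integral_def)
  then have "integrable (M g) (\<lambda>l. l\<^sup>2)" by (simp add: spectral_domain_def)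
  then have i: "integrable (M g) (\<lambda>l. 1 + l\<^sup>2)" using integrable_M[of "\<lambda>_. 1"] by auto
  define D where "D = sqrt (\<integral>l. 1 + l\<^sup>2 \<partial>M g)"
  have D0: "0 \<le> (\<integral>l. 1 + l\<^sup>2 \<partial>M g)" by (rule Bochner_Integration.integral_nonneg) simp
  show ?thesis
  proof (intro exI[of _ D] allI impI)
    fix f C assume f: "f \<in> bfun" and C: "0 \<le> C" and "\<forall>l\<ge>0. (f l)\<^sup>2 \<le> C\<^sup>2 * (1 + l\<^sup>2)"
    then have b: "0 \<le> l \<Longrightarrow> (f l)\<^sup>2 \<le> C\<^sup>2 * (1 + l\<^sup>2)" for l by blast
    have "(norm (Phi f g))\<^sup>2 = (\<integral>l. (f l)\<^sup>2 \<partial>M g)" by (rule norm_Phi_sq[OF f])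
    also have "\<dots> \<le> (\<integral>l. C\<^sup>2 * (1 + l\<^sup>2) \<partial>M g)"
    proof (rule integral_mono_AE)
      show "AE l in M g. (f l)\<^sup>2 \<le> C\<^sup>2 * (1 + l\<^sup>2)" using AE_nonneg by eventually_elim (rule b)
    qed (use f i in \<open>auto intro!: integrable_M\<close>)
    also have "\<dots> = (D * C)\<^sup>2" using D0 by (simp add: D_def power_mult_distrib)
    finally show "norm (Phi f g) \<le> D * C"
      by (rule power2_le_imp_le) (use C D0 in \<open>simp add: D_def\<close>)
  qed
qed

text \<open>The time derivative of \<open>wcos t\<close> is \<open>- l * wsin t l\<close>, in
  general unbounded in \<open>l\<close>; on \<open>g\<close> it acts as \<open>- wsin t\<close> on
  the image \<open>h\<close> of \<open>g\<close>, which is how the domain condition enters.\<close>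

lemma wave_solution_exists:
  assumes g: "(g, h) \<in> S"
  shows "wave_solution S g (\<lambda>t. Phi (wsin t) g)"
  unfolding wave_solution_def
proof (rule exI[of _ "\<lambda>t. Phi (wcos t) g"], rule exI[of _ "\<lambda>t. - Phi (wsin t) h"], intro conjI allI impI)
  have gK: "g \<in> K" and lim: "(\<lambda>n. Phi (trunc (\<lambda>l. l) n) g) \<longlonglongrightarrow> h"
    using g by (auto simp: spectral_integral_iff[OF id_measurable])
  obtain D where D: "\<And>f C. f \<in> bfun \<Longrightarrow> 0 \<le> C \<Longrightarrow> (\<And>l. 0 \<le> l \<Longrightarrow> (f l)\<^sup>2 \<le> C\<^sup>2 * (1 + l\<^sup>2)) \<Longrightarrow> norm (Phi f g) \<le> D * C"
    using norm_Phi_graph_bound[OF g] by blast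
  fix t :: real
  show "((\<lambda>t. Phi (wsin t) g) has_vector_derivative Phi (wcos t) g) (at t within {0..})"
  proof (rule has_vector_derivative_quadratic)
    fix t'
    have "Phi (\<lambda>l. wsin t' l - wsin t l - (t' - t) * wcos t l) g = Phi (wsin t') g - Phi (wsin t) g - (t' - t) *\<^sub>R Phi (wcos t) g"
      by (simp add: Phi_diff_fun Phi_scale_fun bfun_mult)
    then show "norm (Phi (wsin t') g - Phi (wsin t) g - (t' - t) *\<^sub>R Phi (wcos t) g) \<le> D * (t' - t)\<^sup>2"
      using D[of "\<lambda>l. wsin t' l - wsin t l - (t' - t) * wcos t l" "(t' - t)\<^sup>2"] wsin_taylor[of _ t' t]
      by simp
  qed
  show "((\<lambda>t. Phi (wcos t) g) has_vector_derivative - Phi (wsin t) h) (at t within {0..})"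
  proof (rule has_vector_derivative_quadratic)
    fix t'
    \<comment> \<open>Cutting to \<open>\<bar>l\<bar> \<le> n\<close> makes
      \<open>l * wsin t l\<close> a bounded multiplier; the quadratic estimate is uniform in
      \<open>n\<close> and passes to the limit.\<close>
    let ?i = "\<lambda>n. indicator {l. \<bar>l\<bar> \<le> real n} :: real \<Rightarrow> real"
    have im: "?i n \<in> borel_measurable borel" for n by measurable
    have ib: "?i n \<in> bfun" for n by (rule bfunI[OF im, of _ 1]) (simp add: indicator_def)
    define d where "d l = wcos t' l - wcos t l" for l
    have d: "d \<in> bfun" unfolding d_def[abs_def] by auto
    obtain C where C: "0 \<le> C" "\<And>l. \<bar>d l\<bar> \<le> C" by (rule bfun_bound[OF d], rule that)
    have "(\<lambda>n. Phi (\<lambda>l. ?i n l * d l) g) \<longlonglongrightarrow> Phi d g"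
    proof (rule Phi_tendsto)
      show "(\<lambda>l. ?i n l * d l) \<in> borel_measurable borel" for n using ib d by (intro bfun_measurable bfun_mult)
      show "\<bar>?i n l * d l\<bar> \<le> C" for n l using C by (simp add: indicator_def)
      fix l :: real
      obtain N where "\<bar>l\<bar> \<le> real N" using real_arch_simple by blast
      then have "\<forall>\<^sub>F n in sequentially. ?i n l * d l = d l"
        by (intro eventually_mono[OF eventually_ge_at_top[of N]]) (auto simp: indicator_def)
      then show "(\<lambda>n. ?i n l * d l) \<longlonglongrightarrow> d l" by (rule tendsto_eventually)
    qed
    moreover have "(\<lambda>n. (t' - t) *\<^sub>R Phi (wsin t) (Phi (trunc (\<lambda>l. l) n) g)) \<longlonglongrightarrow> (t' - t) *\<^sub>R Phi (wsin t) h"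
      by (intro tendsto_scaleR tendsto_const bounded_linear.tendsto[OF bounded_linear_Phi] lim wsin_bfun)
    ultimately have "(\<lambda>n. Phi (\<lambda>l. ?i n l * d l) g + (t' - t) *\<^sub>R Phi (wsin t) (Phi (trunc (\<lambda>l. l) n) g))
        \<longlonglongrightarrow> Phi d g + (t' - t) *\<^sub>R Phi (wsin t) h"
      by (rule tendsto_add)
    moreover have "norm (Phi (\<lambda>l. ?i n l * d l) g + (t' - t) *\<^sub>R Phi (wsin t) (Phi (trunc (\<lambda>l. l) n) g)) \<le> D * (t' - t)\<^sup>2" for n
    proof -
      define f where "f l = ?i n l * d l + (t' - t) * (wsin t l * trunc (\<lambda>l. l) n l)" for l
      have tb: "trunc (\<lambda>l. l) n \<in> bfun" by (rule trunc_bfun[OF id_measurable])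
      have w: "(\<lambda>l. wsin t l * trunc (\<lambda>l. l) n l) \<in> bfun" using tb by auto
      have f: "f \<in> bfun" unfolding f_def[abs_def] using ib d w by auto
      have "Phi f g = Phi (\<lambda>l. ?i n l * d l) g + (t' - t) *\<^sub>R Phi (wsin t) (Phi (trunc (\<lambda>l. l) n) g)"
        unfolding f_def[abs_def]
        by (simp add: Phi_add_fun Phi_scale_fun bfun_mult ib d w tb Phi_mult[OF wsin_bfun tb])
      moreover have "(f l)\<^sup>2 \<le> ((t' - t)\<^sup>2)\<^sup>2 * (1 + l\<^sup>2)" if "0 \<le> l" for l
        using wcos_taylor[OF that, of t' t] by (auto simp: f_def d_def trunc_def indicator_def)
      ultimately show ?thesis using D[OF f, of "(t' - t)\<^sup>2"] by simp
    qed
    ultimately have "norm (Phi d g + (t' - t) *\<^sub>R Phi (wsin t) h) \<le> D * (t' - t)\<^sup>2"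
      by (intro LIMSEQ_le_const2[OF tendsto_norm]) auto
    then show "norm (Phi (wcos t') g - Phi (wcos t) g - (t' - t) *\<^sub>R - Phi (wsin t) h) \<le> D * (t' - t)\<^sup>2"
      by (simp add: d_def[abs_def] Phi_diff_fun)
  qed
  show "(Phi (wsin t) g, - (- Phi (wsin t) h)) \<in> S"
    using spectral_integral_Phi[OF id_measurable g wsin_bfun] by simp
next
  have gK: "g \<in> K" using g by (auto simp: spectral_integral_iff[OF id_measurable])
  have "wsin 0 = (\<lambda>l. 0 * 1)" "wcos 0 = (\<lambda>_. 1)" by (auto simp: wsin_def wcos_def)
  then show "Phi (wsin 0) g = 0" "Phi (wcos 0) g = g"
    using Phi_scale_fun[of "\<lambda>_. 1" 0 g] E_UNIV[OF gK] by (simp_all add: Phi_one)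
qed

section \<open>Negative powers and dyadic windows\<close>

lemma dyadic_cover:
  assumes "(1/4) ^ Suc N < l" "l \<le> 1/4"
  shows "\<exists>k<N. (1/4) ^ Suc (Suc k) < l \<and> l \<le> (1/4 :: real) ^ Suc k"
  using assms(1)
proof (induction N)
  case 0
  then show ?case using assms(2) by simp
next
  case (Suc N)
  show ?case
  proof (cases "(1/4) ^ Suc N < l")
    case True
    then show ?thesis using Suc.IH less_SucI by blast
  next
    case False
    then show ?thesis using Suc.prems by (intro exI[of _ N]) auto
  qed
qed

text \<open>Zero at and below \<open>0\<close>, so that its product with
  \<open>l powr \<alpha>\<close> is the indicator of the positive half line, whatever
  \<open>powr\<close> returns elsewhere.\<close>

definition ipow :: "real \<Rightarrow> real \<Rightarrow> real" where
  "ipow \<alpha> l = (if l \<le> 0 then 0 else l powr - \<alpha>)"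

lemma ipow_measurable [measurable]: "ipow \<alpha> \<in> borel_measurable borel"
  unfolding ipow_def[abs_def] by measurable

lemma ipow_nonneg: "0 \<le> ipow \<alpha> l"
  by (simp add: ipow_def)

lemma powr_mult_ipow: "l powr \<alpha> * ipow \<alpha> l = indicator {0<..} l"
  by (auto simp: ipow_def powr_minus)

text \<open>The preimage \<open>x\<close> is the image of \<open>g\<close> under
  \<open>ipow \<alpha>\<close>. Truncations of \<open>l powr \<alpha>\<close> applied to it give
  cut-offs of \<open>g\<close> to positive \<open>l\<close>, which converge to \<open>g\<close>
  because neither \<open>0\<close> nor the negative half line carries mass.\<close>

lemma fractional_power_surj:
  assumes g: "g \<in> spectral_domain K E (ipow \<alpha>)" and null: "measure (M g) {0} = 0"
  shows "\<exists>x. (x, g) \<in> spectral_integral K E (\<lambda>l. l powr \<alpha>)"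
proof -
  let ?P = "\<lambda>l :: real. l powr \<alpha>"
  have P: "?P \<in> borel_measurable borel" by measurable
  have gK: "g \<in> K" using g by (simp add: spectral_domain_def)
  obtain x where x: "(g, x) \<in> spectral_integral K E (ipow \<alpha>)"
    by (rule spectral_integral_exists[OF ipow_measurable g])
  then have xK: "x \<in> K" and lim: "(\<lambda>n. Phi (trunc (ipow \<alpha>) n) g) \<longlonglongrightarrow> x"
    by (auto simp: spectral_integral_iff)
  note tP = trunc_bfun[OF P] and ti = trunc_bfun[OF ipow_measurable]
  define J where "J m = (\<lambda>l. indicator {0<..} l * indicator {l. \<bar>?P l\<bar> \<le> real m} l :: real)" for m
  have Jm: "J m \<in> borel_measurable borel" for m unfolding J_def by measurable
  have J1: "\<bar>J m l\<bar> \<le> 1" for m l by (simp add: J_def indicator_def)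
  have prod: "\<bar>trunc ?P m l * trunc (ipow \<alpha>) n l\<bar> \<le> 1" for m n l
  proof -
    have "\<bar>trunc ?P m l\<bar> * \<bar>trunc (ipow \<alpha>) n l\<bar> \<le> ?P l * ipow \<alpha> l"
      using trunc_le(2)[of ?P m l] trunc_le(2)[of "ipow \<alpha>" n l] ipow_nonneg[of \<alpha> l]
      by (intro mult_mono) auto
    also have "\<dots> \<le> 1" by (simp add: powr_mult_ipow indicator_def)
    finally show ?thesis by (simp add: abs_mult)
  qed
  have "Phi (trunc ?P m) x = Phi (J m) g" for m
  proof (rule LIMSEQ_unique)
    show "(\<lambda>n. Phi (trunc ?P m) (Phi (trunc (ipow \<alpha>) n) g)) \<longlonglongrightarrow> Phi (trunc ?P m) x"
      by (rule bounded_linear.tendsto[OF bounded_linear_Phi[OF tP] lim])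
    have "(\<lambda>n. Phi (\<lambda>l. trunc ?P m l * trunc (ipow \<alpha>) n l) g) \<longlonglongrightarrow> Phi (J m) g"
    proof (rule Phi_tendsto)
      show "(\<lambda>l. trunc ?P m l * trunc (ipow \<alpha>) n l) \<in> borel_measurable borel" for n
        by (intro bfun_measurable bfun_mult tP ti)
      show "\<bar>trunc ?P m l * trunc (ipow \<alpha>) n l\<bar> \<le> 1" for n l by (rule prod)
      fix l
      have "(\<lambda>n. trunc ?P m l * trunc (ipow \<alpha>) n l) \<longlonglongrightarrow> trunc ?P m l * ipow \<alpha> l"
        by (intro tendsto_mult_left trunc_tendsto)
      moreover have "trunc ?P m l * ipow \<alpha> l = J m l"
        using powr_mult_ipow[of l \<alpha>] by (simp add: trunc_def J_def mult.assoc mult.commute)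
      ultimately show "(\<lambda>n. trunc ?P m l * trunc (ipow \<alpha>) n l) \<longlonglongrightarrow> J m l" by simp
    qed
    then show "(\<lambda>n. Phi (trunc ?P m) (Phi (trunc (ipow \<alpha>) n) g)) \<longlonglongrightarrow> Phi (J m) g"
      by (simp add: Phi_mult[OF tP ti])
  qed
  moreover have "(\<lambda>m. Phi (J m) g) \<longlonglongrightarrow> Phi (indicator {0<..}) g"
  proof (rule Phi_tendsto[OF Jm J1])
    fix l
    obtain N where "\<bar>?P l\<bar> \<le> real N" using real_arch_simple by blast
    then have "\<forall>\<^sub>F m in sequentially. J m l = indicator {0<..} l"
      by (intro eventually_mono[OF eventually_ge_at_top[of N]]) (auto simp: J_def indicator_def)
    then show "(\<lambda>m. J m l) \<longlonglongrightarrow> indicator {0<..} l" by (rule tendsto_eventually)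
  qed
  moreover have "Phi (indicator {0<..}) g = g"
  proof -
    have "(norm (Phi (\<lambda>l. 1 - indicator {0<..} l) g))\<^sup>2 = (\<integral>l. (1 - indicator {0<..} l)\<^sup>2 \<partial>M g)"
      by (rule norm_Phi_sq) auto
    also have "\<dots> = (\<integral>l. 0 \<partial>M g)"
    proof (rule integral_cong_AE)
      have "AE l in M g. l \<notin> {0}"
      proof (subst AE_iff_measurable[of "{0}"])
        show "emeasure (M g) {0} = 0"
          using null finite_measure.emeasure_eq_measure[OF finite_measure_M] by simp
      qed (auto simp: sets_M space_M)
      with AE_nonneg show "AE l in M g. (1 - indicator {0<..} l)\<^sup>2 = (0 :: real)"
        by eventually_elim (auto simp: indicator_def)
    qed (auto simp: measurable_M)
    finally have "Phi (\<lambda>l. 1 - indicator {0<..} l) g = 0" by simp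
    moreover have "Phi (\<lambda>l. 1 - indicator {0<..} l) g = Phi (\<lambda>_. 1) g - Phi (indicator {0<..}) g"
      by (rule Phi_diff_fun) auto
    ultimately show ?thesis by (simp add: Phi_one E_UNIV[OF gK])
  qed
  ultimately have "(\<lambda>m. Phi (trunc ?P m) x) \<longlonglongrightarrow> g" by simp
  then have "(x, g) \<in> spectral_integral K E ?P" using xK gK by (simp add: spectral_integral_iff[OF P])
  then show ?thesis by blast
qed

text \<open>Dyadic decomposition: for \<open>t\<close> between \<open>2 ^ k\<close> and \<open>2 ^ (k + 1)\<close> the wave multiplier is of
  size \<open>2 ^ k\<close> on the spectral window from \<open>4 ^ - (k + 2)\<close> to \<open>4 ^ - (k + 1)\<close>, so decay of the wave bounds
  the spectral mass of that window.\<close>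

lemma wave_decay_imp_spectral_domain:
  assumes gK: "g \<in> K" and \<alpha>: "0 < \<alpha>" "\<alpha> < \<beta>" "\<beta> \<le> 1 / 2"
    and decay: "AE t in lebesgue_on {0<..}. norm (t powr (2 * \<beta> - 1) *\<^sub>R Phi (wsin t) g) \<le> C"
  shows "g \<in> spectral_domain K E (ipow \<alpha>)" and "measure (M g) {0} = 0"
proof -
  interpret finite_measure "M g" by (rule finite_measure_M)
  \<comment> \<open>For \<open>t\<close> of size \<open>2 ^ k\<close> the squared growth bound
    \<open>t powr (2 - 4 * \<beta>)\<close> is of size \<open>4 ^ k * \<sigma> ^ k\<close>.\<close>
  define \<sigma> where "\<sigma> = 4 powr (- 2 * \<beta>)"
  have \<sigma>: "0 < \<sigma>" "\<sigma> < 1"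
    using \<alpha> powr_less_mono[of "- 2 * \<beta>" 0 "4 :: real"] by (auto simp: \<sigma>_def)
  have ex: "\<exists>t. 2 ^ k \<le> t \<and> t \<le> 2 ^ Suc k \<and> (norm (Phi (wsin t) g))\<^sup>2 \<le> 4 * C\<^sup>2 * (4 ^ k * \<sigma> ^ k)" for k
  proof -
    obtain t where t: "2 ^ k \<le> t" "t \<le> 2 ^ Suc k" "norm (t powr (2 * \<beta> - 1) *\<^sub>R Phi (wsin t) g) \<le> C"
      by (rule ex_of_AE_half_line[OF decay, of "2 ^ k" "2 ^ Suc k"]) auto
    have t0: "0 < t" using t(1) by (rule less_le_trans[rotated]) simp
    have C: "0 \<le> C" using t(3) norm_ge_zero order_trans by blast
    have "norm (Phi (wsin t) g) = t powr (1 - 2 * \<beta>) * (t powr (2 * \<beta> - 1) * norm (Phi (wsin t) g))"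
      using t0 by (simp add: mult.assoc[symmetric] flip: powr_add)
    also have "\<dots> \<le> t powr (1 - 2 * \<beta>) * C" using t(3) by (intro mult_left_mono) auto
    \<comment> \<open>The exponent is nonnegative by \<open>\<beta> \<le> 1 / 2\<close>, so
      \<open>t\<close> may be replaced by the right end of its interval; this costs a factor
      \<open>2\<close>, which becomes the \<open>4\<close> after squaring.\<close>
    also have "t powr (1 - 2 * \<beta>) \<le> (2 * 2 ^ k) powr (1 - 2 * \<beta>)"
      using t t0 \<alpha> by (intro powr_mono2) auto
    also have "(2 * 2 ^ k) powr (1 - 2 * \<beta>) = 2 powr (1 - 2 * \<beta>) * (2 ^ k) powr (1 - 2 * \<beta>)"
      by (rule powr_mult)
    also have "\<dots> \<le> 2 * (2 ^ k) powr (1 - 2 * \<beta>)"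
      using powr_mono[of "1 - 2 * \<beta>" 1 "2 :: real"] \<alpha> by (intro mult_right_mono) auto
    also have "(2 ^ k) powr (1 - 2 * \<beta>) = 2 ^ k * (2 powr (- 2 * \<beta>)) ^ k"
      by (simp add: powr_diff powr_powr powr_minus_divide mult.commute power_divide flip: powr_realpow)
    finally have "norm (Phi (wsin t) g) \<le> 2 * (2 ^ k * (2 powr (- 2 * \<beta>)) ^ k) * C"
      using C by (simp add: mult_right_mono)
    then have "(norm (Phi (wsin t) g))\<^sup>2 \<le> (2 * (2 ^ k * (2 powr (- 2 * \<beta>)) ^ k) * C)\<^sup>2"
      by (rule power_mono) simp
    also have "\<dots> = 4 * C\<^sup>2 * ((2\<^sup>2) ^ k * ((2 powr (- 2 * \<beta>))\<^sup>2) ^ k)"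
      using power_mult_distrib[of "2 :: real" 2 k] by (simp add: power_mult_distrib power2_eq_square mult_ac)
    also have "(2 powr (- 2 * \<beta>))\<^sup>2 = \<sigma>"
      unfolding power2_eq_square \<sigma>_def powr_mult[symmetric] by simp
    finally show ?thesis using t by auto
  qed
  have wint: "(norm (Phi (wsin t) g))\<^sup>2 = (\<integral>l. (wsin t l)\<^sup>2 \<partial>M g)" for t by (rule norm_Phi_sq) simp
  have wi: "integrable (M g) (\<lambda>l. (wsin t l)\<^sup>2)" for t by (intro integrable_M bfun_power wsin_bfun)
  \<comment> \<open>Chebyshev's inequality for the squared multiplier.\<close>
  have lower: "a * measure (M g) B \<le> (norm (Phi (wsin t) g))\<^sup>2"
    if B: "B \<in> sets borel" and a: "\<And>l. l \<in> B \<Longrightarrow> a \<le> (wsin t l)\<^sup>2" for a B t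
  proof -
    have "(\<integral>l. a * indicator B l \<partial>M g) \<le> (\<integral>l. (wsin t l)\<^sup>2 \<partial>M g)"
    proof (rule integral_mono)
      show "integrable (M g) (\<lambda>l. a * indicator B l)" using B by (intro integrable_M bfun_mult) auto
      show "a * indicator B l \<le> (wsin t l)\<^sup>2" for l by (cases "l \<in> B") (simp_all add: a)
    qed (rule wi)
    then show ?thesis using B by (simp add: wint space_M sets_M)
  qed
  \<comment> \<open>At \<open>l = 0\<close> the multiplier equals \<open>t\<close>, so an atom there
    would make the wave grow linearly in time.\<close>
  show "measure (M g) {0} = 0"
  proof -
    have "measure (M g) {0} \<le> 4 * C\<^sup>2 * \<sigma> ^ k" for k
    proof -
      obtain t where t: "2 ^ k \<le> t" "(norm (Phi (wsin t) g))\<^sup>2 \<le> 4 * C\<^sup>2 * (4 ^ k * \<sigma> ^ k)" using ex by blast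
      have "(2 ^ k)\<^sup>2 * measure (M g) {0} \<le> t\<^sup>2 * measure (M g) {0}"
        using t(1) by (intro mult_right_mono power_mono) auto
      also have "\<dots> \<le> (norm (Phi (wsin t) g))\<^sup>2" by (rule lower) (auto simp: wsin_def)
      also note t(2)
      also have "((2::real) ^ k)\<^sup>2 = 4 ^ k" by (simp add: power2_eq_square flip: power_mult_distrib)
      finally show ?thesis by simp
    qed
    moreover have "(\<lambda>k. 4 * C\<^sup>2 * \<sigma> ^ k) \<longlonglongrightarrow> 0"
      using \<sigma> by (intro tendsto_mult_right_zero LIMSEQ_realpow_zero) auto
    ultimately have "measure (M g) {0} \<le> 0" by (intro LIMSEQ_le_const) auto
    then show ?thesis using measure_nonneg[of "M g" "{0}"] by linarith
  qed
  define I where "I k = {(1/4) ^ Suc (Suc k) <.. (1/4 :: real) ^ Suc k}" for k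
  \<comment> \<open>For \<open>t\<close> in \<open>{2 ^ k..2 ^ Suc k}\<close> and \<open>l\<close>
    in \<open>I k\<close> the product \<open>t * sqrt l\<close> lies between
    \<open>2 ^ k * (1/2) ^ (k + 2) = 1/4\<close> and
    \<open>2 ^ (k + 1) * (1/2) ^ (k + 1) = 1\<close>; on this interval the sine has a positive
    minimum.\<close>
  obtain c :: real where c: "0 < c" "\<And>y. 1/4 \<le> y \<Longrightarrow> y \<le> 1 \<Longrightarrow> c \<le> sin y"
  proof -
    have "\<exists>x\<in>{1/4..1}. \<forall>y\<in>{1/4..1}. sin x \<le> sin (y :: real)"
      by (rule continuous_attains_inf) (auto intro!: continuous_intros)
    then obtain x where x: "x \<in> {1/4..1}" "\<And>y. y \<in> {1/4..1} \<Longrightarrow> sin x \<le> sin (y :: real)" by blast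
    have "0 < sin x" using x(1) pi_ge_two by (intro sin_gt_zero) auto
    then show thesis using x(2) by (intro that[of "sin x"]) auto
  qed
  have mI: "measure (M g) (I k) \<le> (C / c)\<^sup>2 * \<sigma> ^ k" for k
  proof -
    obtain t where t: "2 ^ k \<le> t" "t \<le> 2 ^ Suc k" "(norm (Phi (wsin t) g))\<^sup>2 \<le> 4 * C\<^sup>2 * (4 ^ k * \<sigma> ^ k)"
      using ex by blast
    have "c\<^sup>2 * 4 ^ Suc k * measure (M g) (I k) \<le> (norm (Phi (wsin t) g))\<^sup>2"
    proof (rule lower)
      fix l assume "l \<in> I k"
      then have l: "(1/4) ^ Suc (Suc k) < l" "l \<le> (1/4) ^ Suc k" by (auto simp: I_def)
      define s where "s = sqrt l"
      have q: "sqrt ((1/4) ^ j) = (1/2) ^ j" for j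
        by (rule real_sqrt_unique) (auto simp: power2_eq_square simp flip: power_mult_distrib)
      have s: "(1/2) ^ Suc (Suc k) < s" "s \<le> (1/2) ^ Suc k"
        using real_sqrt_less_mono[OF l(1)] real_sqrt_le_mono[OF l(2)] unfolding q s_def by auto
      have s0: "0 < s" using s(1) by (rule less_trans[rotated]) simp
      have l0: "0 < l" using l(1) by (rule less_trans[rotated]) simp
      have t0: "0 < t" using t(1) by (rule less_le_trans[rotated]) simp
      have "2 ^ k * (1/2) ^ Suc (Suc k) \<le> t * s" using t(1) s s0 t0 by (intro mult_mono) auto
      moreover have "t * s \<le> 2 ^ Suc k * (1/2) ^ Suc k"
        using t(2) s s0 by (intro mult_mono) auto
      moreover have "(2::real) ^ k * (1/2) ^ k = 1" by (simp flip: power_mult_distrib)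
      ultimately have "1/4 \<le> t * s" "t * s \<le> 1" by auto
      then have "c \<le> sin (t * s)" by (rule c(2))
      then have "c * 2 ^ Suc k \<le> sin (t * s) * (1 / s)"
      proof (rule mult_mono)
        have "2 ^ Suc k * s \<le> 2 ^ Suc k * (1/2) ^ Suc k" using s by (intro mult_left_mono) auto
        also have "\<dots> = (1::real)" by (simp flip: power_mult_distrib)
        finally show "2 ^ Suc k \<le> 1 / s" using s0 by (simp add: pos_le_divide_eq)
      qed (use c(1) \<open>c \<le> sin (t * s)\<close> in auto)
      also have "\<dots> = wsin t l" using l0 by (simp add: wsin_def s_def)
      finally have "(c * 2 ^ Suc k)\<^sup>2 \<le> (wsin t l)\<^sup>2" using c(1) by (intro power_mono) auto
      moreover have "(c * 2 ^ Suc k)\<^sup>2 = c\<^sup>2 * 4 ^ Suc k"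
        by (simp add: power2_eq_square mult_ac flip: power_mult_distrib)
      ultimately show "c\<^sup>2 * 4 ^ Suc k \<le> (wsin t l)\<^sup>2" by simp
    qed (simp add: I_def)
    also note t(3)
    finally have "(c\<^sup>2 * measure (M g) (I k)) * (4 * 4 ^ k) \<le> (C\<^sup>2 * \<sigma> ^ k) * (4 * 4 ^ k)"
      by (simp add: mult_ac)
    then have "c\<^sup>2 * measure (M g) (I k) \<le> C\<^sup>2 * \<sigma> ^ k" by simp
    then show ?thesis using c(1) by (simp add: power_divide pos_le_divide_eq mult.commute)
  qed
  \<comment> \<open>Growth factor of the bound on \<open>(ipow \<alpha> l)\<^sup>2\<close> from one
    window to the next; \<open>\<alpha> < \<beta>\<close> makes
    \<open>\<tau> * \<sigma> < 1\<close>.\<close>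
  define \<tau> where "\<tau> = 4 powr (2 * \<alpha>)"
  have \<tau>: "1 \<le> \<tau>" using \<alpha> ge_one_powr_ge_zero[of 4 "2 * \<alpha>"] by (simp add: \<tau>_def)
  have ip: "(ipow \<alpha> l)\<^sup>2 \<le> \<tau> ^ j" if "(1/4) ^ j < l" for j l
  proof -
    have l0: "0 < l" using that by (rule less_trans[rotated]) simp
    have "(ipow \<alpha> l)\<^sup>2 = l powr (- (2 * \<alpha>))"
      using l0 by (simp add: ipow_def power2_eq_square flip: powr_add)
    also have "\<dots> \<le> ((1/4) ^ j) powr (- (2 * \<alpha>))"
      using that \<alpha> by (intro powr_mono2') auto
    also have "\<dots> = \<tau> ^ j"
      by (simp add: \<tau>_def powr_minus powr_divide power_one_over powr_powr mult.commute flip: powr_realpow)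
    finally show ?thesis .
  qed
  have r: "0 \<le> \<tau> * \<sigma>" "\<tau> * \<sigma> < 1"
    using \<alpha> \<sigma> \<tau> powr_less_mono[of "2 * \<alpha> + (- 2 * \<beta>)" 0 "4 :: real"]
    by (auto simp: \<tau>_def \<sigma>_def simp flip: powr_add)
  \<comment> \<open>The first term accounts for \<open>l > 1/4\<close>, where the squared power is
    at most \<open>\<tau>\<close>; the second is the geometric series over the windows, where window
    \<open>k\<close> has weight at most \<open>\<tau> ^ (k + 2)\<close>.\<close>
  define Q where "Q = \<tau> * measure (M g) UNIV + \<tau>\<^sup>2 * (C / c)\<^sup>2 * (1 / (1 - \<tau> * \<sigma>))"
  have bound: "(norm (Phi (trunc (ipow \<alpha>) n) g))\<^sup>2 \<le> Q" for n
  proof -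
    \<comment> \<open>Truncation at \<open>n\<close> removes all \<open>l\<close> with
      \<open>ipow \<alpha> l > n\<close>, so finitely many windows suffice for each
      \<open>n\<close>, while \<open>Q\<close> is independent of their number.\<close>
    have "\<exists>N. real n < (4 powr \<alpha>) ^ N"
      using \<alpha> by (intro real_arch_pow) simp
    then obtain N where N: "real n < (4 powr \<alpha>) ^ N" by blast
    have ptw: "(trunc (ipow \<alpha>) n l)\<^sup>2 \<le> \<tau> + (\<Sum>k<N. \<tau> ^ Suc (Suc k) * indicator (I k) l)" for l
    proof (cases "l > 0 \<and> ipow \<alpha> l \<le> real n")
      case True
      have t: "(trunc (ipow \<alpha>) n l)\<^sup>2 = (ipow \<alpha> l)\<^sup>2" using True ipow_nonneg[of \<alpha> l] by (simp add: trunc_def)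
      have sn: "0 \<le> (\<Sum>k<N. \<tau> ^ Suc (Suc k) * indicator (I k) l)" using \<tau> by (intro sum_nonneg) auto
      show ?thesis
      proof (cases "l \<le> 1/4")
        case l: True
        have "(1/4) ^ Suc N < l"
        proof (rule ccontr)
          assume "\<not> (1/4) ^ Suc N < l"
          then have "4 * l \<le> (1/4) ^ N" by simp
          then have "l \<le> (1/4) ^ N" using True by simp
          then have "((1/4) ^ N) powr (- \<alpha>) \<le> l powr (- \<alpha>)"
            using True \<alpha> by (intro powr_mono2') auto
          also have "\<dots> \<le> real n" using True by (auto simp: ipow_def split: if_splits)
          also have "\<dots> < (4 powr \<alpha>) ^ N" by (rule N)
          also have "\<dots> = ((1/4) ^ N) powr (- \<alpha>)"
            by (simp add: powr_minus powr_divide power_one_over powr_powr mult.commute flip: powr_realpow)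
          finally show False by simp
        qed
        from dyadic_cover[OF this l] obtain k where k: "k < N" "l \<in> I k" by (auto simp: I_def)
        have "(ipow \<alpha> l)\<^sup>2 \<le> \<tau> ^ Suc (Suc k)" using k by (intro ip) (simp add: I_def)
        also have "\<dots> = \<tau> ^ Suc (Suc k) * indicator (I k) l" using k by simp
        also have "\<dots> \<le> (\<Sum>k<N. \<tau> ^ Suc (Suc k) * indicator (I k) l)"
          using k \<tau> by (intro member_le_sum) auto
        finally show ?thesis using t \<tau> by simp
      next
        case False
        then show ?thesis using ip[of 1 l] t sn by simp
      qed
    next
      case False
      then have "trunc (ipow \<alpha>) n l = 0" using ipow_nonneg[of \<alpha> l] by (auto simp: trunc_def ipow_def)
      then show ?thesis using \<tau> by (auto intro!: add_nonneg_nonneg sum_nonneg)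
    qed
    have Im: "I k \<in> sets borel" for k by (simp add: I_def)
    have "(norm (Phi (trunc (ipow \<alpha>) n) g))\<^sup>2 = (\<integral>l. (trunc (ipow \<alpha>) n l)\<^sup>2 \<partial>M g)"
      by (rule norm_Phi_sq[OF trunc_bfun[OF ipow_measurable]])
    also have "\<dots> \<le> (\<integral>l. \<tau> + (\<Sum>k<N. \<tau> ^ Suc (Suc k) * indicator (I k) l) \<partial>M g)"
      using ptw Im by (intro integral_mono integrable_M bfun_power bfun_add bfun_sum bfun_mult
          trunc_bfun[OF ipow_measurable]) auto
    also have "\<dots> = \<tau> * measure (M g) UNIV + (\<Sum>k<N. \<tau> ^ Suc (Suc k) * measure (M g) (I k))"
    proof -
      have sf: "sfun (\<lambda>f. \<integral>l. f l \<partial>M g)" by (rule sfun_integral[OF finite_M sets_M])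
      have b: "indicator (I k) \<in> bfun" "(\<lambda>l. \<tau> ^ Suc (Suc k) * indicator (I k) l) \<in> bfun" for k
        using Im by (auto simp only: bfun_indicator intro!: bfun_mult)
      have "(\<integral>l. \<tau> ^ Suc (Suc k) * indicator (I k) l \<partial>M g) = \<tau> ^ Suc (Suc k) * measure (M g) (I k)" for k
        using sfun_scale[OF sf b(1)[of k], of "\<tau> ^ Suc (Suc k)"] Im[of k] by (simp add: sets_M)
      then have "(\<integral>l. (\<Sum>k<N. \<tau> ^ Suc (Suc k) * indicator (I k) l) \<partial>M g) = (\<Sum>k<N. \<tau> ^ Suc (Suc k) * measure (M g) (I k))"
        by (simp only: sfun_sum[OF sf b(2)])
      moreover have "(\<integral>l. \<tau> + (\<Sum>k<N. \<tau> ^ Suc (Suc k) * indicator (I k) l) \<partial>M g)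
          = (\<integral>l. \<tau> \<partial>M g) + (\<integral>l. (\<Sum>k<N. \<tau> ^ Suc (Suc k) * indicator (I k) l) \<partial>M g)"
        by (rule sfun_add[OF sf bfun_const bfun_sum[OF b(2)]])
      ultimately show ?thesis by (simp add: space_M mult.commute)
    qed
    also have "(\<Sum>k<N. \<tau> ^ Suc (Suc k) * measure (M g) (I k)) \<le> (\<Sum>k<N. \<tau>\<^sup>2 * (C / c)\<^sup>2 * (\<tau> * \<sigma>) ^ k)"
    proof (rule sum_mono)
      fix k
      have "\<tau> ^ Suc (Suc k) * measure (M g) (I k) \<le> \<tau> ^ Suc (Suc k) * ((C / c)\<^sup>2 * \<sigma> ^ k)"
        using mI \<tau> by (intro mult_left_mono) auto
      then show "\<tau> ^ Suc (Suc k) * measure (M g) (I k) \<le> \<tau>\<^sup>2 * (C / c)\<^sup>2 * (\<tau> * \<sigma>) ^ k"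
        by (simp add: power2_eq_square power_mult_distrib mult_ac)
    qed
    also have "\<dots> = \<tau>\<^sup>2 * (C / c)\<^sup>2 * (\<Sum>k<N. (\<tau> * \<sigma>) ^ k)" by (simp add: sum_distrib_left)
    also have "\<dots> \<le> \<tau>\<^sup>2 * (C / c)\<^sup>2 * (1 / (1 - \<tau> * \<sigma>))"
    proof (rule mult_left_mono)
      have "(\<Sum>k<N. (\<tau> * \<sigma>) ^ k) \<le> (\<Sum>k. (\<tau> * \<sigma>) ^ k)"
        using r by (intro sum_le_suminf summable_geometric) auto
      then show "(\<Sum>k<N. (\<tau> * \<sigma>) ^ k) \<le> 1 / (1 - \<tau> * \<sigma>)" using r by (simp add: suminf_geometric)
    qed simp
    finally show ?thesis by (simp add: Q_def)
  qed
  have "norm (Phi (trunc (ipow \<alpha>) n) g) \<le> sqrt Q" for n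
    using bound by (rule real_le_rsqrt)
  then show "g \<in> spectral_domain K E (ipow \<alpha>)"
    using gK by (auto simp: in_spectral_domain_iff)
qed

end

section \<open>The resolvent of the Friedrichs extension\<close>

text \<open>\<open>T_total\<close> is density of the domain of \<open>T\<close> in \<open>K\<close>,
  phrased by orthogonality.\<close>

locale nonneg_symmetric =
  fixes K :: "'h::{real_inner,complete_space} set" and T :: "('h \<times> 'h) set"
  assumes subspace_T: "subspace T" and subspace_K: "subspace K" and closed_K: "closed K"
    and T_K: "T \<subseteq> K \<times> K"
    and T_sym: "p \<in> T \<Longrightarrow> p' \<in> T \<Longrightarrow> snd p \<bullet> fst p' = fst p \<bullet> snd p'"
    and T_nonneg: "p \<in> T \<Longrightarrow> 0 \<le> snd p \<bullet> fst p"
    and T_total: "f \<in> K \<Longrightarrow> (\<And>p. p \<in> T \<Longrightarrow> f \<bullet> fst p = 0) \<Longrightarrow> f = 0"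
begin

text \<open>The form is taken on pairs from the graph instead of vectors, so that it is bilinear on
  the product space and no value of \<open>T\<close> has to be selected.\<close>

definition q :: "'h \<times> 'h \<Rightarrow> 'h \<times> 'h \<Rightarrow> real" where "q p p' = snd p \<bullet> fst p'"

lemma T_add: "p \<in> T \<Longrightarrow> p' \<in> T \<Longrightarrow> p + p' \<in> T"
  and T_diff: "p \<in> T \<Longrightarrow> p' \<in> T \<Longrightarrow> p - p' \<in> T"
  and T_scale: "p \<in> T \<Longrightarrow> c *\<^sub>R p \<in> T"
  using subspace_T by (auto simp: subspace_add subspace_diff subspace_scale)

lemma q_add: "q (p + p') r = q p r + q p' r" "q r (p + p') = q r p + q r p'"
  and q_diff: "q (p - p') r = q p r - q p' r" "q r (p - p') = q r p - q r p'"
  and q_scale: "q (c *\<^sub>R p) r = c * q p r" "q r (c *\<^sub>R p) = c * q r p"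
  by (simp_all add: q_def inner_add_left inner_add_right inner_diff_left inner_diff_right)

lemma q_sym: "p \<in> T \<Longrightarrow> p' \<in> T \<Longrightarrow> q p p' = q p' p"
  using T_sym[of p p'] by (simp add: q_def inner_commute)

lemma q_nonneg: "p \<in> T \<Longrightarrow> 0 \<le> q p p"
  by (simp add: q_def T_nonneg)

lemma q_cauchy_schwarz:
  assumes "p \<in> T" "r \<in> T" shows "(q p r)\<^sup>2 \<le> q p p * q r r"
proof (rule discriminant_le)
  fix t
  have "0 \<le> q (p + t *\<^sub>R r) (p + t *\<^sub>R r)" using assms by (intro q_nonneg T_add T_scale)
  also have "\<dots> = q p p + 2 * t * q p r + t\<^sup>2 * q r r"
    using q_sym[OF assms] by (simp add: q_add q_scale power2_eq_square algebra_simps)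
  finally show "0 \<le> q p p + 2 * t * q p r + t\<^sup>2 * q r r" .
qed (rule q_nonneg[OF assms(2)])

lemma q_plus_le: "p \<in> T \<Longrightarrow> r \<in> T \<Longrightarrow> q (p + r) (p + r) \<le> 2 * q p p + 2 * q r r"
proof -
  assume pr: "p \<in> T" "r \<in> T"
  have "0 \<le> q (p - r) (p - r)" using pr by (intro q_nonneg T_diff)
  then show ?thesis by (simp add: q_add q_diff)
qed

section \<open>Closability of the quadratic form\<close>

lemma form_approx_iff:
  "form_approx T s u \<longleftrightarrow> (\<forall>n. s n \<in> T) \<and> (\<lambda>n. fst (s n)) \<longlonglongrightarrow> u \<and>
     (\<forall>e>0. \<exists>M. \<forall>m\<ge>M. \<forall>n\<ge>M. q (s m - s n) (s m - s n) < e)"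
  by (simp add: form_approx_def q_def)

lemma form_approx_T: "form_approx T s u \<Longrightarrow> s n \<in> T"
  and form_approx_lim: "form_approx T s u \<Longrightarrow> (\<lambda>n. fst (s n)) \<longlonglongrightarrow> u"
  by (auto simp: form_approx_def)

lemma form_approx_const: "p \<in> T \<Longrightarrow> form_approx T (\<lambda>n. p) (fst p)"
  by (simp add: form_approx_def)

lemma form_approx_add:
  assumes "form_approx T s u" "form_approx T r v"
  shows "form_approx T (\<lambda>n. s n + r n) (u + v)"
  unfolding form_approx_iff
proof (intro conjI allI impI)
  show "s n + r n \<in> T" for n using assms by (intro T_add form_approx_T)
  show "(\<lambda>n. fst (s n + r n)) \<longlonglongrightarrow> u + v"
    using assms by (auto intro: tendsto_add form_approx_lim)
  fix e :: real assume "0 < e"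
  then have e: "0 < e / 4" by simp
  obtain M where M: "\<And>m n. m \<ge> M \<Longrightarrow> n \<ge> M \<Longrightarrow> q (s m - s n) (s m - s n) < e / 4"
    using assms(1) e unfolding form_approx_iff by blast
  obtain N where N: "\<And>m n. m \<ge> N \<Longrightarrow> n \<ge> N \<Longrightarrow> q (r m - r n) (r m - r n) < e / 4"
    using assms(2) e unfolding form_approx_iff by blast
  show "\<exists>M. \<forall>m\<ge>M. \<forall>n\<ge>M. q (s m + r m - (s n + r n)) (s m + r m - (s n + r n)) < e"
  proof (intro exI allI impI)
    fix m n assume mn: "max M N \<le> m" "max M N \<le> n"
    have "q ((s m - s n) + (r m - r n)) ((s m - s n) + (r m - r n)) \<le> 2 * q (s m - s n) (s m - s n) + 2 * q (r m - r n) (r m - r n)"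
      using assms by (intro q_plus_le T_diff form_approx_T)
    also have "\<dots> < e" using M[of m n] N[of m n] mn by simp
    finally show "q (s m + r m - (s n + r n)) (s m + r m - (s n + r n)) < e"
      by (simp add: algebra_simps)
  qed
qed

lemma form_approx_scale:
  assumes "form_approx T s u" shows "form_approx T (\<lambda>n. c *\<^sub>R s n) (c *\<^sub>R u)"
  unfolding form_approx_iff
proof (intro conjI allI impI)
  show "c *\<^sub>R s n \<in> T" for n using assms by (intro T_scale form_approx_T)
  show "(\<lambda>n. fst (c *\<^sub>R s n)) \<longlonglongrightarrow> c *\<^sub>R u"
    using assms by (auto intro: tendsto_scaleR form_approx_lim)
  fix e :: real assume "0 < e"
  then have e: "0 < e / (c\<^sup>2 + 1)" by (simp add: add_nonneg_pos)
  obtain M where M: "\<And>m n. m \<ge> M \<Longrightarrow> n \<ge> M \<Longrightarrow> q (s m - s n) (s m - s n) < e / (c\<^sup>2 + 1)"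
    using assms e unfolding form_approx_iff by blast
  show "\<exists>M. \<forall>m\<ge>M. \<forall>n\<ge>M. q (c *\<^sub>R s m - c *\<^sub>R s n) (c *\<^sub>R s m - c *\<^sub>R s n) < e"
  proof (intro exI allI impI)
    fix m n assume mn: "M \<le> m" "M \<le> n"
    have n: "0 \<le> q (s m - s n) (s m - s n)" using assms by (intro q_nonneg T_diff form_approx_T)
    have "q (c *\<^sub>R s m - c *\<^sub>R s n) (c *\<^sub>R s m - c *\<^sub>R s n) = c\<^sup>2 * q (s m - s n) (s m - s n)"
      unfolding scaleR_diff_right[symmetric] by (simp add: q_scale power2_eq_square)
    also have "\<dots> \<le> (c\<^sup>2 + 1) * q (s m - s n) (s m - s n)" using n by (intro mult_right_mono) auto
    also have "\<dots> < e" using M[OF mn] by (simp add: pos_less_divide_eq add_nonneg_pos mult.commute)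
    finally show "q (c *\<^sub>R s m - c *\<^sub>R s n) (c *\<^sub>R s m - c *\<^sub>R s n) < e" .
  qed
qed

lemma form_approx_diff:
  "form_approx T s u \<Longrightarrow> form_approx T r v \<Longrightarrow> form_approx T (\<lambda>n. s n - r n) (u - v)"
  using form_approx_add[OF _ form_approx_scale[of r v "-1"], of s u] by simp

lemma form_approx_bounded:
  assumes s: "form_approx T s u"
  obtains C where "0 \<le> C" "\<And>n. q (s n) (s n) \<le> C"
proof -
  obtain M where M: "\<And>m n. m \<ge> M \<Longrightarrow> n \<ge> M \<Longrightarrow> q (s m - s n) (s m - s n) < 1"
    using s unfolding form_approx_iff by (meson zero_less_one)
  define C where "C = Max ((\<lambda>n. q (s n) (s n)) ` {..M}) + (2 + 2 * q (s M) (s M))"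
  have T: "s n \<in> T" for n using s by (rule form_approx_T)
  have mx: "q (s n) (s n) \<le> Max ((\<lambda>n. q (s n) (s n)) ` {..M})" if "n \<le> M" for n
    using that by (intro Max_ge) auto
  have M0: "0 \<le> Max ((\<lambda>n. q (s n) (s n)) ` {..M})" using mx[of M] q_nonneg[OF T, of M] by linarith
  have "q (s n) (s n) \<le> C" for n
  proof (cases "n \<le> M")
    case True
    then show ?thesis unfolding C_def using mx[of n] q_nonneg[OF T, of M] by linarith
  next
    case False
    have "q ((s n - s M) + s M) ((s n - s M) + s M) \<le> 2 * q (s n - s M) (s n - s M) + 2 * q (s M) (s M)"
      using T by (intro q_plus_le T_diff)
    moreover have "q (s n - s M) (s n - s M) < 1" using M[of n M] False by simp
    ultimately show ?thesis unfolding C_def using M0 by simp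
  qed
  moreover from this[of 0] have "0 \<le> C" using q_nonneg[OF T, of 0] by linarith
  ultimately show thesis using that by blast
qed

text \<open>The form comes from an operator: for fixed \<open>n\<close> the mixed value
  \<open>snd (s n) \<bullet> fst (s m)\<close> tends to \<open>0\<close> with \<open>m\<close>,
  while \<open>q (s n) (s n - s m)\<close> is small for large \<open>m\<close> and \<open>n\<close>
  by Cauchy-Schwarz and the Cauchy property.\<close>

lemma form_closable:
  assumes s: "form_approx T s 0" shows "(\<lambda>n. q (s n) (s n)) \<longlonglongrightarrow> 0"
proof (rule LIMSEQ_I)
  fix e :: real assume e: "0 < e"
  have T: "s n \<in> T" for n using s by (rule form_approx_T)
  obtain C where C: "0 \<le> C" "\<And>n. q (s n) (s n) \<le> C" by (rule form_approx_bounded[OF s], rule that)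
  \<comment> \<open>Chosen so that Cauchy-Schwarz with the bound \<open>C\<close> yields
    \<open>e / 2\<close>; \<open>C + 1\<close> avoids a division by \<open>0\<close>.\<close>
  define \<delta> where "\<delta> = (e / 2)\<^sup>2 / (C + 1)"
  have \<delta>: "0 < \<delta>" using e C(1) by (simp add: \<delta>_def)
  obtain M where M: "\<And>m n. m \<ge> M \<Longrightarrow> n \<ge> M \<Longrightarrow> q (s m - s n) (s m - s n) < \<delta>"
    using s \<delta> unfolding form_approx_iff by blast
  have "q (s n) (s n) \<le> e / 2" if n: "n \<ge> M" for n
  proof -
    have "(\<lambda>m. q (s n) (s m)) \<longlonglongrightarrow> snd (s n) \<bullet> 0"
      unfolding q_def using form_approx_lim[OF s] by (intro tendsto_intros)
    from tendsto_add[OF tendsto_const[of "e / 2"] this]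
    have "(\<lambda>m. e / 2 + q (s n) (s m)) \<longlonglongrightarrow> e / 2" by simp
    moreover have "q (s n) (s n) \<le> e / 2 + q (s n) (s m)" if m: "m \<ge> M" for m
    proof -
      have "(q (s n) (s n - s m))\<^sup>2 \<le> q (s n) (s n) * q (s n - s m) (s n - s m)"
        using T by (intro q_cauchy_schwarz T_diff)
      also have "\<dots> \<le> (C + 1) * \<delta>"
        using C(2)[of n] M[OF n m] C(1) q_nonneg[OF T_diff[OF T T]] by (intro mult_mono) (auto simp: less_imp_le)
      also have "\<dots> = (e / 2)\<^sup>2" using C(1) by (simp add: \<delta>_def)
      finally have "q (s n) (s n - s m) \<le> e / 2" by (rule power2_le_imp_le) (use e in simp)
      then show ?thesis by (simp add: q_diff)
    qed
    ultimately show ?thesis by (intro LIMSEQ_le_const[of "\<lambda>m. e / 2 + q (s n) (s m)" "e / 2"] exI[of _ M]) auto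
  qed
  then have "\<forall>n\<ge>M. norm (q (s n) (s n) - 0) < e" using e q_nonneg[OF T] by (smt (verit) real_norm_def field_sum_of_halves)
  then show "\<exists>no. \<forall>n\<ge>no. norm (q (s n) (s n) - 0) < e" by blast
qed

text \<open>The definition of \<open>friedrichs\<close> quantifies over all approximating sequences;
  the difference of two with the same limit approximates \<open>0\<close>, where closability
  applies, so one sequence decides.\<close>

lemma form_limit_unique:
  assumes s: "form_approx T s u" "form_approx T s' u" and r: "form_approx T r v" "form_approx T r' v"
    and lim: "(\<lambda>n. q (s n) (r n)) \<longlonglongrightarrow> c"
  shows "(\<lambda>n. q (s' n) (r' n)) \<longlonglongrightarrow> c"
proof -
  have prod: "(\<lambda>n. q (a n) (b n)) \<longlonglongrightarrow> 0" if a: "form_approx T a 0" and b: "form_approx T b w" for a b w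
  proof -
    obtain C where C: "0 \<le> C" "\<And>n. q (b n) (b n) \<le> C" by (rule form_approx_bounded[OF b], rule that)
    have aT: "a n \<in> T" and bT: "b n \<in> T" for n using a b by (auto intro: form_approx_T)
    have "(\<lambda>n. q (a n) (a n) * C) \<longlonglongrightarrow> 0"
      using form_closable[OF a] by (rule tendsto_mult_left_zero)
    moreover have "(q (a n) (b n))\<^sup>2 \<le> q (a n) (a n) * C" for n
      using q_cauchy_schwarz[OF aT bT, of n n] C(2)[of n] q_nonneg[OF aT, of n]
      by (meson mult_left_mono order_trans)
    ultimately show ?thesis by (rule tendsto_zero_of_square_le[rotated])
  qed
  have 1: "(\<lambda>n. q (s' n - s n) (r n)) \<longlonglongrightarrow> 0"
    using form_approx_diff[OF s(2,1)] r(1) by (intro prod) auto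
  have "(\<lambda>n. q (r' n - r n) (s' n)) \<longlonglongrightarrow> 0"
    using form_approx_diff[OF r(2,1)] s(2) by (intro prod) auto
  moreover have "q (r' n - r n) (s' n) = q (s' n) (r' n - r n)" for n
    using s r by (intro q_sym T_diff form_approx_T)
  ultimately have 2: "(\<lambda>n. q (s' n) (r' n - r n)) \<longlonglongrightarrow> 0" by simp
  from tendsto_add[OF tendsto_add[OF lim 1] 2] show ?thesis by (simp add: q_diff)
qed

text \<open>\<open>friedrichs\<close> with a single approximating sequence of \<open>u\<close> and
  without the restriction to \<open>K\<close>, so that the resolvent can be defined on the ambient
  space.\<close>

definition form_op :: "'h \<Rightarrow> 'h \<Rightarrow> bool" where
  "form_op u g \<longleftrightarrow> (\<exists>s. form_approx T s u \<and> (\<forall>v r. form_approx T r v \<longrightarrow> (\<lambda>n. q (s n) (r n)) \<longlonglongrightarrow> g \<bullet> v))"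

lemma form_op_limit:
  "form_op u g \<Longrightarrow> form_approx T s u \<Longrightarrow> form_approx T r v \<Longrightarrow> (\<lambda>n. q (s n) (r n)) \<longlonglongrightarrow> g \<bullet> v"
  unfolding form_op_def using form_limit_unique by blast

lemma form_op_friedrichs: "(u, g) \<in> friedrichs K T \<longleftrightarrow> g \<in> K \<and> form_op u g"
  using form_op_limit unfolding friedrichs_def form_domain_def form_op_def q_def by blast

lemma form_op_add:
  assumes "form_op u g" "form_op v h" shows "form_op (u + v) (g + h)"
proof -
  obtain s where s: "form_approx T s u" "\<And>v r. form_approx T r v \<Longrightarrow> (\<lambda>n. q (s n) (r n)) \<longlonglongrightarrow> g \<bullet> v"
    using assms(1) unfolding form_op_def by blast
  obtain s' where s': "form_approx T s' v" "\<And>v r. form_approx T r v \<Longrightarrow> (\<lambda>n. q (s' n) (r n)) \<longlonglongrightarrow> h \<bullet> v"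
    using assms(2) unfolding form_op_def by blast
  show ?thesis
    unfolding form_op_def
    by (rule exI[of _ "\<lambda>n. s n + s' n"])
       (use s s' in \<open>auto simp: q_add inner_add_left intro!: form_approx_add tendsto_add\<close>)
qed

lemma form_op_scale:
  assumes "form_op u g" shows "form_op (c *\<^sub>R u) (c *\<^sub>R g)"
proof -
  obtain s where s: "form_approx T s u" "\<And>v r. form_approx T r v \<Longrightarrow> (\<lambda>n. q (s n) (r n)) \<longlonglongrightarrow> g \<bullet> v"
    using assms(1) unfolding form_op_def by blast
  show ?thesis
    unfolding form_op_def
    by (rule exI[of _ "\<lambda>n. c *\<^sub>R s n"])
       (use s in \<open>auto simp: q_scale intro!: form_approx_scale tendsto_mult_left\<close>)
qed

lemma form_op_diff: "form_op u g \<Longrightarrow> form_op v h \<Longrightarrow> form_op (u - v) (g - h)"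
  using form_op_add[OF _ form_op_scale[of v h "-1"], of u g] by simp

lemma form_op_nonneg:
  assumes "form_op u g" shows "0 \<le> g \<bullet> u"
proof -
  obtain s where s: "form_approx T s u" using assms unfolding form_op_def by blast
  have "(\<lambda>n. q (s n) (s n)) \<longlonglongrightarrow> g \<bullet> u" by (rule form_op_limit[OF assms s s])
  then show ?thesis by (rule LIMSEQ_le_const) (use s in \<open>auto intro!: q_nonneg form_approx_T\<close>)
qed

lemma form_op_sym:
  assumes "form_op u g" "form_op v h" shows "g \<bullet> v = u \<bullet> h"
proof -
  obtain s r where s: "form_approx T s u" and r: "form_approx T r v" using assms unfolding form_op_def by blast
  have "(\<lambda>n. q (s n) (r n)) \<longlonglongrightarrow> g \<bullet> v" by (rule form_op_limit[OF assms(1) s r])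
  moreover have "(\<lambda>n. q (r n) (s n)) \<longlonglongrightarrow> h \<bullet> u" by (rule form_op_limit[OF assms(2) r s])
  moreover have "q (r n) (s n) = q (s n) (r n)" for n using s r by (intro q_sym form_approx_T)
  ultimately show ?thesis by (simp add: LIMSEQ_unique inner_commute)
qed

lemma form_op_in_K: "form_op u g \<Longrightarrow> u \<in> K"
proof -
  assume "form_op u g"
  then obtain s where s: "form_approx T s u" unfolding form_op_def by blast
  have "fst (s n) \<in> K" for n using form_approx_T[OF s, of n] T_K by auto
  then show "u \<in> K" by (rule closed_sequentially[OF closed_K _ form_approx_lim[OF s]])
qed

lemma form_op_T: "p \<in> T \<Longrightarrow> form_op (fst p) (snd p)"
  unfolding form_op_def q_def
  by (rule exI[of _ "\<lambda>n. p"]) (auto intro!: form_approx_const tendsto_intros form_approx_lim)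

text \<open>Minimisation of \<open>q p p + fst p \<bullet> fst p - 2 * (f \<bullet> fst p)\<close>
  over the graph. The Euler equation in the limit says that the closed form of \<open>u\<close> and
  \<open>v\<close> is \<open>(f - u) \<bullet> v\<close>. Being Cauchy for \<open>a\<close>, the
  minimising sequence is Cauchy both in norm and for \<open>q\<close>, which puts \<open>u\<close>
  into the form domain.\<close>

lemma form_op_resolvent: "\<exists>u. form_op u (f - u)"
proof -
  define a where "a p p' = q p p' + fst p \<bullet> fst p'" for p p'
  define l where "l p = f \<bullet> fst p" for p :: "'h \<times> 'h"
  have l: "linear l" unfolding l_def by (intro linearI) (auto simp: inner_add_right)
  have lb: "(l p)\<^sup>2 \<le> (norm f)\<^sup>2 * a p p" if "p \<in> T" for p
  proof -
    have "\<bar>l p\<bar> \<le> norm f * norm (fst p)" unfolding l_def by (rule Cauchy_Schwarz_ineq2)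
    from power_mono[OF this, of 2] have "(l p)\<^sup>2 \<le> (norm f)\<^sup>2 * (fst p \<bullet> fst p)"
      by (simp add: power_mult_distrib power2_norm_eq_inner)
    also have "\<dots> \<le> (norm f)\<^sup>2 * a p p" using q_nonneg[OF that] by (intro mult_left_mono) (auto simp: a_def)
    finally show ?thesis .
  qed
  obtain s :: "nat \<Rightarrow> 'h \<times> 'h" and \<epsilon> where sT: "\<And>n. s n \<in> T" and \<epsilon>: "\<And>n. 0 \<le> \<epsilon> n" "\<epsilon> \<longlonglongrightarrow> 0"
    and sc: "\<And>m n. a (s m - s n) (s m - s n) \<le> \<epsilon> m + \<epsilon> n"
    and sv: "\<And>n p. p \<in> T \<Longrightarrow> (a (s n) p - l p)\<^sup>2 \<le> \<epsilon> n * a p p"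
  proof (goal_cases)
    case *: 1
    show thesis
    proof (rule variational_sequence[of T a l "(norm f)\<^sup>2"])
      show "a x y = a y x" if "x \<in> T" "y \<in> T" for x y
        using q_sym[OF that] by (simp add: a_def inner_commute)
      show "0 \<le> a x x" if "x \<in> T" for x using q_nonneg[OF that] by (simp add: a_def)
      show thesis if "\<And>n. s n \<in> T" "\<And>n. 0 \<le> \<epsilon> n" "\<epsilon> \<longlonglongrightarrow> 0"
        "\<And>m n. a (s m - s n) (s m - s n) \<le> \<epsilon> m + \<epsilon> n"
        "\<And>n p. p \<in> T \<Longrightarrow> (a (s n) p - l p)\<^sup>2 \<le> \<epsilon> n * a p p" for s \<epsilon>
        by (rule *[OF that])
    qed (use lb l subspace_T in \<open>auto simp: a_def q_add q_scale inner_add_left algebra_simps\<close>)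
  qed
  have dT: "s m - s n \<in> T" for m n using sT by (intro T_diff)
  have "Cauchy (\<lambda>n. fst (s n))"
  proof (rule Cauchy_of_norm_sq_le[OF \<epsilon>(2)])
    show "(norm (fst (s m) - fst (s n)))\<^sup>2 \<le> \<epsilon> m + \<epsilon> n" for m n
      using sc[of m n] q_nonneg[OF dT[of m n]] by (simp add: a_def power2_norm_eq_inner)
  qed
  then obtain u where u: "(\<lambda>n. fst (s n)) \<longlonglongrightarrow> u" using Cauchy_convergent_iff convergent_def by blast
  have s: "form_approx T s u"
    unfolding form_approx_iff
  proof (intro conjI allI impI sT u)
    fix e :: real assume "0 < e"
    then have "0 < e / 2" by simp
    from order_tendstoD(2)[OF \<epsilon>(2) this] obtain N where N: "\<And>n. n \<ge> N \<Longrightarrow> \<epsilon> n < e / 2"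
      by (auto simp: eventually_sequentially)
    have "q (s m - s n) (s m - s n) < e" if "m \<ge> N" "n \<ge> N" for m n
    proof -
      have "q (s m - s n) (s m - s n) \<le> a (s m - s n) (s m - s n)" by (simp add: a_def)
      then show ?thesis using sc[of m n] N[OF that(1)] N[OF that(2)] by linarith
    qed
    then show "\<exists>M. \<forall>m\<ge>M. \<forall>n\<ge>M. q (s m - s n) (s m - s n) < e" by blast
  qed
  have "(\<lambda>n. q (s n) (r n)) \<longlonglongrightarrow> (f - u) \<bullet> v" if r: "form_approx T r v" for r v
  proof -
    obtain C where C: "0 \<le> C" "\<And>n. q (r n) (r n) \<le> C" by (rule form_approx_bounded[OF r], rule that)
    have "Bseq (\<lambda>n. fst (r n))" using form_approx_lim[OF r] convergent_imp_Bseq convergent_def by blast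
    then obtain D where D: "0 < D" "\<And>n. norm (fst (r n)) \<le> D" by (auto simp: Bseq_def)
    have ar: "a (r n) (r n) \<le> C + D\<^sup>2" for n
      using C(2)[of n] power_mono[OF D(2)[of n], of 2] by (simp add: a_def flip: power2_norm_eq_inner)
    \<comment> \<open>The test vector moves with \<open>n\<close>, which is harmless since
      \<open>a (r n) (r n)\<close> stays bounded.\<close>
    have "(a (s n) (r n) - l (r n))\<^sup>2 \<le> \<epsilon> n * (C + D\<^sup>2)" for n
      using sv[OF form_approx_T[OF r], of n n] mult_left_mono[OF ar[of n] \<epsilon>(1)[of n]] by linarith
    then have "(\<lambda>n. a (s n) (r n) - l (r n)) \<longlonglongrightarrow> 0"
      by (rule tendsto_zero_of_square_le) (rule tendsto_mult_left_zero[OF \<epsilon>(2)])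
    moreover have "(\<lambda>n. f \<bullet> fst (r n) - fst (s n) \<bullet> fst (r n)) \<longlonglongrightarrow> f \<bullet> v - u \<bullet> v"
      by (intro tendsto_intros u form_approx_lim[OF r])
    ultimately have "(\<lambda>n. (a (s n) (r n) - l (r n)) + (f \<bullet> fst (r n) - fst (s n) \<bullet> fst (r n))) \<longlonglongrightarrow> 0 + (f \<bullet> v - u \<bullet> v)"
      by (rule tendsto_add)
    then show ?thesis by (simp add: a_def l_def inner_diff_left)
  qed
  then show ?thesis unfolding form_op_def using s by blast
qed

definition A :: "'h \<Rightarrow> 'h" where "A f = (SOME u. form_op u (f - u))"

lemma form_op_A: "form_op (A f) (f - A f)"
  unfolding A_def by (rule someI_ex[OF form_op_resolvent])

text \<open>The difference \<open>w\<close> of two solutions is mapped to \<open>- w\<close>, which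
  nonnegativity forbids unless \<open>w = 0\<close>.\<close>

lemma form_op_unique: "form_op u (f - u) \<Longrightarrow> u = A f"
proof -
  assume u: "form_op u (f - u)"
  have "0 \<le> ((f - u) - (f - A f)) \<bullet> (u - A f)"
    by (rule form_op_nonneg[OF form_op_diff[OF u form_op_A]])
  also have "\<dots> = - ((u - A f) \<bullet> (u - A f))" by (simp add: inner_diff_left inner_diff_right algebra_simps)
  finally have "(u - A f) \<bullet> (u - A f) = 0" using inner_ge_zero[of "u - A f"] by linarith
  then show ?thesis by simp
qed

lemma linear_A: "linear A"
proof (rule linearI)
  show "A (f + g) = A f + A g" for f g
    using form_op_unique[of "A f + A g" "f + g"] form_op_add[OF form_op_A form_op_A, of f g]
    by (simp add: algebra_simps)
  show "A (c *\<^sub>R f) = c *\<^sub>R A f" for c f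
    using form_op_unique[of "c *\<^sub>R A f" "c *\<^sub>R f"] form_op_scale[OF form_op_A, of c f]
    by (simp add: algebra_simps)
qed

lemma A_sym: "A f \<bullet> g = f \<bullet> A g"
  using form_op_sym[OF form_op_A[of f] form_op_A[of g]] by (simp add: inner_diff_left inner_diff_right)

lemma A_bounds: "(norm (A f))\<^sup>2 \<le> A f \<bullet> f" "A f \<bullet> f \<le> f \<bullet> f"
proof -
  show 1: "(norm (A f))\<^sup>2 \<le> A f \<bullet> f"
    using form_op_nonneg[OF form_op_A, of f] by (simp add: inner_diff_left power2_norm_eq_inner inner_commute[of f])
  have "norm (A f) * norm (A f) \<le> norm (A f) * norm f"
    using 1 norm_cauchy_schwarz[of "A f" f] by (simp add: power2_eq_square)
  then have "norm (A f) \<le> norm f" by (cases "norm (A f) = 0") auto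
  then have "norm (A f) * norm f \<le> norm f * norm f" by (rule mult_right_mono) simp
  then show "A f \<bullet> f \<le> f \<bullet> f"
    using norm_cauchy_schwarz[of "A f" f] by (simp flip: power2_norm_eq_inner add: power2_eq_square)
qed

lemma A_in_K: "A f \<in> K"
  by (rule form_op_in_K[OF form_op_A])

text \<open>\<open>A f = 0\<close> means that the operator sends \<open>0\<close> to
  \<open>f\<close>; symmetry against the elements of \<open>T\<close> makes \<open>f\<close>
  orthogonal to the dense domain.\<close>

lemma A_inj:
  assumes "f \<in> K" "A f = 0" shows "f = 0"
proof (rule T_total[OF assms(1)])
  fix p assume p: "p \<in> T"
  have "form_op 0 f" using form_op_A[of f] assms(2) by simp
  from form_op_sym[OF this form_op_T[OF p]] show "f \<bullet> fst p = 0" by simp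
qed

text \<open>The same parametrisation of the graph by \<open>f\<close> as in the resolvent
  construction of a spectral measure, which is how the two operators are identified.\<close>

lemma friedrichs_eq: "friedrichs K T = {(A f, f - A f) | f. f \<in> K}"
proof (intro set_eqI iffI; clarify)
  fix u g assume "(u, g) \<in> friedrichs K T"
  then have g: "g \<in> K" "form_op u g" by (auto simp: form_op_friedrichs)
  have "u + g \<in> K" using form_op_in_K[OF g(2)] g(1) by (rule subspace_add[OF subspace_K])
  moreover have "u = A (u + g)" by (rule form_op_unique) (simp add: g)
  ultimately show "\<exists>f. (u, g) = (A f, f - A f) \<and> f \<in> K" by (intro exI[of _ "u + g"]) auto
next
  fix f assume "f \<in> K"
  then show "(A f, f - A f) \<in> friedrichs K T"
    using A_in_K by (simp add: form_op_friedrichs form_op_A subspace_diff[OF subspace_K])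
qed

lemma T_subset_friedrichs: "T \<subseteq> friedrichs K T"
  using form_op_T T_K by (auto simp: form_op_friedrichs)

lemma friedrichs_nonneg: "(u, g) \<in> friedrichs K T \<Longrightarrow> 0 \<le> g \<bullet> u"
  by (auto simp: form_op_friedrichs form_op_nonneg)

end

section \<open>Completeness of the space of square-integrable functions\<close>

lemma l2_rel_refl: "l2_rel f f \<longleftrightarrow> sq_integrable f"
  by (auto simp: l2_rel_def)

lemma sq_integrable_rep: "sq_integrable (rep_l2 u)"
  using Quotient3_rep_reflp[OF Quotient3_l2, of u] by (simp add: l2_rel_refl)

lemma class_of_rep: "class_of (rep_l2 u) = u"
  by (rule Quotient3_abs_rep[OF Quotient3_l2])

lemma class_of_add: "sq_integrable f \<Longrightarrow> sq_integrable g \<Longrightarrow> class_of f + class_of g = class_of (\<lambda>x. f x + g x)"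
  by (rule plus_l2.abs_eq) (simp_all add: l2_rel_refl)

lemma class_of_scale: "sq_integrable f \<Longrightarrow> c *\<^sub>R class_of f = class_of (\<lambda>x. c * f x)"
  by (rule scaleR_l2.abs_eq) (simp add: l2_rel_refl)

lemma class_of_diff:
  assumes "sq_integrable f" "sq_integrable g"
  shows "class_of f - class_of g = class_of (\<lambda>x. f x - g x)"
proof -
  have "class_of f - class_of g = class_of f + (-1) *\<^sub>R class_of g" by simp
  also have "\<dots> = class_of (\<lambda>x. f x - g x)"
    using assms sq_integrable_scale[OF assms(2), of "-1"] by (simp only: class_of_scale class_of_add) simp
  finally show ?thesis .
qed

lemma class_of_inner: "sq_integrable f \<Longrightarrow> sq_integrable g \<Longrightarrow> class_of f \<bullet> class_of g = (\<integral>x. f x * g x \<partial>lborel)"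
  by (rule inner_l2.abs_eq) (simp_all add: l2_rel_refl)

lemma class_of_norm: "sq_integrable f \<Longrightarrow> (norm (class_of f))\<^sup>2 = (\<integral>x. (f x)\<^sup>2 \<partial>lborel)"
  using class_of_inner[of f f] by (simp add: power2_eq_square flip: power2_norm_eq_inner)

lemma nn_integral_class_of_norm:
  "sq_integrable f \<Longrightarrow> (\<integral>\<^sup>+x. ennreal ((f x)\<^sup>2) \<partial>lborel) = ennreal ((norm (class_of f))\<^sup>2)"
  unfolding class_of_norm by (rule nn_integral_eq_integral) (auto simp: sq_integrable_def)

lemma class_of_in_L2: "sq_integrable f \<Longrightarrow> class_of f \<in> L2 \<Omega> \<longleftrightarrow> (AE x in lborel. x \<notin> \<Omega> \<longrightarrow> f x = 0)"
  unfolding L2_def mem_Collect_eq by (rule vanishes_off.abs_eq) (simp add: l2_rel_refl)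

lemma class_of_nonneg_ae: "sq_integrable f \<Longrightarrow> nonneg_ae (class_of f) \<longleftrightarrow> (AE x in lborel. 0 \<le> f x)"
  by (rule nonneg_ae.abs_eq) (simp add: l2_rel_refl)

lemma class_of_eq_0: "sq_integrable f \<Longrightarrow> class_of f = 0 \<longleftrightarrow> (AE x in lborel. f x = 0)"
proof -
  assume f: "sq_integrable f"
  have "class_of f = 0 \<longleftrightarrow> (\<integral>x. (f x)\<^sup>2 \<partial>lborel) = 0"
    using class_of_norm[OF f] by (metis norm_eq_zero zero_eq_power2)
  also have "\<dots> \<longleftrightarrow> (AE x in lborel. (f x)\<^sup>2 = 0)"
    using f by (intro integral_nonneg_eq_0_iff_AE) (auto simp: sq_integrable_def)
  finally show ?thesis by simp
qed

lemma sq_integrable_nn_integral: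
  "f \<in> borel_measurable lborel \<Longrightarrow> (\<integral>\<^sup>+x. ennreal ((f x)\<^sup>2) \<partial>lborel) < \<infinity> \<Longrightarrow> sq_integrable f"
  unfolding sq_integrable_def by (auto intro!: integrableI_nonneg)

text \<open>The weight \<open>4 ^ k\<close> turns bounded terms into increments of order
  \<open>2 ^ - k\<close>, hence absolute convergence of the telescoping series.\<close>

lemma convergent_of_square_series:
  fixes f :: "nat \<Rightarrow> real"
  assumes "(\<Sum>k. ennreal (4 ^ k * (f (Suc k) - f k)\<^sup>2)) < \<infinity>"
  shows "convergent f"
proof -
  have "summable (\<lambda>k. 4 ^ k * (f (Suc k) - f k)\<^sup>2)"
    using assms by (intro summable_suminf_not_top) auto
  then have "Bseq (\<lambda>k. 4 ^ k * (f (Suc k) - f k)\<^sup>2)"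
    using summable_LIMSEQ_zero convergent_imp_Bseq convergent_def by blast
  then obtain C where C: "0 < C" "\<And>k. \<bar>4 ^ k * (f (Suc k) - f k)\<^sup>2\<bar> \<le> C" by (auto simp: Bseq_def)
  have "\<bar>f (Suc k) - f k\<bar> \<le> sqrt C * (1/2) ^ k" for k
  proof (rule power2_le_imp_le)
    have "(f (Suc k) - f k)\<^sup>2 \<le> C * (1/4) ^ k"
      using C(2)[of k] by (simp add: power_one_over field_simps)
    also have "\<dots> = (sqrt C * (1/2) ^ k)\<^sup>2"
      using C(1) power_mult_distrib[of "1/2 :: real" "1/2" k] by (simp add: power_mult_distrib power2_eq_square)
    finally show "\<bar>f (Suc k) - f k\<bar>\<^sup>2 \<le> (sqrt C * (1/2) ^ k)\<^sup>2" by simp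
  qed (use C in simp)
  then have b: "norm (f (Suc k) - f k) \<le> sqrt C * (1/2) ^ k" for k by simp
  have "summable (\<lambda>k. sqrt C * (1/2) ^ k)" by (intro summable_mult summable_geometric) simp
  then have "summable (\<lambda>k. f (Suc k) - f k)" by (rule summable_comparison_test'[where N = 0]) (rule b)
  then have "convergent (\<lambda>n. (\<Sum>k<n. f (Suc k) - f k) + f 0)"
    by (intro convergent_add convergent_const) (simp add: summable_iff_convergent)
  then show ?thesis by (simp add: sum_lessThan_telescope)
qed

text \<open>Riesz-Fischer: a rapidly Cauchy subsequence converges almost everywhere, and Fatou's
  lemma upgrades the pointwise limit to a norm limit of the full sequence.\<close>

instance l2 :: (euclidean_space) complete_space
proof
  fix X :: "nat \<Rightarrow> 'a l2"
  assume X: "Cauchy X"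
  \<comment> \<open>A norm of order \<open>4 ^ - k\<close>, squared and multiplied by the weight
    \<open>4 ^ k\<close>, leaves the summable \<open>4 ^ - k\<close>.\<close>
  have "\<exists>N. \<forall>m\<ge>N. \<forall>n\<ge>N. norm (X m - X n) < (1/4) ^ k" for k
    using X unfolding Cauchy_iff by (meson zero_less_divide_1_iff zero_less_numeral zero_less_power)
  then obtain N where N: "\<And>k m n. m \<ge> N k \<Longrightarrow> n \<ge> N k \<Longrightarrow> norm (X m - X n) < (1/4) ^ k" by metis
  define r where "r k = (\<Sum>i\<le>k. N i)" for k
  have rN: "N k \<le> r k" for k unfolding r_def by (rule member_le_sum) auto
  have rmono: "r k \<le> r (Suc k)" for k by (simp add: r_def)
  have rstep: "norm (X (r (Suc k)) - X (r k)) < (1/4) ^ k" for k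
    using rN[of k] rmono[of k] by (intro N) auto
  define f where "f n = rep_l2 (X n)" for n
  have f: "sq_integrable (f n)" "class_of (f n) = X n" for n
    by (simp_all add: f_def sq_integrable_rep class_of_rep)
  have fm [measurable]: "f n \<in> borel_measurable borel" for n using f(1)[of n] by (simp add: sq_integrable_def)
  have nf: "(\<integral>\<^sup>+x. ennreal ((f m x - f n x)\<^sup>2) \<partial>lborel) = ennreal ((norm (X m - X n))\<^sup>2)" for m n
  proof -
    have "sq_integrable (\<lambda>x. f m x - f n x)"
      using sq_integrable_add[OF f(1)[of m] sq_integrable_scale[OF f(1)[of n], of "-1"]] by simp
    from nn_integral_class_of_norm[OF this] show ?thesis
      using class_of_diff[OF f(1) f(1), of m n] by (simp add: f(2))
  qed
  have "(\<integral>\<^sup>+x. (\<Sum>k. ennreal (4 ^ k * (f (r (Suc k)) x - f (r k) x)\<^sup>2)) \<partial>lborel)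
      = (\<Sum>k. \<integral>\<^sup>+x. ennreal (4 ^ k * (f (r (Suc k)) x - f (r k) x)\<^sup>2) \<partial>lborel)"
    by (rule nn_integral_suminf) measurable
  also have "\<dots> \<le> (\<Sum>k. ennreal ((1/4) ^ k))"
  proof (rule suminf_le)
    fix k
    have "(\<integral>\<^sup>+x. ennreal (4 ^ k * (f (r (Suc k)) x - f (r k) x)\<^sup>2) \<partial>lborel)
        = ennreal (4 ^ k * (norm (X (r (Suc k)) - X (r k)))\<^sup>2)"
      by (simp add: ennreal_mult nn_integral_cmult nf)
    also have "\<dots> \<le> ennreal ((1/4) ^ k)"
    proof (rule ennreal_leI)
      have "(norm (X (r (Suc k)) - X (r k)))\<^sup>2 \<le> ((1/4) ^ k)\<^sup>2"
        using rstep[of k] by (intro power_mono) auto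
      then have "4 ^ k * (norm (X (r (Suc k)) - X (r k)))\<^sup>2 \<le> 4 ^ k * ((1/4) ^ k)\<^sup>2" by simp
      also have "\<dots> = (1/4) ^ k" by (simp add: power2_eq_square power_one_over)
      finally show "4 ^ k * (norm (X (r (Suc k)) - X (r k)))\<^sup>2 \<le> (1/4) ^ k" .
    qed
    finally show "(\<integral>\<^sup>+x. ennreal (4 ^ k * (f (r (Suc k)) x - f (r k) x)\<^sup>2) \<partial>lborel) \<le> ennreal ((1/4) ^ k)" .
  qed auto
  also have "\<dots> < \<infinity>"
  proof -
    have "(\<Sum>k. ennreal ((1/4) ^ k)) = ennreal (\<Sum>k. (1/4) ^ k)"
      by (rule suminf_ennreal2) (simp, rule summable_geometric, simp)
    then show ?thesis by (simp only: ennreal_less_top infinity_ennreal_def)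
  qed
  finally have "(\<integral>\<^sup>+x. (\<Sum>k. ennreal (4 ^ k * (f (r (Suc k)) x - f (r k) x)\<^sup>2)) \<partial>lborel) \<noteq> \<infinity>" by simp
  then have "AE x in lborel. (\<Sum>k. ennreal (4 ^ k * (f (r (Suc k)) x - f (r k) x)\<^sup>2)) \<noteq> \<infinity>"
    by (rule nn_integral_PInf_AE[rotated]) measurable
  then have "AE x in lborel. (\<Sum>k. ennreal (4 ^ k * (f (r (Suc k)) x - f (r k) x)\<^sup>2)) < \<infinity>"
    by eventually_elim (simp add: less_top)
  then have conv: "AE x in lborel. convergent (\<lambda>k. f (r k) x)"
    by eventually_elim (rule convergent_of_square_series)
  \<comment> \<open>Where the subsequence diverges, a null set, \<open>lim\<close> returns an
    unspecified value; \<open>F\<close> is measurable all the same.\<close>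
  define F where "F x = lim (\<lambda>k. f (r k) x)" for x
  have Fm [measurable]: "F \<in> borel_measurable borel"
    unfolding F_def by (rule borel_measurable_lim_metric) measurable
  have est: "(\<integral>\<^sup>+x. ennreal ((F x - f m x)\<^sup>2) \<partial>lborel) \<le> ennreal (((1/4) ^ j)\<^sup>2)" if m: "N j \<le> m" for m j
  proof -
    have "(\<integral>\<^sup>+x. ennreal ((F x - f m x)\<^sup>2) \<partial>lborel)
        \<le> (\<integral>\<^sup>+x. liminf (\<lambda>k. ennreal ((f (r k) x - f m x)\<^sup>2)) \<partial>lborel)"
    proof (rule nn_integral_mono_AE)
      show "AE x in lborel. ennreal ((F x - f m x)\<^sup>2) \<le> liminf (\<lambda>k. ennreal ((f (r k) x - f m x)\<^sup>2))"
        using conv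
      proof eventually_elim
        case (elim x)
        then have "(\<lambda>k. f (r k) x) \<longlonglongrightarrow> F x" by (simp add: F_def convergent_LIMSEQ_iff)
        then have "(\<lambda>k. ennreal ((f (r k) x - f m x)\<^sup>2)) \<longlonglongrightarrow> ennreal ((F x - f m x)\<^sup>2)"
          by (intro tendsto_ennrealI tendsto_intros)
        from lim_imp_Liminf[OF _ this] show ?case by simp
      qed
    qed
    also have "\<dots> \<le> liminf (\<lambda>k. \<integral>\<^sup>+x. ennreal ((f (r k) x - f m x)\<^sup>2) \<partial>lborel)"
      by (rule nn_integral_liminf) measurable
    also have "\<dots> \<le> liminf (\<lambda>k. ennreal (((1/4) ^ j)\<^sup>2))"
    proof (rule Liminf_mono, rule eventually_mono[OF eventually_ge_at_top[of j]])
      fix k assume "j \<le> k"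
      have "r j \<le> r k" unfolding r_def using \<open>j \<le> k\<close> by (intro sum_mono2) auto
      then have "norm (X (r k) - X m) \<le> (1/4) ^ j"
        using rN[of j] m by (intro less_imp_le[OF N]) auto
      then show "(\<integral>\<^sup>+x. ennreal ((f (r k) x - f m x)\<^sup>2) \<partial>lborel) \<le> ennreal (((1/4) ^ j)\<^sup>2)"
        unfolding nf by (intro ennreal_leI power_mono) auto
    qed
    also have "\<dots> = ennreal (((1/4) ^ j)\<^sup>2)" by (simp add: Liminf_const)
    finally show ?thesis .
  qed
  have sqd: "sq_integrable (\<lambda>x. F x - f m x)" if "N 0 \<le> m" for m
    by (rule sq_integrable_nn_integral) (use est[OF that] in \<open>auto simp: le_less_trans\<close>)
  have FF: "sq_integrable F"
    using sq_integrable_add[OF sqd[OF order_refl] f(1)[of "N 0"]] by simp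
  have "X \<longlonglongrightarrow> class_of F"
  proof (rule LIMSEQ_I)
    fix e :: real assume "0 < e"
    then obtain j where j: "(1/4) ^ j < e" using real_arch_pow_inv[of e "1/4"] by auto
    have "norm (X m - class_of F) < e" if m: "m \<ge> max (N j) (N 0)" for m
    proof -
      have d: "class_of F - X m = class_of (\<lambda>x. F x - f m x)"
        using class_of_diff[OF FF f(1)[of m]] by (simp add: f(2))
      have "ennreal ((norm (class_of F - X m))\<^sup>2) \<le> ennreal (((1/4) ^ j)\<^sup>2)"
        using est[of j m] nn_integral_class_of_norm[OF sqd[of m]] m by (simp add: d)
      then have "(norm (class_of F - X m))\<^sup>2 \<le> ((1/4) ^ j)\<^sup>2" by (subst (asm) ennreal_le_iff) auto
      then have "norm (class_of F - X m) \<le> (1/4) ^ j" by (rule power2_le_imp_le) simp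
      then show ?thesis using j by (simp add: norm_minus_commute)
    qed
    then show "\<exists>no. \<forall>n\<ge>no. norm (X n - class_of F) < e" by blast
  qed
  then show "convergent X" by (rule convergentI)
qed

section \<open>The closed subspace of functions vanishing off a set\<close>

lemma subspace_L2: "subspace (L2 \<Omega>)"
proof (rule subspaceI)
  have *: "\<exists>f. sq_integrable f \<and> u = class_of f" for u :: "'a l2"
    using sq_integrable_rep class_of_rep by metis
  show "0 \<in> L2 \<Omega>"
    using class_of_eq_0[OF sq_integrable_zero] class_of_in_L2[OF sq_integrable_zero] by (metis (no_types, lifting) AE_I2)
  fix u v assume u: "u \<in> L2 \<Omega>"
  obtain f where f: "sq_integrable f" "u = class_of f" using * by blast
  show "c *\<^sub>R u \<in> L2 \<Omega>" for c
    using u f by (auto simp: class_of_scale class_of_in_L2 sq_integrable_scale)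
  assume v: "v \<in> L2 \<Omega>"
  obtain g where g: "sq_integrable g" "v = class_of g" using * by blast
  show "u + v \<in> L2 \<Omega>"
    using u v f g by (auto simp: class_of_add class_of_in_L2 sq_integrable_add elim: AE_mp)
qed

text \<open>Vanishing off \<open>\<Omega>\<close> is orthogonality to all functions cut off to the
  complement, an intersection of kernels of continuous functionals; testing with the cut-off of
  \<open>u\<close> itself gives the nontrivial inclusion.\<close>

lemma closed_L2:
  assumes "\<Omega> \<in> sets borel" shows "closed (L2 \<Omega> :: 'a::euclidean_space l2 set)"
proof -
  have cut: "sq_integrable (\<lambda>x. indicator (- \<Omega>) x * f x)" if "sq_integrable f" for f :: "'a \<Rightarrow> real"
  proof -
    have [measurable]: "f \<in> borel_measurable borel" "\<Omega> \<in> sets borel" using that assms by (auto simp: sq_integrable_def)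
    have "integrable lborel (\<lambda>x. (indicator (- \<Omega>) x * f x)\<^sup>2)"
      by (rule Bochner_Integration.integrable_bound[of _ "\<lambda>x. (f x)\<^sup>2"])
         (use that in \<open>auto simp: sq_integrable_def indicator_def\<close>)
    then show ?thesis by (simp add: sq_integrable_def)
  qed
  have "L2 \<Omega> = {u :: 'a l2. \<forall>v. u \<bullet> class_of (\<lambda>x. indicator (- \<Omega>) x * rep_l2 v x) = 0}"
  proof (intro set_eqI iffI CollectI allI)
    fix u v :: "'a l2" assume u: "u \<in> L2 \<Omega>"
    have "u = class_of (rep_l2 u)" by (simp add: class_of_rep)
    then have "AE x in lborel. x \<notin> \<Omega> \<longrightarrow> rep_l2 u x = 0" using u class_of_in_L2[OF sq_integrable_rep[of u]] by metis
    then have "AE x in lborel. rep_l2 u x * (indicator (- \<Omega>) x * rep_l2 v x) = 0"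
      by eventually_elim (auto simp: indicator_def)
    then have "(\<integral>x. rep_l2 u x * (indicator (- \<Omega>) x * rep_l2 v x) \<partial>lborel) = 0"
      by (rule integral_eq_zero_AE)
    then have "class_of (rep_l2 u) \<bullet> class_of (\<lambda>x. indicator (- \<Omega>) x * rep_l2 v x) = 0"
      by (simp add: class_of_inner sq_integrable_rep cut)
    then show "u \<bullet> class_of (\<lambda>x. indicator (- \<Omega>) x * rep_l2 v x) = 0" by (simp add: class_of_rep)
  next
    fix u :: "'a l2" assume "u \<in> {u. \<forall>v. u \<bullet> class_of (\<lambda>x. indicator (- \<Omega>) x * rep_l2 v x) = 0}"
    then have "class_of (rep_l2 u) \<bullet> class_of (\<lambda>x. indicator (- \<Omega>) x * rep_l2 u x) = 0" by (simp add: class_of_rep)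
    then have "(\<integral>x. rep_l2 u x * (indicator (- \<Omega>) x * rep_l2 u x) \<partial>lborel) = 0"
      by (simp add: class_of_inner sq_integrable_rep cut)
    then have "AE x in lborel. rep_l2 u x * (indicator (- \<Omega>) x * rep_l2 u x) = 0"
      using integral_nonneg_eq_0_iff_AE[OF sq_integrable_mult[OF sq_integrable_rep[of u] cut[OF sq_integrable_rep[of u]]]]
      by (simp add: indicator_def)
    then have "AE x in lborel. x \<notin> \<Omega> \<longrightarrow> rep_l2 u x = 0"
      by eventually_elim (auto simp: indicator_def)
    then show "u \<in> L2 \<Omega>" using class_of_in_L2[OF sq_integrable_rep[of u]] by (simp add: class_of_rep)
  qed
  also have "closed \<dots>"
    by (intro closed_Collect_all closed_Collect_eq continuous_intros)
  finally show ?thesis .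
qed

section \<open>Smooth functions\<close>

lemma partial_eq: "(f has_derivative f') (at x) \<Longrightarrow> partial i f x = f' i"
  unfolding partial_def using frechet_derivative_at by metis

lemma has_derivative_frechet: "f differentiable at x \<Longrightarrow> (f has_derivative frechet_derivative f (at x)) (at x)"
  using frechet_derivative_works by blast

lemma partial_add:
  "f differentiable at x \<Longrightarrow> g differentiable at x \<Longrightarrow> partial i (\<lambda>x. f x + g x) x = partial i f x + partial i g x"
  by (subst partial_eq[OF has_derivative_add[OF has_derivative_frechet has_derivative_frechet]])
     (simp_all add: partial_def)

lemma partial_mult:
  fixes f g :: "'a::euclidean_space \<Rightarrow> real"
  shows "f differentiable at x \<Longrightarrow> g differentiable at x \<Longrightarrow>
    partial i (\<lambda>x. f x * g x) x = f x * partial i g x + partial i f x * g x"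
  by (subst partial_eq[OF has_derivative_mult[OF has_derivative_frechet has_derivative_frechet]])
     (simp_all add: partial_def)

lemma partial_const: "partial i (\<lambda>x. c) x = 0"
  by (rule partial_eq[OF has_derivative_const, THEN trans]) simp

lemma Ck_continuous: "Ck k f \<Longrightarrow> continuous_on UNIV f"
  by (cases k) (auto simp: differentiable_imp_continuous_within continuous_at_imp_continuous_on)

lemma Ck_Suc_imp: "Ck (Suc k) f \<Longrightarrow> Ck k f"
proof (induction k arbitrary: f)
  case 0
  then show ?case using Ck_continuous[OF 0] by simp
next
  case (Suc k)
  then show ?case by (metis Ck.simps(2))
qed

lemma Ck_const: "Ck k (\<lambda>x. c)"
proof (induction k arbitrary: c)
  case (Suc k)
  have "partial i (\<lambda>x. c) = (\<lambda>x. 0)" for i :: 'a by (rule ext) (rule partial_const)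
  then show ?case using Suc[of 0] by simp
qed simp

lemma Ck_add: "Ck k f \<Longrightarrow> Ck k g \<Longrightarrow> Ck k (\<lambda>x. f x + g x)"
proof (induction k arbitrary: f g)
  case (Suc k)
  have "partial i (\<lambda>x. f x + g x) = (\<lambda>x. partial i f x + partial i g x)" for i
    using Suc.prems by (intro ext partial_add) auto
  then show ?case using Suc by auto
qed (auto intro: continuous_intros)

lemma Ck_mult: "Ck k f \<Longrightarrow> Ck k g \<Longrightarrow> Ck k (\<lambda>x. f x * g x)"
proof (induction k arbitrary: f g)
  case (Suc k)
  have "partial i (\<lambda>x. f x * g x) = (\<lambda>x. f x * partial i g x + partial i f x * g x)" for i
    using Suc.prems by (intro ext partial_mult) auto
  moreover have "Ck k f" "Ck k g" using Suc.prems by (auto simp only: Ck_Suc_imp)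
  ultimately show ?case using Suc by (auto intro!: Ck_add)
qed (auto intro: continuous_intros)

lemma Ck_cmult: "Ck k f \<Longrightarrow> Ck k (\<lambda>x. c * f x)"
  by (rule Ck_mult[OF Ck_const])

lemma Ck_prod: "finite I \<Longrightarrow> (\<And>i. i \<in> I \<Longrightarrow> Ck k (f i)) \<Longrightarrow> Ck k (\<lambda>x. \<Prod>i\<in>I. f i x)"
  by (induction I rule: finite_induct) (auto intro: Ck_const Ck_mult)

lemma partial_cmult: "f differentiable at x \<Longrightarrow> partial i (\<lambda>x. c * f x) x = c * partial i f x"
  using partial_mult[of "\<lambda>x. c" x f i] by (simp add: partial_const)

text \<open>The flat function \<open>exp (- c / t)\<close> with a factor \<open>t ^ - m\<close>:
  differentiation stays in the span of the family, so smoothness is an induction, and for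
  \<open>m = 0\<close> the limit as \<open>c\<close> tends to \<open>0\<close> is the indicator of
  the positive half line.\<close>

definition exp_bump :: "nat \<Rightarrow> real \<Rightarrow> real \<Rightarrow> real" where
  "exp_bump m c t = (if t \<le> 0 then 0 else (1 / t) ^ m * exp (- c / t))"

text \<open>From \<open>exp y \<ge> (y / j) ^ j\<close> for \<open>y = c / t\<close> and
  \<open>j = m + 2\<close>: two powers of \<open>t\<close> are left over, enough for derivative
  \<open>0\<close> at the origin.\<close>

lemma exp_bump_le:
  assumes c: "0 < c" and t: "0 \<le> t"
  shows "exp_bump m c t \<le> (real (m + 2) / c) ^ (m + 2) * t\<^sup>2"
proof (cases "t = 0")
  case False
  then have t: "0 < t" using t by simp
  define j where "j = m + 2"
  have "(c / t / real j) ^ j \<le> (1 + (c / t) / real j) ^ j"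
    using c t by (intro power_mono) auto
  also have "\<dots> \<le> exp (c / t)"
  proof (rule exp_ge_one_plus_x_over_n_power_n)
    have "0 < c / t" using c t by simp
    then show "- real j \<le> c / t" by linarith
  qed (simp add: j_def)
  finally have "inverse (exp (c / t)) \<le> inverse ((c / t / real j) ^ j)"
    using c t by (intro le_imp_inverse_le) (auto simp: j_def)
  then have "exp (- c / t) \<le> (real j / c) ^ j * t ^ j"
    using c t by (simp add: exp_minus field_simps power_divide power_mult_distrib)
  then have "(1 / t) ^ m * exp (- c / t) \<le> (1 / t) ^ m * ((real j / c) ^ j * t ^ j)"
    using t by (intro mult_left_mono) auto
  also have "\<dots> = (real j / c) ^ j * t\<^sup>2 * ((1 / t) ^ m * t ^ m)"
    by (simp add: j_def power_add power2_eq_square)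
  also have "(1 / t) ^ m * t ^ m = 1" using t by (simp flip: power_mult_distrib)
  finally show ?thesis unfolding j_def using t by (simp add: exp_bump_def)
qed (simp add: exp_bump_def)

lemma exp_bump_deriv:
  assumes c: "0 < c"
  shows "(exp_bump m c has_real_derivative (c * exp_bump (m + 2) c t - real m * exp_bump (m + 1) c t)) (at t)"
proof -
  consider "t < 0" | "t = 0" | "0 < t" by linarith
  then show ?thesis
  proof cases
    case 1
    have "((\<lambda>t. 0) has_real_derivative 0) (at t)" by simp
    then have "(exp_bump m c has_real_derivative 0) (at t)"
      by (rule has_field_derivative_transform_within_open[of _ _ _ "{..<0}"])
         (use 1 in \<open>auto simp: exp_bump_def\<close>)
    then show ?thesis using 1 by (simp add: exp_bump_def)
  next
    case 2
    define C where "C = (real (m + 2) / c) ^ (m + 2)"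
    have "((\<lambda>h. (exp_bump m c (0 + h) - exp_bump m c 0) / h) \<longlongrightarrow> 0) (at 0)"
    proof (rule Lim_null_comparison)
      show "\<forall>\<^sub>F h in at 0. norm ((exp_bump m c (0 + h) - exp_bump m c 0) / h) \<le> C * \<bar>h\<bar>"
      proof (rule always_eventually, rule allI)
        fix h :: real
        have "\<bar>exp_bump m c h\<bar> \<le> C * h\<^sup>2"
        proof (cases "h \<le> 0")
          case True
          then show ?thesis using c by (simp add: exp_bump_def C_def)
        next
          case False
          then have "0 \<le> exp_bump m c h" by (simp add: exp_bump_def)
          then show ?thesis using exp_bump_le[OF c, of h m] False by (simp add: C_def)
        qed
        also have "C * h\<^sup>2 = C * \<bar>h\<bar> * \<bar>h\<bar>" by (simp add: power2_eq_square)
        finally show "norm ((exp_bump m c (0 + h) - exp_bump m c 0) / h) \<le> C * \<bar>h\<bar>"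
          using c by (cases "h = 0") (auto simp: exp_bump_def[of _ _ 0] C_def divide_le_eq)
      qed
      show "((\<lambda>h. C * \<bar>h\<bar>) \<longlongrightarrow> 0) (at 0)" by (auto intro!: tendsto_eq_intros)
    qed
    then show ?thesis using 2 by (simp add: DERIV_def exp_bump_def)
  next
    case 3
    have "((\<lambda>t. (1 / t) ^ m * exp (- c / t)) has_real_derivative
        (real m * (1 / t) ^ (m - 1) * (- 1 / t\<^sup>2) * exp (- c / t) + (1 / t) ^ m * (exp (- c / t) * (c / t\<^sup>2)))) (at t)"
    proof -
      have d1: "((\<lambda>t. 1 / t) has_real_derivative - 1 / t\<^sup>2) (at t)"
        using 3 by (auto intro!: derivative_eq_intros simp: power2_eq_square)
      have d2: "((\<lambda>t. exp (- c / t)) has_real_derivative exp (- c / t) * (c / t\<^sup>2)) (at t)"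
        using 3 by (auto intro!: derivative_eq_intros simp: power2_eq_square)
      show ?thesis
        by (rule DERIV_cong[OF DERIV_mult[OF DERIV_power[OF d1, of m] d2]]) (simp add: mult_ac)
    qed
    then have d: "(exp_bump m c has_real_derivative
        (real m * (1 / t) ^ (m - 1) * (- 1 / t\<^sup>2) * exp (- c / t) + (1 / t) ^ m * (exp (- c / t) * (c / t\<^sup>2)))) (at t)"
      by (rule has_field_derivative_transform_within_open[of _ _ _ "{0<..}"])
         (use 3 in \<open>auto simp: exp_bump_def\<close>)
    have "real m * (1 / t) ^ (m - 1) * (- 1 / t\<^sup>2) = - real m * (1 / t) ^ (m + 1)"
      by (cases m) (simp_all add: power2_eq_square add_divide_distrib diff_divide_distrib algebra_simps)
    then have "real m * (1 / t) ^ (m - 1) * (- 1 / t\<^sup>2) * exp (- c / t) + (1 / t) ^ m * (exp (- c / t) * (c / t\<^sup>2))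
        = c * exp_bump (m + 2) c t - real m * exp_bump (m + 1) c t"
      using 3 by (simp add: exp_bump_def power2_eq_square mult_ac)
    then show ?thesis using d by simp
  qed
qed

text \<open>The affine argument covers both faces of a slab, with \<open>v\<close> equal to
  \<open>i\<close> or \<open>- i\<close>; the induction runs over all \<open>m\<close> at once,
  since differentiation raises \<open>m\<close>.\<close>

lemma Ck_exp_bump:
  fixes v :: "'a::euclidean_space"
  assumes c: "0 < c" shows "Ck k (\<lambda>x. exp_bump m c (x \<bullet> v + a))"
proof (induction k arbitrary: m)
  case (Suc k)
  have d: "((\<lambda>x. exp_bump m c (x \<bullet> v + a)) has_derivative
      (\<lambda>y. (c * exp_bump (m + 2) c (x \<bullet> v + a) - real m * exp_bump (m + 1) c (x \<bullet> v + a)) * (y \<bullet> v))) (at x)" for x m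
  proof -
    have "((\<lambda>x. x \<bullet> v + a) has_derivative (\<lambda>y. y \<bullet> v)) (at x)"
      by (auto intro!: derivative_eq_intros)
    from has_derivative_compose[OF this exp_bump_deriv[OF c, of m "x \<bullet> v + a", unfolded has_field_derivative_def]]
    show ?thesis by simp
  qed
  have "partial i (\<lambda>x. exp_bump m c (x \<bullet> v + a)) = (\<lambda>x. ((i \<bullet> v) * c) * exp_bump (m + 2) c (x \<bullet> v + a)
      + (- (i \<bullet> v) * real m) * exp_bump (m + 1) c (x \<bullet> v + a))" for i
    by (rule ext, subst partial_eq[OF d]) (simp add: algebra_simps)
  moreover have "Ck k (\<lambda>x. ((i \<bullet> v) * c) * exp_bump (m + 2) c (x \<bullet> v + a)
      + (- (i \<bullet> v) * real m) * exp_bump (m + 1) c (x \<bullet> v + a))" for i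
    by (intro Ck_add Ck_cmult Suc)
  moreover have "(\<lambda>x. exp_bump m c (x \<bullet> v + a)) differentiable at x" for x by (rule differentiableI[OF d])
  ultimately show ?case by simp
next
  case 0
  have "continuous_on UNIV (exp_bump m c)"
    using DERIV_isCont[OF exp_bump_deriv[OF c]] by (simp add: continuous_at_imp_continuous_on)
  then have "continuous_on UNIV (\<lambda>x. exp_bump m c (x \<bullet> v + a))"
    by (rule continuous_on_compose2) (auto intro!: continuous_intros)
  then show ?case by simp
qed

definition box_bump :: "real \<Rightarrow> 'a::euclidean_space \<Rightarrow> 'a \<Rightarrow> 'a \<Rightarrow> real" where
  "box_bump c a b x = (\<Prod>i\<in>Basis. exp_bump 0 c (x \<bullet> i + - (a \<bullet> i)) * exp_bump 0 c (x \<bullet> - i + b \<bullet> i))"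

lemma exp_bump_0: "0 \<le> exp_bump 0 c t" "0 < c \<Longrightarrow> exp_bump 0 c t \<le> 1"
  "exp_bump 0 c t = 0 \<longleftrightarrow> t \<le> 0"
  by (auto simp: exp_bump_def)

lemma box_bump_nonneg: "0 \<le> box_bump c a b x"
  unfolding box_bump_def by (intro prod_nonneg mult_nonneg_nonneg) (auto simp: exp_bump_0)

lemma box_bump_le_1: "0 < c \<Longrightarrow> box_bump c a b x \<le> 1"
  unfolding box_bump_def
  by (intro prod_le_1) (auto simp: exp_bump_0 intro!: mult_nonneg_nonneg mult_le_one)

lemma box_bump_eq_0: "box_bump c a b x = 0 \<longleftrightarrow> x \<notin> box a b"
  unfolding box_bump_def by (auto simp: exp_bump_0 mem_box not_less)

lemma box_bump_test_function:
  assumes c: "0 < c" and ab: "cbox a b \<subseteq> \<Omega>"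
  shows "box_bump c a b \<in> test_functions \<Omega>"
proof -
  have "{x. box_bump c a b x \<noteq> 0} = box a b" by (simp add: box_bump_eq_0)
  then have cl: "closure {x. box_bump c a b x \<noteq> 0} \<subseteq> cbox a b"
    by (simp add: closure_minimal box_subset_cbox closed_cbox)
  have "Ck k (box_bump c a b)" for k
    unfolding box_bump_def[abs_def] by (intro Ck_prod Ck_mult Ck_exp_bump[OF c]) auto
  then show ?thesis
    using cl ab compact_closure bounded_subset[OF bounded_cbox order_trans[OF closure_subset cl]]
    unfolding test_functions_def by auto
qed

lemma box_bump_tendsto: "(\<lambda>n. box_bump (1 / real (Suc n)) a b x) \<longlonglongrightarrow> indicator (box a b) x"
proof (cases "x \<in> box a b")
  case True
  have e: "(\<lambda>n. exp_bump 0 (1 / real (Suc n)) t) \<longlonglongrightarrow> 1" if "0 < t" for t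
  proof -
    have "(\<lambda>n. - (1 / real (Suc n)) / t) \<longlonglongrightarrow> - 0 / t"
      using LIMSEQ_inverse_real_of_nat that by (intro tendsto_divide tendsto_minus tendsto_const) (auto simp: inverse_eq_divide)
    from tendsto_exp[OF this] show ?thesis using that by (simp add: exp_bump_def)
  qed
  have "(\<lambda>n. box_bump (1 / real (Suc n)) a b x) \<longlonglongrightarrow> (\<Prod>i\<in>(Basis :: 'a set). 1 * 1)"
    unfolding box_bump_def using True by (intro tendsto_prod tendsto_mult e) (auto simp: mem_box)
  then show ?thesis using True by simp
next
  case False
  then have "box_bump (1 / real (Suc n)) a b x = 0" for n by (simp add: box_bump_eq_0)
  then show ?thesis using False by simp
qed

section \<open>Test functions and integration by parts\<close>

lemma test_function_Ck: "\<phi> \<in> test_functions \<Omega> \<Longrightarrow> Ck k \<phi>"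
  and test_function_compact: "\<phi> \<in> test_functions \<Omega> \<Longrightarrow> compact (closure {x. \<phi> x \<noteq> 0})"
  and test_function_support: "\<phi> \<in> test_functions \<Omega> \<Longrightarrow> closure {x. \<phi> x \<noteq> 0} \<subseteq> \<Omega>"
  by (simp_all add: test_functions_def)

lemma test_function_differentiable: "\<phi> \<in> test_functions \<Omega> \<Longrightarrow> \<phi> differentiable at x"
  using test_function_Ck[of \<phi> \<Omega> 1] by simp

lemma test_functionI:
  assumes "\<And>k. Ck k f" "compact S" "S \<subseteq> \<Omega>" "\<And>x. x \<notin> S \<Longrightarrow> f x = 0"
  shows "f \<in> test_functions \<Omega>"
proof -
  have "closure {x. f x \<noteq> 0} \<subseteq> S"
    using assms by (intro closure_minimal compact_imp_closed) auto
  moreover from this have "compact (closure {x. f x \<noteq> 0})"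
    using compact_Int_closed[OF assms(2) closed_closure, of "{x. f x \<noteq> 0}"] by (simp only: inf_absorb2)
  ultimately show ?thesis
    unfolding test_functions_def mem_Collect_eq using assms(1,3) by (meson order_trans)
qed

lemma not_in_support: "x \<notin> closure {x. f x \<noteq> 0} \<Longrightarrow> f x = 0"
  using closure_subset[of "{x. f x \<noteq> 0}"] by blast

lemma test_function_add:
  assumes "\<phi> \<in> test_functions \<Omega>" "\<psi> \<in> test_functions \<Omega>"
  shows "(\<lambda>x. \<phi> x + \<psi> x) \<in> test_functions \<Omega>"
proof (rule test_functionI[of _ "closure {x. \<phi> x \<noteq> 0} \<union> closure {x. \<psi> x \<noteq> 0}"])
  show "Ck k (\<lambda>x. \<phi> x + \<psi> x)" for k by (rule Ck_add[OF test_function_Ck[OF assms(1)] test_function_Ck[OF assms(2)]])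
  show "compact (closure {x. \<phi> x \<noteq> 0} \<union> closure {x. \<psi> x \<noteq> 0})"
    by (rule compact_Un[OF test_function_compact[OF assms(1)] test_function_compact[OF assms(2)]])
  show "closure {x. \<phi> x \<noteq> 0} \<union> closure {x. \<psi> x \<noteq> 0} \<subseteq> \<Omega>"
    by (rule Un_least[OF test_function_support[OF assms(1)] test_function_support[OF assms(2)]])
  show "\<phi> x + \<psi> x = 0" if "x \<notin> closure {x. \<phi> x \<noteq> 0} \<union> closure {x. \<psi> x \<noteq> 0}" for x
    using that not_in_support[of x \<phi>] not_in_support[of x \<psi>] by simp
qed

lemma test_function_cmult:
  assumes "\<phi> \<in> test_functions \<Omega>"
  shows "(\<lambda>x. c * \<phi> x) \<in> test_functions \<Omega>"
proof (rule test_functionI[OF _ test_function_compact[OF assms] test_function_support[OF assms]])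
  show "Ck k (\<lambda>x. c * \<phi> x)" for k by (rule Ck_cmult[OF test_function_Ck[OF assms]])
  show "c * \<phi> x = 0" if "x \<notin> closure {x. \<phi> x \<noteq> 0}" for x
    using not_in_support[OF that] by simp
qed

lemma partial_eq_0:
  assumes "open U" "x \<in> U" "\<And>y. y \<in> U \<Longrightarrow> f y = 0" shows "partial i f x = 0"
proof -
  have "((\<lambda>y. 0) has_derivative (\<lambda>_. 0)) (at x)" by simp
  then have "(f has_derivative (\<lambda>_. 0)) (at x)"
    by (rule has_derivative_transform_within_open[OF _ assms(1,2)]) (simp add: assms(3))
  then show ?thesis by (simp add: partial_eq)
qed

lemma test_function_partial:
  assumes \<phi>: "\<phi> \<in> test_functions \<Omega>" and i: "i \<in> Basis"
  shows "partial i \<phi> \<in> test_functions \<Omega>"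
proof (rule test_functionI[OF _ test_function_compact[OF \<phi>] test_function_support[OF \<phi>]])
  show "Ck k (partial i \<phi>)" for k using test_function_Ck[OF \<phi>, of "Suc k"] i by simp
  show "partial i \<phi> x = 0" if "x \<notin> closure {x. \<phi> x \<noteq> 0}" for x
  proof (rule partial_eq_0)
    show "open (- closure {x. \<phi> x \<noteq> 0})" by (simp add: open_Compl)
    show "\<phi> y = 0" if "y \<in> - closure {x. \<phi> x \<noteq> 0}" for y
      using that by (intro not_in_support) simp
  qed (use that in simp)
qed

lemma test_function_mult:
  assumes "\<phi> \<in> test_functions \<Omega>" "\<psi> \<in> test_functions \<Omega>"
  shows "(\<lambda>x. \<phi> x * \<psi> x) \<in> test_functions \<Omega>"
proof (rule test_functionI[OF _ test_function_compact[OF assms(1)] test_function_support[OF assms(1)]])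
  show "Ck k (\<lambda>x. \<phi> x * \<psi> x)" for k by (rule Ck_mult[OF test_function_Ck[OF assms(1)] test_function_Ck[OF assms(2)]])
  show "\<phi> x * \<psi> x = 0" if "x \<notin> closure {x. \<phi> x \<noteq> 0}" for x
    using not_in_support[OF that] by simp
qed

lemma integrable_continuous_compact_support:
  fixes f :: "'a::euclidean_space \<Rightarrow> real"
  assumes "continuous_on UNIV f" "compact S" "\<And>x. x \<notin> S \<Longrightarrow> f x = 0"
  shows "integrable lborel f"
proof -
  have "integrable lborel (\<lambda>x. indicator S x *\<^sub>R f x)"
    using assms by (intro borel_integrable_compact) (auto intro: continuous_on_subset)
  moreover have "(\<lambda>x. indicator S x *\<^sub>R f x) = f"
  proof
    show "indicator S x *\<^sub>R f x = f x" for x using assms(3)[of x] by (cases "x \<in> S") auto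
  qed
  ultimately show ?thesis by simp
qed

lemma sq_integrable_continuous_compact_support:
  fixes f :: "'a::euclidean_space \<Rightarrow> real"
  assumes "continuous_on UNIV f" "compact S" "\<And>x. x \<notin> S \<Longrightarrow> f x = 0"
  shows "sq_integrable f"
  unfolding sq_integrable_def
proof
  show "f \<in> borel_measurable lborel" using assms(1) by (simp add: borel_measurable_continuous_onI)
  show "integrable lborel (\<lambda>x. (f x)\<^sup>2)"
    by (rule integrable_continuous_compact_support[OF _ assms(2)]) (auto intro: continuous_intros assms(1) simp: assms(3))
qed

lemma sq_integrable_test_function: "\<phi> \<in> test_functions \<Omega> \<Longrightarrow> sq_integrable \<phi>"
  by (rule sq_integrable_continuous_compact_support[OF Ck_continuous[OF test_function_Ck] test_function_compact
      not_in_support])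

lemma integrable_test_function: "\<phi> \<in> test_functions \<Omega> \<Longrightarrow> integrable lborel \<phi>"
  by (rule integrable_continuous_compact_support[OF Ck_continuous[OF test_function_Ck] test_function_compact
      not_in_support])

lemma integral_translate:
  fixes f :: "'a::euclidean_space \<Rightarrow> real"
  assumes "f \<in> borel_measurable borel"
  shows "(\<integral>x. f (c + x) \<partial>lborel) = (\<integral>x. f x \<partial>lborel)"
proof -
  have "(\<integral>x. f x \<partial>lborel) = (\<integral>x. f x \<partial>distr lborel borel ((+) c))" by (simp add: lborel_distr_plus)
  also have "\<dots> = (\<integral>x. f (c + x) \<partial>lborel)" using assms by (subst integral_distr) auto
  finally show ?thesis by simp
qed

lemma integrable_translate:
  fixes f :: "'a::euclidean_space \<Rightarrow> real"
  assumes "integrable lborel f" shows "integrable lborel (\<lambda>x. f (c + x))"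
proof -
  have "integrable (distr lborel borel ((+) c)) f" using assms by (simp add: lborel_distr_plus)
  then show ?thesis by (subst (asm) integrable_distr_eq) (use assms in auto)
qed

text \<open>Translation invariance of the Lebesgue measure: difference quotients have integral zero and
  converge dominatedly to the derivative.\<close>

lemma integral_partial_eq_0:
  fixes \<phi> :: "'a::euclidean_space \<Rightarrow> real"
  assumes \<phi>: "\<phi> \<in> test_functions \<Omega>" and i: "i \<in> Basis"
  shows "(\<integral>x. partial i \<phi> x \<partial>lborel) = 0"
proof -
  define h where "h n = 1 / real (Suc n)" for n
  have h: "0 < h n" "h n \<le> 1" for n by (simp_all add: h_def)
  have h0: "h \<longlonglongrightarrow> 0" unfolding h_def using LIMSEQ_inverse_real_of_nat by (simp add: inverse_eq_divide)
  note p = test_function_partial[OF \<phi> i]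
  note int = integrable_test_function[OF \<phi>]
  have deriv: "((\<lambda>t. \<phi> (t *\<^sub>R i + x)) has_real_derivative partial i \<phi> (t *\<^sub>R i + x)) (at t)" for x t
  proof -
    have "((\<lambda>t. t *\<^sub>R i + x) has_derivative (\<lambda>s. s *\<^sub>R i)) (at t)"
      by (auto intro!: derivative_eq_intros)
    from has_derivative_compose[OF this has_derivative_frechet[OF test_function_differentiable[OF \<phi>]]]
    have "((\<lambda>t. \<phi> (t *\<^sub>R i + x)) has_derivative (\<lambda>s. frechet_derivative \<phi> (at (t *\<^sub>R i + x)) (s *\<^sub>R i))) (at t)" .
    moreover have "frechet_derivative \<phi> (at (t *\<^sub>R i + x)) (s *\<^sub>R i) = partial i \<phi> (t *\<^sub>R i + x) * s" for s
      using linear_cmul[OF has_derivative_linear[OF has_derivative_frechet[OF test_function_differentiable[OF \<phi>]]]]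
      by (simp add: partial_def)
    ultimately show ?thesis by (simp add: has_field_derivative_def)
  qed
  obtain C where C: "\<And>x. \<bar>partial i \<phi> x\<bar> \<le> C" "0 \<le> C"
  proof -
    have "compact (partial i \<phi> ` closure {x. partial i \<phi> x \<noteq> 0})"
      using test_function_compact[OF p] Ck_continuous[OF test_function_Ck[OF p]]
      by (intro compact_continuous_image) (auto intro: continuous_on_subset)
    from compact_imp_bounded[OF this] obtain C where
      C: "\<And>x. x \<in> closure {x. partial i \<phi> x \<noteq> 0} \<Longrightarrow> \<bar>partial i \<phi> x\<bar> \<le> C"
      by (auto simp: bounded_iff)
    have "\<bar>partial i \<phi> x\<bar> \<le> \<bar>C\<bar>" for x
      using C[of x] not_in_support[of x "partial i \<phi>"] by (cases "x \<in> closure {x. partial i \<phi> x \<noteq> 0}") auto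
    then show thesis using that[of "\<bar>C\<bar>"] by auto
  qed
  obtain R where R: "\<And>x. \<phi> x \<noteq> 0 \<Longrightarrow> norm x \<le> R"
  proof -
    obtain R where "\<forall>x\<in>closure {x. \<phi> x \<noteq> 0}. norm x \<le> R"
      using compact_imp_bounded[OF test_function_compact[OF \<phi>]] unfolding bounded_iff by blast
    then have "\<phi> x \<noteq> 0 \<Longrightarrow> norm x \<le> R" for x using not_in_support[of x \<phi>] by blast
    then show thesis by (rule that)
  qed
  define D where "D n x = (\<phi> (h n *\<^sub>R i + x) - \<phi> x) / h n" for n x
  have D0: "(\<integral>x. D n x \<partial>lborel) = 0" for n
    unfolding D_def using integral_translate[of \<phi> "h n *\<^sub>R i"] int integrable_translate[OF int]
    by (simp add: borel_measurable_integrable)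
  have Dlim: "(\<lambda>n. D n x) \<longlonglongrightarrow> partial i \<phi> x" for x
  proof -
    have "((\<lambda>t. (\<phi> (t *\<^sub>R i + x) - \<phi> x) / t) \<longlongrightarrow> partial i \<phi> x) (at 0)"
      using deriv[of x 0] by (simp add: DERIV_def)
    moreover have "filterlim h (at 0) sequentially"
      using h0 h by (auto simp: filterlim_at intro!: always_eventually less_imp_neq[symmetric])
    ultimately show ?thesis unfolding D_def by (rule filterlim_compose)
  qed
  have Db: "\<bar>D n x\<bar> \<le> C" for n x
  proof -
    have "\<exists>z. 0 < z \<and> z < h n \<and> \<phi> (h n *\<^sub>R i + x) - \<phi> (0 *\<^sub>R i + x) = (h n - 0) * partial i \<phi> (z *\<^sub>R i + x)"
      by (rule MVT2[OF h(1)]) (rule deriv)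
    then obtain z where "\<phi> (h n *\<^sub>R i + x) - \<phi> x = h n * partial i \<phi> (z *\<^sub>R i + x)" by auto
    then have "D n x = partial i \<phi> (z *\<^sub>R i + x)" using h(1)[of n] by (simp add: D_def)
    then show ?thesis using C(1) by simp
  qed
  \<comment> \<open>Steps \<open>h n \<le> 1\<close> keep all shifted supports in the ball of radius
    \<open>R + 1\<close>, which gives an integrable majorant.\<close>
  have Ds: "D n x = 0" if "x \<notin> cball 0 (R + 1)" for n x
  proof -
    have x: "R + 1 < norm x" using that by simp
    have "norm x \<le> norm (h n *\<^sub>R i + x) + norm (h n *\<^sub>R i)"
      using norm_triangle_ineq4[of "h n *\<^sub>R i + x" "h n *\<^sub>R i"] by simp
    then have "norm x \<le> norm (h n *\<^sub>R i + x) + 1" using h[of n] i by simp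
    then have "\<phi> (h n *\<^sub>R i + x) = 0" "\<phi> x = 0" using R[of x] R[of "h n *\<^sub>R i + x"] x by (force, force)
    then show ?thesis by (simp add: D_def)
  qed
  have "(\<lambda>n. \<integral>x. D n x \<partial>lborel) \<longlonglongrightarrow> (\<integral>x. partial i \<phi> x \<partial>lborel)"
  proof (rule integral_dominated_convergence)
    show "integrable lborel (\<lambda>x :: 'a. C * indicator (cball 0 (R + 1)) x :: real)"
      by (intro integrable_mult_right integrable_real_indicator) (use emeasure_bounded_finite[of "cball 0 (R + 1) :: 'a set"] in auto)
    show "AE x in lborel. norm (D n x) \<le> C * indicator (cball 0 (R + 1)) x" for n
    proof (rule AE_I2)
      fix x show "norm (D n x) \<le> C * indicator (cball 0 (R + 1)) x"
        using Db[of n x] Ds[of x n] by (cases "x \<in> cball 0 (R + 1)") auto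
    qed
    show "partial i \<phi> \<in> borel_measurable lborel" using integrable_test_function[OF p] by auto
    show "D n \<in> borel_measurable lborel" for n
      unfolding D_def[abs_def] using int integrable_translate[OF int, of "h n *\<^sub>R i"] by auto
  qed (use Dlim in auto)
  then show ?thesis by (simp add: D0 LIMSEQ_const_iff)
qed

lemma integration_by_parts:
  assumes \<phi>: "\<phi> \<in> test_functions \<Omega>" and \<psi>: "\<psi> \<in> test_functions \<Omega>" and i: "i \<in> Basis"
  shows "(\<integral>x. partial i \<phi> x * \<psi> x \<partial>lborel) = - (\<integral>x. \<phi> x * partial i \<psi> x \<partial>lborel)"
proof -
  note p = test_function_partial[OF \<phi> i] and q = test_function_partial[OF \<psi> i]
  have "partial i (\<lambda>x. \<phi> x * \<psi> x) = (\<lambda>x. \<phi> x * partial i \<psi> x + partial i \<phi> x * \<psi> x)"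
    by (intro ext partial_mult test_function_differentiable[OF \<phi>] test_function_differentiable[OF \<psi>])
  then have "(\<integral>x. \<phi> x * partial i \<psi> x + partial i \<phi> x * \<psi> x \<partial>lborel) = 0"
    using integral_partial_eq_0[OF test_function_mult[OF \<phi> \<psi>] i] by simp
  then show ?thesis
    using integrable_test_function[OF test_function_mult[OF \<phi> q]]
      integrable_test_function[OF test_function_mult[OF p \<psi>]] by simp
qed

section \<open>The fundamental lemma of the calculus of variations\<close>

lemma sq_integrable_indicator_cbox: "sq_integrable (indicator (cbox a b) :: 'a::euclidean_space \<Rightarrow> real)"
proof -
  have "(\<lambda>x. (indicator (cbox a b) x)\<^sup>2) = (indicator (cbox a b) :: 'a \<Rightarrow> real)" by (auto simp: indicator_def)
  then show ?thesis by (simp add: sq_integrable_def emeasure_lborel_cbox_eq)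
qed

text \<open>The bumps of a box tend to its indicator as their parameter tends to \<open>0\<close>,
  dominated by the indicator of the closed box.\<close>

lemma integral_box_eq_0:
  fixes f :: "'a::euclidean_space \<Rightarrow> real"
  assumes f: "sq_integrable f" and ortho: "\<And>\<phi>. \<phi> \<in> test_functions \<Omega> \<Longrightarrow> (\<integral>x. f x * \<phi> x \<partial>lborel) = 0"
    and ab: "cbox a b \<subseteq> \<Omega>"
  shows "(\<integral>x. f x * indicator (box a b) x \<partial>lborel) = 0"
proof -
  have [measurable]: "f \<in> borel_measurable borel" using f by (simp add: sq_integrable_def)
  let ?\<phi> = "\<lambda>n. box_bump (1 / real (Suc n)) a b"
  have \<phi>: "?\<phi> n \<in> test_functions \<Omega>" for n by (rule box_bump_test_function[OF _ ab]) simp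
  have "(\<lambda>n. \<integral>x. f x * ?\<phi> n x \<partial>lborel) \<longlonglongrightarrow> (\<integral>x. f x * indicator (box a b) x \<partial>lborel)"
  proof (rule integral_dominated_convergence)
    show "integrable lborel (\<lambda>x. \<bar>f x * indicator (cbox a b) x\<bar>)"
      by (intro integrable_abs sq_integrable_mult f sq_integrable_indicator_cbox)
    show "(\<lambda>x. f x * ?\<phi> n x) \<in> borel_measurable lborel" for n
      using sq_integrable_test_function[OF \<phi>[of n]] by (auto simp: sq_integrable_def)
    show "AE x in lborel. norm (f x * ?\<phi> n x) \<le> \<bar>f x * indicator (cbox a b) x\<bar>" for n
    proof (rule AE_I2)
      fix x
      show "norm (f x * ?\<phi> n x) \<le> \<bar>f x * indicator (cbox a b) x\<bar>"
      proof (cases "x \<in> box a b")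
        case True
        then have "x \<in> cbox a b" using box_subset_cbox by blast
        moreover have "\<bar>?\<phi> n x\<bar> \<le> 1" using box_bump_nonneg[of _ a b x] box_bump_le_1[of "1 / real (Suc n)" a b x] by simp
        ultimately show ?thesis using mult_left_mono[of "\<bar>?\<phi> n x\<bar>" 1 "\<bar>f x\<bar>"] by (simp add: abs_mult)
      next
        case False
        then have "?\<phi> n x = 0" by (simp add: box_bump_eq_0)
        then show ?thesis by simp
      qed
    qed
    show "AE x in lborel. (\<lambda>n. f x * ?\<phi> n x) \<longlonglongrightarrow> f x * indicator (box a b) x"
      by (intro AE_I2 tendsto_mult_left box_bump_tendsto)
  qed measurable
  then show ?thesis using ortho[OF \<phi>] by (simp add: LIMSEQ_const_iff)
qed

lemma box_Int_box:
  "box a b \<inter> box c d = box (\<Sum>i\<in>Basis. max (a \<bullet> i) (c \<bullet> i) *\<^sub>R i) (\<Sum>i\<in>Basis. min (b \<bullet> i) (d \<bullet> i) *\<^sub>R i)"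
  by (auto simp: mem_box)

text \<open>Localised to one box so that \<open>f\<close> becomes integrable and not merely square
  integrable. Boxes are stable under intersection and generate the Borel sets, so all set integrals
  of \<open>h\<close> vanish, in particular over \<open>{x. 0 < h x}\<close> and
  \<open>{x. h x < 0}\<close>.\<close>

lemma AE_box_eq_0:
  fixes f :: "'a::euclidean_space \<Rightarrow> real"
  assumes f: "sq_integrable f" and ortho: "\<And>\<phi>. \<phi> \<in> test_functions \<Omega> \<Longrightarrow> (\<integral>x. f x * \<phi> x \<partial>lborel) = 0"
    and pq: "cbox p q \<subseteq> \<Omega>"
  shows "AE x in lborel. x \<in> box p q \<longrightarrow> f x = 0"
proof -
  have fm [measurable]: "f \<in> borel_measurable borel" using f by (simp add: sq_integrable_def)
  define h where "h x = f x * indicator (box p q) x" for x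
  have hm [measurable]: "h \<in> borel_measurable borel" unfolding h_def by measurable
  have hi: "integrable lborel h"
  proof (rule Bochner_Integration.integrable_bound)
    show "integrable lborel (\<lambda>x. f x * indicator (cbox p q) x)"
      by (intro sq_integrable_mult f sq_integrable_indicator_cbox)
    show "AE x in lborel. norm (h x) \<le> norm (f x * indicator (cbox p q) x)"
      using box_subset_cbox[of p q] by (intro AE_I2) (auto simp: h_def indicator_def)
  qed measurable
  have hB: "integrable lborel (\<lambda>x. h x * indicator B x)" if "B \<in> sets borel" for B
    using hi that by (intro integrable_real_mult_indicator) auto
  have box0: "(\<integral>x. h x * indicator (box a b) x \<partial>lborel) = 0" for a b
  proof -
    let ?a = "\<Sum>i\<in>Basis. max (a \<bullet> i) (p \<bullet> i) *\<^sub>R i" and ?b = "\<Sum>i\<in>Basis. min (b \<bullet> i) (q \<bullet> i) *\<^sub>R i"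
    have "cbox ?a ?b \<subseteq> cbox p q" by (auto simp: mem_box)
    then have "(\<integral>x. f x * indicator (box ?a ?b) x \<partial>lborel) = 0"
      using pq by (intro integral_box_eq_0[OF f, where \<Omega> = \<Omega>] ortho) auto
    moreover have "h x * indicator (box a b) x = f x * indicator (box ?a ?b) x" for x
      unfolding box_Int_box[symmetric] by (auto simp: h_def indicator_def)
    ultimately show ?thesis by simp
  qed
  have all0: "(\<integral>x. h x * indicator B x \<partial>lborel) = 0" if "B \<in> sets borel" for B
  proof -
    let ?G = "range (\<lambda>(a, b). box a b :: 'a set)"
    have stable: "Int_stable ?G"
      unfolding Int_stable_def by (auto simp: box_Int_box)
    have B: "B \<in> sigma_sets UNIV ?G" using that by (simp add: borel_eq_box)
    have "?G \<subseteq> Pow UNIV" by simp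
    from stable this B show ?thesis
    proof (induction rule: sigma_sets_induct_disjoint)
      case (basic A)
      then show ?case using box0 by auto
    next
      case empty
      then show ?case by simp
    next
      case (compl A)
      have A: "A \<in> sets borel" using compl(1) by (simp add: borel_eq_box)
      \<comment> \<open>Since \<open>h\<close> lives in \<open>box p q\<close>, its integral over
        the whole space is one over a box; the complement case starts from this.\<close>
      have "(\<integral>x. h x \<partial>lborel) = (\<integral>x. h x * indicator (box p q) x \<partial>lborel)"
        by (intro Bochner_Integration.integral_cong) (auto simp: h_def indicator_def)
      then have h0: "(\<integral>x. h x \<partial>lborel) = 0" by (simp add: box0)
      have "(\<integral>x. h x * indicator (UNIV - A) x \<partial>lborel) = (\<integral>x. h x - h x * indicator A x \<partial>lborel)"
        by (intro Bochner_Integration.integral_cong) (auto simp: indicator_def)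
      also have "\<dots> = 0" using hi hB[OF A] compl(2) h0 by simp
      finally show ?case .
    next
      case (union A)
      have A: "A i \<in> sets borel" for i using union(2) by (auto simp: borel_eq_box)
      have eq: "(\<Sum>i<n. indicator (A i) x) = (indicator (\<Union>i<n. A i) x :: real)" for n x
        using union(1) by (intro indicator_UN_disjoint[symmetric]) (auto simp: disjoint_family_on_def)
      have "(\<lambda>n. \<integral>x. h x * indicator (\<Union>i<n. A i) x \<partial>lborel) \<longlonglongrightarrow> (\<integral>x. h x * indicator (\<Union>i. A i) x \<partial>lborel)"
      proof (rule integral_dominated_convergence)
        show "integrable lborel (\<lambda>x. \<bar>h x\<bar>)" using hi by simp
        show "AE x in lborel. (\<lambda>n. h x * indicator (\<Union>i<n. A i) x) \<longlonglongrightarrow> h x * indicator (\<Union>i. A i) x"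
          by (intro AE_I2 tendsto_mult_left LIMSEQ_indicator_UN)
        show "AE x in lborel. norm (h x * indicator (\<Union>i<n. A i) x) \<le> \<bar>h x\<bar>" for n
          by (intro AE_I2) (simp add: indicator_def)
      qed (use A in measurable)
      moreover have "(\<integral>x. h x * indicator (\<Union>i<n. A i) x \<partial>lborel) = 0" for n
      proof -
        have "(\<integral>x. h x * indicator (\<Union>i<n. A i) x \<partial>lborel) = (\<integral>x. (\<Sum>i<n. h x * indicator (A i) x) \<partial>lborel)"
          by (simp only: eq[symmetric] sum_distrib_left)
        also have "\<dots> = (\<Sum>i<n. \<integral>x. h x * indicator (A i) x \<partial>lborel)"
          using hB[OF A] by (rule Bochner_Integration.integral_sum)
        finally show ?thesis using union(3) by simp
      qed
      ultimately show ?case by (simp add: LIMSEQ_const_iff)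
    qed
  qed
  have "AE x in lborel. \<bar>h x\<bar> = 0"
  proof (subst integral_nonneg_eq_0_iff_AE[symmetric])
    let ?P = "{x. 0 < h x}" and ?N = "{x. h x < 0}"
    have P: "?P \<in> sets borel" and N: "?N \<in> sets borel" by measurable
    have "(\<integral>x. \<bar>h x\<bar> \<partial>lborel) = (\<integral>x. h x * indicator ?P x - h x * indicator ?N x \<partial>lborel)"
      by (intro Bochner_Integration.integral_cong) (auto simp: indicator_def)
    also have "\<dots> = 0" using hB[OF P] hB[OF N] all0[OF P] all0[OF N] by simp
    finally show "(\<integral>x. \<bar>h x\<bar> \<partial>lborel) = 0" .
  qed (use hi in auto)
  then show ?thesis by eventually_elim (auto simp: h_def indicator_def)
qed

text \<open>Lindelof: countably many boxes with closed box inside \<open>\<Omega>\<close> cover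
  \<open>\<Omega>\<close>, so the exceptional sets unite to a null set.\<close>

lemma AE_eq_0_of_orthogonal:
  fixes f :: "'a::euclidean_space \<Rightarrow> real"
  assumes "open \<Omega>" and f: "sq_integrable f"
    and ortho: "\<And>\<phi>. \<phi> \<in> test_functions \<Omega> \<Longrightarrow> (\<integral>x. f x * \<phi> x \<partial>lborel) = 0"
  shows "AE x in lborel. x \<in> \<Omega> \<longrightarrow> f x = 0"
proof -
  define F where "F = {box a b | a b :: 'a. cbox a b \<subseteq> \<Omega>}"
  obtain F' where F': "F' \<subseteq> F" "countable F'" "\<Union>F' = \<Union>F"
    by (rule Lindelof[of F]) (auto simp: F_def)
  have cover: "\<Omega> \<subseteq> \<Union>F"
  proof
    fix x assume "x \<in> \<Omega>"
    with \<open>open \<Omega>\<close> obtain a b where "cbox a b \<subseteq> \<Omega>" "x \<in> box a b" by (rule open_contains_cbox)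
    then show "x \<in> \<Union>F" unfolding F_def by blast
  qed
  have "AE x in lborel. \<forall>B\<in>F'. x \<in> B \<longrightarrow> f x = 0"
  proof (subst AE_ball_countable[OF F'(2)], rule ballI)
    fix B assume "B \<in> F'"
    then obtain a b where "B = box a b" "cbox a b \<subseteq> \<Omega>" using F'(1) unfolding F_def by blast
    then show "AE x in lborel. x \<in> B \<longrightarrow> f x = 0" using AE_box_eq_0[OF f ortho] by simp
  qed
  then show ?thesis by eventually_elim (use cover F'(3) in blast)
qed

section \<open>The minimal Schroedinger operator\<close>

definition schroedinger :: "('a::euclidean_space \<Rightarrow> real) \<Rightarrow> ('a \<Rightarrow> real) \<Rightarrow> 'a \<Rightarrow> real" where
  "schroedinger V \<phi> x = - laplacian \<phi> x + V x * \<phi> x"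

lemma S_min_eq: "S_min \<Omega> V = {(class_of \<phi>, class_of (schroedinger V \<phi>)) | \<phi>. \<phi> \<in> test_functions \<Omega>}"
  by (simp add: S_min_def schroedinger_def[abs_def])

lemma test_function_zero: "(\<lambda>x. 0) \<in> test_functions \<Omega>"
  by (rule test_functionI[of _ "{}"]) (auto intro: Ck_const)

lemma test_function_sum:
  "finite I \<Longrightarrow> (\<And>i. i \<in> I \<Longrightarrow> \<phi> i \<in> test_functions \<Omega>) \<Longrightarrow> (\<lambda>x. \<Sum>i\<in>I. \<phi> i x) \<in> test_functions \<Omega>"
  by (induction I rule: finite_induct) (auto intro: test_function_zero test_function_add)

lemma laplacian_test_function: "\<phi> \<in> test_functions \<Omega> \<Longrightarrow> laplacian \<phi> \<in> test_functions \<Omega>"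
  unfolding laplacian_def[abs_def] by (intro test_function_sum test_function_partial) auto

lemma class_of_test_function_L2: "\<phi> \<in> test_functions \<Omega> \<Longrightarrow> class_of \<phi> \<in> L2 \<Omega>"
proof -
  assume \<phi>: "\<phi> \<in> test_functions \<Omega>"
  have "x \<notin> \<Omega> \<longrightarrow> \<phi> x = 0" for x
    using test_function_support[OF \<phi>] not_in_support[of x \<phi>] by blast
  then show ?thesis by (subst class_of_in_L2[OF sq_integrable_test_function[OF \<phi>]]) simp
qed

context
  fixes \<Omega> :: "'a::euclidean_space set" and V :: "'a \<Rightarrow> real"
  assumes \<Omega>: "open \<Omega>" and V: "continuous_on \<Omega> V"
begin

text \<open>\<open>V\<close> is arbitrary outside \<open>\<Omega>\<close>. The product is continuous
  on \<open>\<Omega>\<close> and zero on the complement of the support; these two open sets cover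
  the space.\<close>

lemma continuous_potential_mult:
  assumes \<phi>: "\<phi> \<in> test_functions \<Omega>" shows "continuous_on UNIV (\<lambda>x. V x * \<phi> x)"
proof -
  let ?S = "closure {x. \<phi> x \<noteq> 0}"
  have "continuous_on \<Omega> (\<lambda>x. V x * \<phi> x)"
    using V continuous_on_subset[OF Ck_continuous[OF test_function_Ck[OF \<phi>]]] by (intro continuous_on_mult) auto
  moreover have "continuous_on (- ?S) (\<lambda>x. V x * \<phi> x)"
  proof (subst continuous_on_cong[OF refl])
    show "V x * \<phi> x = 0" if "x \<in> - ?S" for x using that not_in_support[of x \<phi>] by simp
  qed simp
  ultimately have "continuous_on (\<Omega> \<union> - ?S) (\<lambda>x. V x * \<phi> x)"
    using \<Omega> by (intro continuous_on_open_Un) auto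
  moreover have "\<Omega> \<union> - ?S = UNIV" using test_function_support[OF \<phi>] by blast
  ultimately show ?thesis by simp
qed

lemma sq_integrable_potential_mult: "\<phi> \<in> test_functions \<Omega> \<Longrightarrow> sq_integrable (\<lambda>x. V x * \<phi> x)"
  by (rule sq_integrable_continuous_compact_support[OF continuous_potential_mult test_function_compact])
     (auto dest: not_in_support)

lemma sq_integrable_schroedinger: "\<phi> \<in> test_functions \<Omega> \<Longrightarrow> sq_integrable (schroedinger V \<phi>)"
  using sq_integrable_add[OF sq_integrable_scale[OF sq_integrable_test_function[OF laplacian_test_function], of \<phi> \<Omega> "-1"]
    sq_integrable_potential_mult, of \<phi>]
  by (simp add: schroedinger_def[abs_def])

lemma schroedinger_off_support:
  assumes "\<phi> \<in> test_functions \<Omega>" "x \<notin> \<Omega>" shows "schroedinger V \<phi> x = 0"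
proof -
  have 0: "f x = 0" if "f \<in> test_functions \<Omega>" for f
    using test_function_support[OF that] not_in_support[of x f] assms(2) by blast
  show ?thesis using 0[OF assms(1)] 0[OF laplacian_test_function[OF assms(1)]] by (simp add: schroedinger_def)
qed

text \<open>After integration by parts the expression is symmetric in \<open>\<phi>\<close> and
  \<open>\<psi>\<close>, and its diagonal is the form assumed to be nonnegative.\<close>

lemma inner_schroedinger:
  assumes \<phi>: "\<phi> \<in> test_functions \<Omega>" and \<psi>: "\<psi> \<in> test_functions \<Omega>"
  shows "class_of (schroedinger V \<phi>) \<bullet> class_of \<psi>
    = (\<integral>x. (\<Sum>i\<in>Basis. partial i \<phi> x * partial i \<psi> x) + V x * \<phi> x * \<psi> x \<partial>lborel)"
proof -
  have i1: "integrable lborel (\<lambda>x. partial i (partial i \<phi>) x * \<psi> x)" if "i \<in> Basis" for i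
    by (rule integrable_test_function[OF test_function_mult[OF test_function_partial[OF test_function_partial[OF \<phi> that] that] \<psi>]])
  have i2: "integrable lborel (\<lambda>x. partial i \<phi> x * partial i \<psi> x)" if "i \<in> Basis" for i
    by (rule integrable_test_function[OF test_function_mult[OF test_function_partial[OF \<phi> that] test_function_partial[OF \<psi> that]]])
  have i3: "integrable lborel (\<lambda>x. V x * \<phi> x * \<psi> x)"
    by (rule sq_integrable_mult[OF sq_integrable_potential_mult[OF \<phi>] sq_integrable_test_function[OF \<psi>]])
  have "class_of (schroedinger V \<phi>) \<bullet> class_of \<psi> = (\<integral>x. schroedinger V \<phi> x * \<psi> x \<partial>lborel)"
    by (rule class_of_inner[OF sq_integrable_schroedinger[OF \<phi>] sq_integrable_test_function[OF \<psi>]])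
  also have "\<dots> = (\<integral>x. V x * \<phi> x * \<psi> x - (\<Sum>i\<in>Basis. partial i (partial i \<phi>) x * \<psi> x) \<partial>lborel)"
    by (simp add: schroedinger_def laplacian_def algebra_simps sum_distrib_left)
  also have "\<dots> = (\<integral>x. V x * \<phi> x * \<psi> x \<partial>lborel) - (\<Sum>i\<in>Basis. \<integral>x. partial i (partial i \<phi>) x * \<psi> x \<partial>lborel)"
    using i1 i3 by simp
  also have "(\<Sum>i\<in>Basis. \<integral>x. partial i (partial i \<phi>) x * \<psi> x \<partial>lborel)
      = (\<Sum>i\<in>Basis. - (\<integral>x. partial i \<phi> x * partial i \<psi> x \<partial>lborel))"
    by (intro sum.cong refl integration_by_parts[OF test_function_partial[OF \<phi>] \<psi>])
  also have "(\<integral>x. V x * \<phi> x * \<psi> x \<partial>lborel) - \<dots>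
      = (\<integral>x. (\<Sum>i\<in>Basis. partial i \<phi> x * partial i \<psi> x) + V x * \<phi> x * \<psi> x \<partial>lborel)"
    using i2 i3 by (simp add: sum_negf)
  finally show ?thesis .
qed

lemma schroedinger_sym:
  assumes "\<phi> \<in> test_functions \<Omega>" "\<psi> \<in> test_functions \<Omega>"
  shows "class_of (schroedinger V \<phi>) \<bullet> class_of \<psi> = class_of \<phi> \<bullet> class_of (schroedinger V \<psi>)"
  using inner_schroedinger[OF assms] inner_schroedinger[OF assms(2,1)]
  by (simp add: inner_commute[of "class_of \<phi>"] mult.commute mult.left_commute)

lemma schroedinger_form:
  assumes \<phi>: "\<phi> \<in> test_functions \<Omega>"
  shows "class_of (schroedinger V \<phi>) \<bullet> class_of \<phi> = (LINT x:\<Omega>|lborel. (norm (grad \<phi> x))\<^sup>2 + V x * \<bar>\<phi> x\<bar>\<^sup>2)"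
  unfolding inner_schroedinger[OF \<phi> \<phi>] set_lebesgue_integral_def
proof (intro Bochner_Integration.integral_cong refl)
  fix x
  have "(norm (grad \<phi> x))\<^sup>2 = (\<Sum>i\<in>Basis. partial i \<phi> x * partial i \<phi> x)"
    unfolding power2_norm_eq_inner by (subst euclidean_inner) (simp add: grad_def)
  moreover have "f x = 0" if "x \<notin> \<Omega>" "f \<in> test_functions \<Omega>" for f
    using test_function_support[OF that(2)] not_in_support[of x f] that(1) by blast
  then have "\<phi> x = 0 \<and> (\<forall>i\<in>Basis. partial i \<phi> x = 0)" if "x \<notin> \<Omega>"
    using that \<phi> test_function_partial[OF \<phi>] by blast
  ultimately show "(\<Sum>i\<in>Basis. partial i \<phi> x * partial i \<phi> x) + V x * \<phi> x * \<phi> x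
      = indicator \<Omega> x *\<^sub>R ((norm (grad \<phi> x))\<^sup>2 + V x * \<bar>\<phi> x\<bar>\<^sup>2)"
    by (cases "x \<in> \<Omega>") (simp_all add: power2_eq_square)
qed

lemma laplacian_add:
  assumes "\<phi> \<in> test_functions \<Omega>" "\<psi> \<in> test_functions \<Omega>"
  shows "laplacian (\<lambda>x. \<phi> x + \<psi> x) x = laplacian \<phi> x + laplacian \<psi> x"
proof -
  have "partial i (\<lambda>x. \<phi> x + \<psi> x) = (\<lambda>x. partial i \<phi> x + partial i \<psi> x)" for i
    by (intro ext partial_add test_function_differentiable[OF assms(1)] test_function_differentiable[OF assms(2)])
  then show ?thesis
    unfolding laplacian_def sum.distrib[symmetric]
    by (intro sum.cong refl)
       (simp add: partial_add test_function_differentiable[OF test_function_partial[OF assms(1)]]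
         test_function_differentiable[OF test_function_partial[OF assms(2)]])
qed

lemma laplacian_cmult:
  assumes "\<phi> \<in> test_functions \<Omega>" shows "laplacian (\<lambda>x. c * \<phi> x) x = c * laplacian \<phi> x"
proof -
  have "partial i (\<lambda>x. c * \<phi> x) = (\<lambda>x. c * partial i \<phi> x)" for i
    by (intro ext partial_cmult test_function_differentiable[OF assms(1)])
  then show ?thesis
    unfolding laplacian_def sum_distrib_left
    by (intro sum.cong refl)
       (simp add: partial_cmult test_function_differentiable[OF test_function_partial[OF assms(1)]])
qed

lemma subspace_S_min: "subspace (S_min \<Omega> V)"
proof (rule subspaceI)
  note sq = sq_integrable_test_function sq_integrable_schroedinger
  show scale: "c *\<^sub>R p \<in> S_min \<Omega> V" if "p \<in> S_min \<Omega> V" for c p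
  proof -
    from that obtain \<phi> where \<phi>: "\<phi> \<in> test_functions \<Omega>" "p = (class_of \<phi>, class_of (schroedinger V \<phi>))"
      by (auto simp: S_min_eq)
    have "schroedinger V (\<lambda>x. c * \<phi> x) = (\<lambda>x. c * schroedinger V \<phi> x)"
      by (rule ext) (simp add: schroedinger_def laplacian_cmult[OF \<phi>(1)] algebra_simps)
    then have "c *\<^sub>R p = (class_of (\<lambda>x. c * \<phi> x), class_of (schroedinger V (\<lambda>x. c * \<phi> x)))"
      by (simp add: \<phi> class_of_scale sq[OF \<phi>(1)])
    then show ?thesis using test_function_cmult[OF \<phi>(1), of c] unfolding S_min_eq by blast
  qed
  have "(class_of (\<lambda>x. 0), class_of (schroedinger V (\<lambda>x. 0))) \<in> S_min \<Omega> V"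
    unfolding S_min_eq using test_function_zero by blast
  from scale[OF this, of 0] show "0 \<in> S_min \<Omega> V" by (simp add: zero_prod_def)
  show "p + p' \<in> S_min \<Omega> V" if "p \<in> S_min \<Omega> V" "p' \<in> S_min \<Omega> V" for p p'
  proof -
    from that obtain \<phi> \<psi> where \<phi>: "\<phi> \<in> test_functions \<Omega>" "p = (class_of \<phi>, class_of (schroedinger V \<phi>))"
      and \<psi>: "\<psi> \<in> test_functions \<Omega>" "p' = (class_of \<psi>, class_of (schroedinger V \<psi>))"
      unfolding S_min_eq by blast
    have "schroedinger V (\<lambda>x. \<phi> x + \<psi> x) = (\<lambda>x. schroedinger V \<phi> x + schroedinger V \<psi> x)"
      by (rule ext) (simp add: schroedinger_def laplacian_add[OF \<phi>(1) \<psi>(1)] algebra_simps)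
    then have "p + p' = (class_of (\<lambda>x. \<phi> x + \<psi> x), class_of (schroedinger V (\<lambda>x. \<phi> x + \<psi> x)))"
      using class_of_add[OF sq(1)[OF \<phi>(1)] sq(1)[OF \<psi>(1)]] class_of_add[OF sq(2)[OF \<phi>(1)] sq(2)[OF \<psi>(1)]]
      by (simp add: \<phi> \<psi>)
    then show ?thesis using test_function_add[OF \<phi>(1) \<psi>(1)] unfolding S_min_eq by blast
  qed
qed

lemma S_min_L2: "S_min \<Omega> V \<subseteq> L2 \<Omega> \<times> L2 \<Omega>"
proof -
  have "class_of (schroedinger V \<phi>) \<in> L2 \<Omega>" if "\<phi> \<in> test_functions \<Omega>" for \<phi>
    using schroedinger_off_support[OF that] by (subst class_of_in_L2[OF sq_integrable_schroedinger[OF that]]) auto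
  then show ?thesis by (auto simp: S_min_eq class_of_test_function_L2)
qed

text \<open>Density of the test functions: the fundamental lemma gives vanishing inside
  \<open>\<Omega>\<close>, membership in \<open>L2 \<Omega>\<close> gives it outside.\<close>

lemma S_min_total:
  assumes f: "f \<in> L2 \<Omega>" and ortho: "\<And>p. p \<in> S_min \<Omega> V \<Longrightarrow> f \<bullet> fst p = 0"
  shows "f = 0"
proof -
  note sq = sq_integrable_rep[of f]
  have "(\<integral>x. rep_l2 f x * \<phi> x \<partial>lborel) = 0" if \<phi>: "\<phi> \<in> test_functions \<Omega>" for \<phi>
  proof -
    have "f \<bullet> class_of \<phi> = 0" using ortho[of "(class_of \<phi>, class_of (schroedinger V \<phi>))"] \<phi> unfolding S_min_eq by auto
    then show ?thesis using class_of_inner[OF sq sq_integrable_test_function[OF \<phi>]] by (simp add: class_of_rep)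
  qed
  then have "AE x in lborel. x \<in> \<Omega> \<longrightarrow> rep_l2 f x = 0" by (rule AE_eq_0_of_orthogonal[OF \<Omega> sq])
  moreover have "AE x in lborel. x \<notin> \<Omega> \<longrightarrow> rep_l2 f x = 0"
    using f class_of_in_L2[OF sq, of \<Omega>] by (simp add: class_of_rep)
  ultimately have "AE x in lborel. rep_l2 f x = 0" by eventually_elim blast
  then show ?thesis using class_of_eq_0[OF sq] by (simp add: class_of_rep)
qed

end

section \<open>Proof of the theorem\<close>

text \<open>The spectral measure in the definition of the functional calculus is a choice, so its existence
  has to be established before anything can be said about fractional powers.\<close>

lemma friedrichs_spectral_measure:
  fixes K :: "'h::{real_inner,complete_space} set"
  assumes "nonneg_symmetric K T"
  shows "projection_valued_measure K (spectral_measure_of K (friedrichs K T))"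
    and "spectral_integral K (spectral_measure_of K (friedrichs K T)) (\<lambda>l. l) = friedrichs K T"
proof -
  interpret nonneg_symmetric K T by fact
  interpret R: resolvent A K
  proof (intro resolvent.intro positive_contraction.intro resolvent_axioms.intro)
    show "linear A" by (rule linear_A)
    show "A x \<bullet> y = x \<bullet> A y" for x y by (rule A_sym)
    show "0 \<le> A x \<bullet> x" for x using A_bounds(1)[of x] zero_le_power2 order_trans by blast
    show "A x \<bullet> x \<le> x \<bullet> x" for x by (rule A_bounds(2))
    show "subspace K" "closed K" by (rule subspace_K closed_K)+
    show "A x \<in> K" for x by (rule A_in_K)
    show "x = 0" if "x \<in> K" "A x = 0" for x using that by (rule A_inj)
  qed
  have "\<exists>E. projection_valued_measure K E \<and> spectral_integral K E (\<lambda>l. l) = friedrichs K T"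
    using R.pvm_E R.spectral_integral_E friedrichs_eq by metis
  from someI_ex[OF this]
  show "projection_valued_measure K (spectral_measure_of K (friedrichs K T))"
    and "spectral_integral K (spectral_measure_of K (friedrichs K T)) (\<lambda>l. l) = friedrichs K T"
    unfolding spectral_measure_of_def by blast+
qed

lemma nonneg_symmetric_S_min:
  assumes \<Omega>: "open \<Omega>" and V: "continuous_on \<Omega> V"
    and form: "\<forall>u\<in>test_functions \<Omega>. 0 \<le> (LINT x:\<Omega>|lborel. (norm (grad u x))\<^sup>2 + V x * \<bar>u x\<bar>\<^sup>2)"
  shows "nonneg_symmetric (L2 \<Omega>) (S_min \<Omega> V)"
proof
  show "subspace (S_min \<Omega> V)" by (rule subspace_S_min[OF \<Omega> V])
  show "subspace (L2 \<Omega>)" by (rule subspace_L2)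
  show "closed (L2 \<Omega>)" using \<Omega> by (intro closed_L2) simp
  show "S_min \<Omega> V \<subseteq> L2 \<Omega> \<times> L2 \<Omega>" by (rule S_min_L2[OF \<Omega> V])
  show "snd p \<bullet> fst p' = fst p \<bullet> snd p'" if "p \<in> S_min \<Omega> V" "p' \<in> S_min \<Omega> V" for p p'
    using that schroedinger_sym[OF \<Omega> V] unfolding S_min_eq by auto
  show "0 \<le> snd p \<bullet> fst p" if "p \<in> S_min \<Omega> V" for p
    using that form schroedinger_form[OF \<Omega> V] unfolding S_min_eq by auto
  show "f = 0" if "f \<in> L2 \<Omega>" "\<And>p. p \<in> S_min \<Omega> V \<Longrightarrow> f \<bullet> fst p = 0" for f
    using that by (rule S_min_total[OF \<Omega> V])
qed

theorem theorem1p5: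
  fixes \<Omega> :: "'a::euclidean_space set" and V :: "'a \<Rightarrow> real" and \<alpha>s :: real
    and S :: "('a l2 \<times> 'a l2) set"
  assumes "open \<Omega>" and "connected \<Omega>" and "\<Omega> \<noteq> {}"
    and "continuous_on \<Omega> V"
    and "\<forall>u\<in>test_functions \<Omega>.
           0 \<le> (LINT x:\<Omega>|lborel. (norm (grad u x))\<^sup>2 + V x * \<bar>u x\<bar>\<^sup>2)"
    and "S = friedrichs (L2 \<Omega>) (S_min \<Omega> V)"
    and "0 < \<alpha>s" and "\<alpha>s \<le> 1 / 2"
    and "\<forall>g\<in>test_functions \<Omega>. \<forall>w. wave_solution S (class_of g) w \<longrightarrow>
           (\<lambda>t. t powr (2 * \<alpha>s - 1) *\<^sub>R w t) \<in> Linf_half_line"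
  shows "{0<..<\<alpha>s} \<subseteq> I_set \<Omega> S"
proof
  fix \<alpha> assume "\<alpha> \<in> {0<..<\<alpha>s}"
  then have \<alpha>: "0 < \<alpha>" "\<alpha> < \<alpha>s" by auto
  interpret F: nonneg_symmetric "L2 \<Omega>" "S_min \<Omega> V"
    by (rule nonneg_symmetric_S_min[OF assms(1,4,5)])
  define E where "E = spectral_measure_of (L2 \<Omega>) S"
  note spec = friedrichs_spectral_measure[OF F.nonneg_symmetric_axioms, folded assms(6), folded E_def]
  interpret nonneg_pvm "L2 \<Omega>" E
  proof
    show "projection_valued_measure (L2 \<Omega>) E" by (rule spec(1))
    show "0 \<le> y \<bullet> x" if "(x, y) \<in> spectral_integral (L2 \<Omega>) E (\<lambda>l. l)" for x y
      using that F.friedrichs_nonneg unfolding spec(2) assms(6) by blast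
  qed
  obtain x0 where "x0 \<in> \<Omega>" using assms(3) by blast
  with assms(1) obtain a b where ab: "cbox a b \<subseteq> \<Omega>" "\<forall>i\<in>Basis. a \<bullet> i < b \<bullet> i" by (rule open_contains_cbox)
  \<comment> \<open>As a test function it is subject to the decay hypothesis; as a bump it is
    nonnegative, and nonzero on a box of positive measure.\<close>
  define \<phi> where "\<phi> = box_bump 1 a b"
  have \<phi>: "\<phi> \<in> test_functions \<Omega>" unfolding \<phi>_def by (rule box_bump_test_function[OF _ ab(1)]) simp
  define g where "g = class_of \<phi>"
  have nonneg: "g \<in> L2_nonneg \<Omega>"
    using class_of_test_function_L2[OF \<phi>] class_of_nonneg_ae[OF sq_integrable_test_function[OF \<phi>]]
    by (simp add: g_def L2_nonneg_def \<phi>_def box_bump_nonneg)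
  have "g \<noteq> 0"
  proof
    assume "g = 0"
    then have "AE x in lborel. \<phi> x = 0" using class_of_eq_0[OF sq_integrable_test_function[OF \<phi>]] by (simp add: g_def)
    then have "AE x in lborel. x \<notin> box a b" by eventually_elim (simp add: \<phi>_def box_bump_eq_0)
    then have "emeasure lborel (box a b) = 0" by (subst (asm) AE_iff_measurable[of "box a b"]) auto
    moreover have "0 < emeasure lborel (box a b)"
      using ab(2) by (subst emeasure_lborel_box) (auto simp: less_imp_le inner_diff_left intro!: prod_pos)
    ultimately show False by simp
  qed
  have gS: "(g, class_of (schroedinger V \<phi>)) \<in> S"
    using F.T_subset_friedrichs \<phi> unfolding assms(6) g_def S_min_eq by blast
  then have gS': "(g, class_of (schroedinger V \<phi>)) \<in> spectral_integral (L2 \<Omega>) E (\<lambda>l. l)"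
    by (simp add: spec(2))
  \<comment> \<open>The decay hypothesis quantifies over all solutions, so it applies to this
    explicit one, whose norm is computed by the spectral measure of \<open>g\<close>.\<close>
  have "wave_solution S g (\<lambda>t. Phi (wsin t) g)"
    using wave_solution_exists[OF gS'] by (simp add: spec(2))
  then have "(\<lambda>t. t powr (2 * \<alpha>s - 1) *\<^sub>R Phi (wsin t) g) \<in> Linf_half_line"
    using assms(9) \<phi> by (simp add: g_def)
  then obtain C where "AE t in lebesgue_on {0<..}. norm (t powr (2 * \<alpha>s - 1) *\<^sub>R Phi (wsin t) g) \<le> C"
    unfolding Linf_half_line_def by blast
  moreover have "g \<in> L2 \<Omega>" using nonneg by (simp add: L2_nonneg_def)
  ultimately have "g \<in> spectral_domain (L2 \<Omega>) E (ipow \<alpha>)" "measure (M g) {0} = 0"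
    using wave_decay_imp_spectral_domain[OF _ \<alpha> assms(8)] by blast+
  then obtain x where "(x, g) \<in> spectral_integral (L2 \<Omega>) E (\<lambda>l. l powr \<alpha>)"
    using fractional_power_surj by blast
  then have "g \<in> Range (fractional_power (L2 \<Omega>) S \<alpha>)"
    unfolding fractional_power_def functional_calculus_def E_def[symmetric] by blast
  then show "\<alpha> \<in> I_set \<Omega> S"
    using nonneg \<open>g \<noteq> 0\<close> \<alpha>(1) unfolding I_set_def by blast
qed

end
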